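(* Let $1<p<\infty$ and let $f\in L^p(T)$. Let $$S_N^{T}f:=\sum_{(m,n)\in\mathcal{U}_N}f_a^{\triangle}(m,n)\,u_{m,n}+\sum_{(m,n)\in\mathcal{V}_N}f_s^{\triangle}(m,n)\,v_{m,n}.$$ Then $S_N^Tf\to f$ in $L^p(T)$ as $N\to\infty$.
   Context: $T\subset\mathbb{R}^2$ is the equilateral triangle with vertices $(-1/\sqrt3,0)$, $(1/\sqrt3,0)$, $(0,1)$, and $T_1$ is its right-hand half, the hemiequilateral triangle with vertices $(0,0)$, $(1/\sqrt3,0)$, $(0,1)$. Functions are real-valued and $L^p$ is with respect to Lebesgue measure. The antisymmetric and symmetric parts of $f$ are $$f_a(x,y):=\frac{f(x,y)-f(-x,y)}{2},\qquad f_s(x,y):=\frac{f(x,y)+f(-x,y)}{2},\qquad (x,y)\in T.$$ For integers $0<m<n$ with $m\equiv n \pmod 2$ define, for $(x,y)\in T$, $$\begin{aligned}u_{m,n}(x,y)&:=2\sin\left(\frac{\pi m x}{\sqrt{3}}\right)\sin(\pi n y)\\&\quad-2(-1)^{(m+n)/2}\sin\left(\frac{\pi x}{2\sqrt{3}}(m+3n)\right)\sin\left(\frac{\pi y}{2}(m-n)\right)\\&\quad+2(-1)^{(m-n)/2}\sin\left(\frac{\pi x}{2\sqrt{3}}(m-3n)\right)\sin\left(\frac{\pi y}{2}(m+n)\right),\end{aligned}$$ and for integers $0\leq m<n$ with $m\equiv n \pmod 2$ define, for $(x,y)\in T$, $$\begin{aligned}v_{m,n}(x,y)&:=2\cos\left(\frac{\pi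 m x}{\sqrt{3}}\right)\sin(\pi n y)\\&\quad+2(-1)^{(m+n)/2}\cos\left(\frac{\pi x}{2\sqrt{3}}(m+3n)\right)\sin\left(\frac{\pi y}{2}(m-n)\right)\\&\quad-2(-1)^{(m-n)/2}\cos\left(\frac{\pi x}{2\sqrt{3}}(3n-m)\right)\sin\left(\frac{\pi y}{2}(m+n)\right).\end{aligned}$$ (These are eigenfunctions of the Dirichlet Laplacian on $T$, respectively odd and even in $x$.) The coefficients are $$f_a^{\triangle}(m,n):=\frac{2}{\sqrt3}\int_{T_1}f_a\,u_{m,n},\qquad f_s^{\triangle}(m,n):=\frac{1}{\|v_{m,n}\|_{L^2(T_1)}^2}\int_{T_1}f_s\,v_{m,n},$$ where $2/\sqrt3=1/\|u_{m,n}\|_{L^2(T_1)}^2$. The index sets are $$\mathcal{U}_N:=\{(m,n)\in\mathbb{Z}^2: 0<m<n\leq N,\ m\equiv n \pmod 2\},\qquad \mathcal{V}_N:=\{(m,n)\in\mathbb{Z}^2: 0\leq m<n\leq N,\ m\equiv n \pmod 2\}.$$ *)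

theory Defs
  imports "HOL-Analysis.Analysis" "HOL-Number_Theory.Cong"
begin

text \<open>
  Elements of \<open>L\<^sup>p(S)\<close> are represented by functions on the whole plane, of which only the
  restriction to \<open>S\<close> matters, and which need not be identified almost everywhere.
  The exponent \<open>p\<close> is finite and positive.
\<close>

definition Lp_space :: "real \<Rightarrow> (real \<times> real) set \<Rightarrow> (real \<times> real \<Rightarrow> real) set" where
  "Lp_space p S = {f. f \<in> borel_measurable (lebesgue_on S) \<and>
                      integrable (lebesgue_on S) (\<lambda>z. \<bar>f z\<bar> powr p)}"

definition Lp_norm :: "real \<Rightarrow> (real \<times> real) set \<Rightarrow> (real \<times> real \<Rightarrow> real) \<Rightarrow> real" where
  "Lp_norm p S f = (LINT z|lebesgue_on S. \<bar>f z\<bar> powr p) powr (1 / p)"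

text \<open>
  Membership in \<open>L\<^sup>p\<close> is part of convergence, since the Bochner integral of a
  non-integrable function is \<open>0\<close>.
\<close>

definition converges_in_Lp ::
    "real \<Rightarrow> (real \<times> real) set \<Rightarrow> (nat \<Rightarrow> real \<times> real \<Rightarrow> real) \<Rightarrow> (real \<times> real \<Rightarrow> real) \<Rightarrow> bool" where
  "converges_in_Lp p S F f \<longleftrightarrow>
     f \<in> Lp_space p S \<and> (\<forall>N. F N \<in> Lp_space p S) \<and>
     (\<lambda>N. Lp_norm p S (\<lambda>z. F N z - f z)) \<longlonglongrightarrow> 0"

definition equi_triangle :: "(real \<times> real) set" where
  "equi_triangle = convex hull {(- 1 / sqrt 3, 0), (1 / sqrt 3, 0), (0, 1)}"

definition hemi_triangle :: "(real \<times> real) set" where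
  "hemi_triangle = convex hull {(0, 0), (1 / sqrt 3, 0), (0, 1)}"

definition antisym_part :: "(real \<times> real \<Rightarrow> real) \<Rightarrow> real \<times> real \<Rightarrow> real" where
  "antisym_part f = (\<lambda>(x, y). (f (x, y) - f (- x, y)) / 2)"

definition sym_part :: "(real \<times> real \<Rightarrow> real) \<Rightarrow> real \<times> real \<Rightarrow> real" where
  "sym_part f = (\<lambda>(x, y). (f (x, y) + f (- x, y)) / 2)"

text \<open>
  Only used for \<open>m\<close> and \<open>n\<close> of the same parity, where the integer divisions are exact.
\<close>

definition u_fun :: "int \<Rightarrow> int \<Rightarrow> real \<times> real \<Rightarrow> real" where
  "u_fun m n = (\<lambda>(x, y).
       2 * sin (pi * of_int m * x / sqrt 3) * sin (pi * of_int n * y)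
     - 2 * (- 1) powi ((m + n) div 2)
         * sin (pi * x / (2 * sqrt 3) * of_int (m + 3 * n)) * sin (pi * y / 2 * of_int (m - n))
     + 2 * (- 1) powi ((m - n) div 2)
         * sin (pi * x / (2 * sqrt 3) * of_int (m - 3 * n)) * sin (pi * y / 2 * of_int (m + n)))"

definition v_fun :: "int \<Rightarrow> int \<Rightarrow> real \<times> real \<Rightarrow> real" where
  "v_fun m n = (\<lambda>(x, y).
       2 * cos (pi * of_int m * x / sqrt 3) * sin (pi * of_int n * y)
     + 2 * (- 1) powi ((m + n) div 2)
         * cos (pi * x / (2 * sqrt 3) * of_int (m + 3 * n)) * sin (pi * y / 2 * of_int (m - n))
     - 2 * (- 1) powi ((m - n) div 2)
         * cos (pi * x / (2 * sqrt 3) * of_int (3 * n - m)) * sin (pi * y / 2 * of_int (m + n)))"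

definition antisym_coeff :: "(real \<times> real \<Rightarrow> real) \<Rightarrow> int \<Rightarrow> int \<Rightarrow> real" where
  "antisym_coeff f m n =
     2 / sqrt 3 * (LINT z|lebesgue_on hemi_triangle. antisym_part f z * u_fun m n z)"

definition sym_coeff :: "(real \<times> real \<Rightarrow> real) \<Rightarrow> int \<Rightarrow> int \<Rightarrow> real" where
  "sym_coeff f m n =
     1 / (Lp_norm 2 hemi_triangle (v_fun m n))\<^sup>2
       * (LINT z|lebesgue_on hemi_triangle. sym_part f z * v_fun m n z)"

definition U_index :: "nat \<Rightarrow> (int \<times> int) set" where
  "U_index N = {(m, n). 0 < m \<and> m < n \<and> n \<le> int N \<and> [m = n] (mod 2)}"

definition V_index :: "nat \<Rightarrow> (int \<times> int) set" where
  "V_index N = {(m, n). 0 \<le> m \<and> m < n \<and> n \<le> int N \<and> [m = n] (mod 2)}"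

lemma finite_V_index: "finite (V_index N)"
  by (rule finite_subset[of _ "{0..int N} \<times> {0..int N}"]) (auto simp: V_index_def)

lemma finite_U_index: "finite (U_index N)"
  by (rule finite_subset[OF _ finite_V_index[of N]]) (auto simp: U_index_def V_index_def)

definition partial_sum :: "nat \<Rightarrow> (real \<times> real \<Rightarrow> real) \<Rightarrow> real \<times> real \<Rightarrow> real" where
  "partial_sum N f z =
     (\<Sum>(m, n)\<in>U_index N. antisym_coeff f m n * u_fun m n z) +
     (\<Sum>(m, n)\<in>V_index N. sym_coeff f m n * v_fun m n z)"

end

theory Submission
  imports Defs "HOL-Complex_Analysis.Complex_Analysis"
begin

text \<open>
  In coordinates with origin at the vertex \<open>(0, 1)\<close> the functions \<open>u\<^bsub>m,n\<^esub>\<close> and \<open>v\<^bsub>m,n\<^esub>\<close> are the exponential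
  sums that are odd under the affine reflection group of \<open>T\<close> and, respectively, odd and even in \<open>x\<close>.
  The orbit of the frequency \<open>(m, n)\<close> lies in the hexagon \<open>\<bar>l\<bar> \<le> N\<close>, \<open>\<bar>k \<plusminus> l\<bar> \<le> 2N\<close> exactly when \<open>n \<le> N\<close>, and
  otherwise misses it. So on finite combinations of the \<open>u\<^bsub>m,n\<^esub>\<close> (or \<open>v\<^bsub>m,n\<^esub>\<close>) the partial sum is a product
  of three strip truncations on a torus. By shears each of these is a one-dimensional truncation,
  which is bounded in \<open>L\<^sup>p\<close> by M. Riesz' theorem.

  For \<open>1 < p \<le> 2\<close> the latter follows from \<open>\<bar>w\<bar>\<^sup>p \<le> A (Re w)\<^sup>p - B Re (w\<^sup>p)\<close> for \<open>Re w > 0\<close> and the mean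
  value property; duality on the triangle gives \<open>p > 2\<close>. Convergence follows because finite
  combinations are dense: they form a module over the invariant functions \<open>cos 2X + 2 cos X cos Y\<close>
  and \<open>cos 2Y + 2 cos 3X cos Y\<close>, which separate the points of the half triangle, so that
  the Stone-Weierstrass theorem applies.
\<close>

section \<open>Riesz projections of trigonometric polynomials\<close>

text \<open>A combination w of modes changes only by a sign under the symmetries of the tiling, so
  |w|^p is invariant, and its integral over the torus is a fixed multiple of that over the half
  triangle. This carries the torus bound to the triangle, but for combinations of modes only. For
  fixed N the partial sum, being given by integrals, is continuous on L^p with a constant that may
  depend on N. Since that constant multiplies only the distance from f to a combination, which can
  be made as small as desired after N is fixed, the uniform bound extends to all of L^p.

  Density meets an obstacle: every mode vanishes on at least two sides of the half triangle, so the
  span contains no constants and the Stone-Weierstrass theorem does not apply to it. It is applied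
  to the functions that multiply the span into itself. A target f is then written as
  \<open>\<rho> * (f / \<rho>)\<close> with a mode \<open>\<rho>\<close> free of zeros inside, the
  quotient being regularised by \<open>\<rho> / (\<rho>^2 + t)\<close>.

  The pointwise inequality behind the Riesz bound needs \<open>cos (p * pi / 2) < 0\<close>, which
  holds for 1 < p <= 2 but fails at p = 3. Large exponents therefore go through duality.\<close>

lemma integral_circle_mean_value:
  assumes "f holomorphic_on cball 0 1"
  shows "((\<lambda>t. f (cis t)) has_integral of_real (2 * pi) * f 0) {0..2*pi}"
proof -
  have "((\<lambda>u. f u / (u - 0)) has_contour_integral (2 * of_real pi * \<i> * f 0)) (circlepath 0 1)"
    by (rule Cauchy_integral_circlepath_simple[OF assms]) simp
  then have "((\<lambda>t. f (cis t) / cis t * \<i> * cis t) has_integral (2 * of_real pi * \<i> * f 0)) {0..2*pi}"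
    by (simp add: circlepath_def has_contour_integral_part_circlepath_iff)
  then have "((\<lambda>t. \<i> * f (cis t)) has_integral (2 * of_real pi * \<i> * f 0)) {0..2*pi}"
    by (simp add: field_simps)
  from has_integral_mult_right[OF this, of "- \<i>"] show ?thesis
    by (simp add: field_simps)
qed

text \<open>The maximum principle for the real part of -Q. Positivity in the whole disc keeps the
  values of Q off the cut of the principal branch, so that Q^p is holomorphic there.\<close>

lemma Re_pos_cball:
  fixes Q :: "complex poly"
  assumes "\<And>w. norm w = 1 \<Longrightarrow> 0 < Re (poly Q w)" "z \<in> cball 0 1"
  shows "0 < Re (poly Q z)"
proof -
  have "compact (sphere (0::complex) 1)" by simp
  moreover have "sphere (0::complex) 1 \<noteq> {}" by auto
  moreover have "continuous_on (sphere 0 1) (\<lambda>w. Re (poly Q w))" by (intro continuous_intros)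
  ultimately obtain w0 where w0: "w0 \<in> sphere 0 1" "\<And>w. w \<in> sphere 0 1 \<Longrightarrow> Re (poly Q w0) \<le> Re (poly Q w)"
    using continuous_attains_inf[of "sphere 0 1" "\<lambda>w. Re (poly Q w)"] by blast
  have "Re (- poly Q z) \<le> - Re (poly Q w0)"
  proof (rule maximum_real_frontier[of "\<lambda>z. - poly Q z" "cball 0 1"])
    show "(\<lambda>z. - poly Q z) holomorphic_on interior (cball 0 1)" by (intro holomorphic_intros)
    show "continuous_on (closure (cball 0 1)) (\<lambda>z. - poly Q z)" by (intro continuous_intros)
    show "bounded (cball (0::complex) 1)" by simp
    show "Re (- poly Q z) \<le> - Re (poly Q w0)" if "z \<in> frontier (cball 0 1)" for z
      using w0(2)[of z] that by simp
    show "z \<in> cball 0 1" by fact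
  qed
  moreover have "0 < Re (poly Q w0)" using assms(1) w0(1) by auto
  ultimately show ?thesis by simp
qed

text \<open>The threshold is chosen so that p times it is the midpoint of pi/2 and p pi/2. Beyond it
  the angle p \<phi> stays in (pi/2, pi], at a fixed distance from pi/2.\<close>

lemma cos_mult_le_neg:
  fixes p \<phi> :: real
  assumes "1 < p" "p \<le> 2" "pi * (p + 1) / (4 * p) \<le> \<phi>" "\<phi> \<le> pi / 2"
  shows "cos (p * \<phi>) \<le> cos (pi * (p + 1) / 4)"
proof (rule cos_monotone_0_pi_le)
  show "pi * (p + 1) / 4 \<le> p * \<phi>" using assms by (simp add: field_simps)
  show "0 \<le> pi * (p + 1) / 4" using assms by simp
  have "0 \<le> \<phi>" using assms by (intro order_trans[OF _ assms(3)]) simp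
  have "p * \<phi> \<le> 2 * (pi / 2)" using assms \<open>0 \<le> \<phi>\<close> by (intro mult_mono) auto
  then show "p * \<phi> \<le> pi" by simp
qed

text \<open>Around the real axis Re w is comparable with |w|. In the rest of the half plane Re (w^p)
  is at most a negative multiple of |w|^p. The condition \<open>1 \<le> B\<close> is for
  \<open>Riesz_positive\<close>.\<close>

lemma powr_norm_le_right_halfplane:
  assumes p: "1 < p" "p \<le> 2"
  obtains A B :: real where "1 \<le> B" "0 < A"
    "\<And>w. 0 < Re w \<Longrightarrow> norm w powr p \<le> A * Re w powr p - B * Re (w powr of_real p)"
proof -
  define g where "g = pi * (p + 1) / (4 * p)"
  define d where "d = - cos (pi * (p + 1) / 4)"
  have g: "0 < g" using p by (auto simp: g_def)
  have g: "0 < g" "g < pi / 2" using p g by (auto simp: g_def field_simps)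
  have d: "0 < d"
  proof -
    have "pi * 2 < pi * (p + 1)" "pi * (p + 1) \<le> pi * 3" using p by (auto intro!: mult_left_mono)
    then have "pi / 2 < pi * (p + 1) / 4" "pi * (p + 1) / 4 < pi" using pi_gt_zero by linarith+
    then show ?thesis using cos_lt_zero_pi[of "pi * (p + 1) / 4"] cos_monotone_0_pi[of "pi/2" "pi * (p + 1) / 4"] by (simp add: d_def)
  qed
  have cg: "0 < cos g" using g by (intro cos_gt_zero) auto
  \<comment> \<open>\<open>B\<close> settles the sector near the imaginary axis, where
    \<open>cos (p * \<phi>) \<le> - d\<close>. \<open>A\<close> then also pays for the term of size
    at most \<open>B\<close> that is lost in the sector near the real axis.\<close>
  define B where "B = max 1 (1 / d)"
  define A where "A = (1 + B) / cos g powr p"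
  have B: "1 \<le> B" "1 / d \<le> B" by (auto simp: B_def)
  have A: "0 < A" using B cg by (auto simp: A_def)
  have "norm w powr p \<le> A * Re w powr p - B * Re (w powr of_real p)" if w: "0 < Re w" for w
  proof -
    define r where "r = norm w"
    define \<phi> where "\<phi> = Arg w"
    have w0: "w \<noteq> 0" using w by auto
    have r: "0 < r" using w0 by (simp add: r_def)
    have phi: "\<bar>\<phi>\<bar> < pi / 2" using w Re_Ln_pos_lt[OF w0] by (simp add: \<phi>_def Arg_eq_Im_Ln w0)
    have Rew: "Re w = r * cos \<phi>"
      using w0 by (simp add: r_def \<phi>_def cos_Arg)
    have "w powr of_real p = exp (of_real p * Ln w)" using w0 by (simp add: powr_def)
    also have "Re \<dots> = exp (p * ln r) * cos (p * \<phi>)"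
      using w0 by (simp add: Re_exp r_def \<phi>_def Arg_eq_Im_Ln)
    also have "exp (p * ln r) = r powr p" using r by (simp add: powr_def)
    finally have Rp: "Re (w powr of_real p) = r powr p * cos (p * \<phi>)" .
    have cp: "0 < cos \<phi>" using phi by (intro cos_gt_zero_pi) auto
    have Rwp: "Re w powr p = r powr p * cos \<phi> powr p"
      unfolding Rew using r cp by (simp add: powr_mult)
    have "1 \<le> A * cos \<phi> powr p - B * cos (p * \<phi>)"
    proof (cases "\<bar>\<phi>\<bar> < g")
      case True
      have "cos g \<le> cos \<bar>\<phi>\<bar>" using True g by (intro cos_monotone_0_pi_le) auto
      then have "cos g powr p \<le> cos \<phi> powr p" using cg p by (intro powr_mono2) auto
      then have "(1 + B) * cos g powr p \<le> (1 + B) * cos \<phi> powr p" using B by (intro mult_left_mono) auto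
      then have "1 + B \<le> A * cos \<phi> powr p" using cg by (simp add: A_def pos_le_divide_eq)
      moreover have "B * cos (p * \<phi>) \<le> B * 1" using B by (intro mult_left_mono) auto
      ultimately show ?thesis by simp
    next
      case False
      have "cos (p * \<phi>) = cos (p * \<bar>\<phi>\<bar>)" by (simp add: abs_if)
      also have "\<dots> \<le> - d" unfolding d_def using cos_mult_le_neg[OF p, of "\<bar>\<phi>\<bar>"] False phi by (simp add: g_def)
      finally have "B * d \<le> B * - cos (p * \<phi>)" using B by (intro mult_left_mono) auto
      moreover have "1 \<le> B * d" using B d by (simp add: field_simps)
      moreover have "0 \<le> A * cos \<phi> powr p" using A by simp
      ultimately show ?thesis by simp
    qed
    then have "r powr p * 1 \<le> r powr p * (A * cos \<phi> powr p - B * cos (p * \<phi>))"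
      by (intro mult_left_mono) auto
    then show ?thesis unfolding Rwp Rp r_def[symmetric] by (simp add: algebra_simps)
  qed
  with A B that show ?thesis by blast
qed

text \<open>Stands in for Minkowski's inequality: the estimates concern p-th powers of norms up to
  constants, so the factor 2^p is harmless.\<close>

lemma abs_add_powr_le:
  fixes a b p :: real
  assumes "0 \<le> p" "0 \<le> a" "0 \<le> b"
  shows "(a + b) powr p \<le> 2 powr p * (a powr p + b powr p)"
proof -
  have "(a + b) powr p \<le> (2 * max a b) powr p" using assms by (intro powr_mono2) auto
  also have "\<dots> = 2 powr p * max a b powr p" using assms by (simp add: powr_mult)
  also have "\<dots> \<le> 2 powr p * (a powr p + b powr p)" by (intro mult_left_mono) (auto simp: max_def)
  finally show ?thesis .
qed

lemma norm_add_powr_le: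
  fixes a b :: "'a::real_normed_vector"
  assumes "0 \<le> p"
  shows "norm (a + b) powr p \<le> 2 powr p * (norm a powr p + norm b powr p)"
proof -
  have "norm (a + b) powr p \<le> (norm a + norm b) powr p"
    using assms by (intro powr_mono2 norm_triangle_ineq) auto
  also have "\<dots> \<le> 2 powr p * (norm a powr p + norm b powr p)"
    using assms by (intro abs_add_powr_le) auto
  finally show ?thesis .
qed

text \<open>For real Q(0), the function Q + Q(0) is twice the projection of Re Q to the frequencies
  >= 0. In the half-plane inequality the integral of Re (Q^p) is 2 pi Q(0)^p by the mean value
  property, which is positive and enters with a minus sign.\<close>

lemma Riesz_positive:
  assumes p: "1 < p" "p \<le> 2"
  obtains C :: real where "0 < C" 
    "\<And>Q. (\<And>w. norm w = 1 \<Longrightarrow> 0 < Re (poly Q w)) \<Longrightarrow> Im (poly Q 0) = 0 \<Longrightarrow>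
      integral {0..2*pi} (\<lambda>t. norm (poly Q (cis t) + poly Q 0) powr p)
        \<le> C * integral {0..2*pi} (\<lambda>t. Re (poly Q (cis t)) powr p)"
proof -
  obtain A B :: real where AB: "1 \<le> B" "0 < A"
    "\<And>w. 0 < Re w \<Longrightarrow> norm w powr p \<le> A * Re w powr p - B * Re (w powr of_real p)"
    using powr_norm_le_right_halfplane[OF p] by metis
  show ?thesis
  proof (rule that[of "2 powr p * A"])
    show "0 < 2 powr p * A" using AB by simp
    fix Q :: "complex poly" assume Q: "\<And>w. norm w = 1 \<Longrightarrow> 0 < Re (poly Q w)" and Im0: "Im (poly Q 0) = 0"
    define q where "q = Re (poly Q 0)"
    have q: "poly Q 0 = of_real q" using Im0 by (simp add: q_def complex_eq_iff)
    have Qpos: "0 < Re (poly Q z)" if "z \<in> cball 0 1" for z using Re_pos_cball[OF Q that] by blast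
    have q0: "0 < q" using Qpos[of 0] by (simp add: q_def)
    have "(\<lambda>z. poly Q z powr of_real p) holomorphic_on cball 0 1"
    proof (intro holomorphic_intros)
      show "poly Q z \<notin> \<real>\<^sub>\<le>\<^sub>0" if "z \<in> cball 0 1" for z
        using Qpos[OF that] by (auto simp: complex_nonpos_Reals_iff)
    qed
    from integral_circle_mean_value[OF this]
    have "((\<lambda>t. poly Q (cis t) powr of_real p) has_integral of_real (2 * pi * q powr p)) {0..2*pi}"
      using q0 by (simp add: q powr_of_real)
    then have "((Re \<circ> (\<lambda>t. poly Q (cis t) powr of_real p)) has_integral Re (of_real (2 * pi * q powr p))) {0..2*pi}"
      by (rule has_integral_linear) (rule bounded_linear_Re)
    then have I1: "((\<lambda>t. Re (poly Q (cis t) powr of_real p)) has_integral 2 * pi * q powr p) {0..2*pi}"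
      by (simp add: o_def)
    have ne: "poly Q (cis t) \<noteq> 0" "0 < Re (poly Q (cis t))" for t using Q[of "cis t"] by auto
    define U where "U = integral {0..2*pi} (\<lambda>t. Re (poly Q (cis t)) powr p)"
    have ccis: "continuous_on S cis" for S by (rule continuous_on_cis) (rule continuous_on_id)
    have contU: "continuous_on {0..2*pi} (\<lambda>t. Re (poly Q (cis t)) powr p)"
      using ne(2) by (intro continuous_intros continuous_on_powr' ccis) (auto intro: less_imp_le simp: less_imp_neq[THEN not_sym])
    have I2: "((\<lambda>t. Re (poly Q (cis t)) powr p) has_integral U) {0..2*pi}"
      unfolding U_def by (intro integrable_integral integrable_continuous_interval contU)
    have I3: "((\<lambda>t. 2 powr p * (A * Re (poly Q (cis t)) powr p - B * Re (poly Q (cis t) powr of_real p) + q powr p))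
        has_integral 2 powr p * (A * U - B * (2 * pi * q powr p) + 2 * pi * q powr p)) {0..2*pi}"
      using has_integral_const_real[of "q powr p" 0 "2*pi"] 
      by (intro has_integral_mult_right has_integral_add has_integral_diff I1 I2) simp
    have "continuous_on {0..2*pi} (\<lambda>t. norm (poly Q (cis t) + poly Q 0) powr p)"
      using p by (intro continuous_intros continuous_on_powr' ccis) auto
    then have "integral {0..2*pi} (\<lambda>t. norm (poly Q (cis t) + poly Q 0) powr p)
      \<le> 2 powr p * (A * U - B * (2 * pi * q powr p) + 2 * pi * q powr p)"
    proof (rule has_integral_le[OF integrable_integral[OF integrable_continuous_interval] I3])
      fix t
      have "norm (poly Q (cis t) + poly Q 0) powr p \<le> 2 powr p * (norm (poly Q (cis t)) powr p + norm (poly Q 0) powr p)"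
        using p by (intro norm_add_powr_le) auto
      also have "\<dots> \<le> 2 powr p * (A * Re (poly Q (cis t)) powr p - B * Re (poly Q (cis t) powr of_real p) + q powr p)"
        using AB(3)[OF ne(2)[of t]] q0 by (intro mult_left_mono add_mono) (auto simp: q)
      finally show "norm (poly Q (cis t) + poly Q 0) powr p \<le> 2 powr p * (A * Re (poly Q (cis t)) powr p - B * Re (poly Q (cis t) powr of_real p) + q powr p)" .
    qed
    \<comment> \<open>Since \<open>1 \<le> B\<close>, the mean value term absorbs the contribution
      \<open>2 * pi * q powr p\<close> of the added constant Q(0).\<close>
    also have "\<dots> \<le> 2 powr p * (A * U)"
    proof (intro mult_left_mono)
      have "1 * (2 * pi * q powr p) \<le> B * (2 * pi * q powr p)" using AB by (intro mult_right_mono) auto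
      then show "A * U - B * (2 * pi * q powr p) + 2 * pi * q powr p \<le> A * U" by simp
    qed simp
    finally show "integral {0..2*pi} (\<lambda>t. norm (poly Q (cis t) + poly Q 0) powr p)
        \<le> 2 powr p * A * integral {0..2*pi} (\<lambda>t. Re (poly Q (cis t)) powr p)" by (simp add: U_def)
  qed
qed

text \<open>On the circle the conjugate of w is 1/w, so the product involves a w Q and cnj a Q / w.
  Division by w shifts the coefficients of Q down; only the constant term b gets a negative
  exponent, and conjugating its contribution keeps the real part.\<close>

lemma Re_poly_multiplier:
  fixes a :: complex
  shows "\<exists>Q'. \<forall>w. norm w = 1 \<longrightarrow> Re (a * w) * Re (poly Q w) = Re (poly Q' w)"
proof (cases Q)
  case (pCons b P)
  have "Re (a * w) * Re (poly Q w) = Re (poly (smult (1/2) (pCons 0 (smult a Q) + smult (cnj a) P + [:0, a * cnj b:])) w)"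
    if w: "norm w = 1" for w
  proof -
    have ww: "cnj w * w = 1" using w by (metis complex_norm_square mult.commute of_real_1 one_power2)
    have "Re (a * w) * Re (poly Q w) = Re (a * w * poly Q w + cnj (a * w) * poly Q w) / 2"
      by (simp add: algebra_simps)
    also have "cnj (a * w) * poly Q w = cnj (a * w) * b + cnj a * poly P w * (cnj w * w)"
      by (simp add: pCons algebra_simps)
    also have "\<dots> = cnj (a * w) * b + cnj a * poly P w" by (simp add: ww)
    also have "Re (a * w * poly Q w + (cnj (a * w) * b + cnj a * poly P w)) = Re (a * w * poly Q w + cnj (cnj (a * w) * b) + cnj a * poly P w)"
      by (simp add: algebra_simps)
    finally have "Re (a * w) * Re (poly Q w) = Re ((a * w * poly Q w + cnj (cnj (a * w) * b) + cnj a * poly P w) / 2)"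
      by (simp only: Re_divide_numeral)
    also have "(a * w * poly Q w + cnj (cnj (a * w) * b) + cnj a * poly P w) / 2
      = poly (smult (1/2) (pCons 0 (smult a Q) + smult (cnj a) P + [:0, a * cnj b:])) w"
      by (simp add: algebra_simps add_divide_distrib)
    finally show ?thesis .
  qed
  then show ?thesis by blast
qed

text \<open>Real parts of polynomials are the real trigonometric polynomials. Closure under products
  comes for free if the ring consists of the functions that multiply this set into itself;
  \<open>Re_poly_multiplier\<close> provides enough of them to separate points.\<close>

lemma Re_poly_dense_circle:
  fixes h :: "complex \<Rightarrow> real"
  assumes h: "continuous_on (sphere 0 1) h" and e: "0 < e"
  obtains Q where "\<And>w. norm w = 1 \<Longrightarrow> \<bar>h w - Re (poly Q w)\<bar> < e"
proof -
  define R where "R = {h. continuous_on (sphere 0 1) h \<and> (\<forall>Q. \<exists>Q'. \<forall>w. norm w = 1 \<longrightarrow> h w * Re (poly Q w) = Re (poly Q' w))}"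
  have RI: "(\<lambda>w. Re (a * w)) \<in> R" for a
    unfolding R_def using Re_poly_multiplier[of a] by (auto intro!: continuous_intros)
  interpret function_ring_on R "sphere 0 1"
  proof
    show "compact (sphere (0::complex) 1)" by simp
    show "continuous_on (sphere 0 1) f" if "f \<in> R" for f using that by (simp add: R_def)
  next
    fix f g assume f: "f \<in> R" and g: "g \<in> R"
    have "\<exists>Q'. \<forall>w. norm w = 1 \<longrightarrow> (f w + g w) * Re (poly Q w) = Re (poly Q' w)" for Q
    proof -
      obtain F where "\<forall>w. norm w = 1 \<longrightarrow> f w * Re (poly Q w) = Re (poly F w)" using f by (auto simp: R_def)
      moreover obtain G where "\<forall>w. norm w = 1 \<longrightarrow> g w * Re (poly Q w) = Re (poly G w)" using g by (auto simp: R_def)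
      ultimately have "\<forall>w. norm w = 1 \<longrightarrow> (f w + g w) * Re (poly Q w) = Re (poly (F + G) w)"
        by (simp add: algebra_simps)
      then show ?thesis by blast
    qed
    then show "(\<lambda>x. f x + g x) \<in> R" using f g by (auto simp: R_def intro!: continuous_intros)
    have "\<exists>Q'. \<forall>w. norm w = 1 \<longrightarrow> (f w * g w) * Re (poly Q w) = Re (poly Q' w)" for Q
    proof -
      obtain G where "\<forall>w. norm w = 1 \<longrightarrow> g w * Re (poly Q w) = Re (poly G w)" using g by (auto simp: R_def)
      moreover obtain F where "\<forall>w. norm w = 1 \<longrightarrow> f w * Re (poly G w) = Re (poly F w)" using f by (auto simp: R_def)
      ultimately have "\<forall>w. norm w = 1 \<longrightarrow> (f w * g w) * Re (poly Q w) = Re (poly F w)"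
        by (simp add: mult.assoc)
      then show ?thesis by blast
    qed
    then show "(\<lambda>x. f x * g x) \<in> R" using f g by (auto simp: R_def intro!: continuous_intros)
  next
    fix c
    have "c * Re (poly Q w) = Re (poly (smult (of_real c) Q) w)" for Q w by simp
    then have "\<exists>Q'. \<forall>w. norm w = 1 \<longrightarrow> c * Re (poly Q w) = Re (poly Q' w)" for Q by blast
    then show "(\<lambda>_. c) \<in> R" by (auto simp: R_def)
  next
    fix x y :: complex assume "x \<noteq> y"
    then have "Re (1 * x) \<noteq> Re (1 * y) \<or> Re (- \<i> * x) \<noteq> Re (- \<i> * y)" by (auto simp: complex_eq_iff)
    then obtain a where "Re (a * x) \<noteq> Re (a * y)" by metis
    then show "\<exists>f\<in>R. f x \<noteq> f y" by (intro bexI[OF _ RI[of a]])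
  qed
  obtain g where g: "g \<in> R" "\<forall>x\<in>sphere 0 1. \<bar>h x - g x\<bar> < e"
    using Stone_Weierstrass_basic[OF h e] by blast
  \<comment> \<open>Applied to the constant 1, the multiplier \<open>g\<close> shows itself to be
    the real part of a polynomial on the circle.\<close>
  then obtain Q where "\<forall>w. norm w = 1 \<longrightarrow> g w * Re (poly 1 w) = Re (poly Q w)" unfolding R_def by blast
  with g(2) have "\<bar>h w - Re (poly Q w)\<bar> < e" if "norm w = 1" for w using that by auto
  then show ?thesis using that by blast
qed

lemma continuous_on_poly_cis [continuous_intros]: "continuous_on S (\<lambda>t. poly Q (cis t))"
  by (intro continuous_intros continuous_on_cis)

text \<open>The factorisation \<open>2Q = (R + Q) - (R - Q)\<close> with \<open>Re R\<close> slightly larger than \<open>\<bar>Re Q\<bar>\<close>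
  on the circle reduces the bound to boundary values of positive real part.\<close>

lemma Riesz_conjugate:
  assumes p: "1 < p" "p \<le> 2"
  obtains C :: real where "0 < C" 
    "\<And>Q. integral {0..2*pi} (\<lambda>t. norm (poly Q (cis t) + cnj (poly Q 0)) powr p)
        \<le> C * integral {0..2*pi} (\<lambda>t. \<bar>Re (poly Q (cis t))\<bar> powr p)"
proof -
  obtain C :: real where C: "0 < C"
    "\<And>Q. (\<And>w. norm w = 1 \<Longrightarrow> 0 < Re (poly Q w)) \<Longrightarrow> Im (poly Q 0) = 0 \<Longrightarrow>
      integral {0..2*pi} (\<lambda>t. norm (poly Q (cis t) + poly Q 0) powr p)
        \<le> C * integral {0..2*pi} (\<lambda>t. Re (poly Q (cis t)) powr p)"
    using Riesz_positive[OF p] by metis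
  define K where "K = 2 * C * 2 powr p * 2 powr p"
  have K: "0 < K" using C by (simp add: K_def)
  have main: "integral {0..2*pi} (\<lambda>t. norm (poly Q (cis t) + poly Q 0) powr p)
        \<le> K * integral {0..2*pi} (\<lambda>t. \<bar>Re (poly Q (cis t))\<bar> powr p)" if Im0: "Im (poly Q 0) = 0" for Q
  proof (rule field_le_epsilon)
    fix d :: real assume d: "0 < d"
    \<comment> \<open>Makes the total error \<open>K * (e powr p * (2 * pi))\<close> equal to
      \<open>d\<close>.\<close>
    define e where "e = (d / (K * 2 * pi)) powr (1/p)"
    have e: "0 < e" using d K by (simp add: e_def)
    have ep: "e powr p = d / (K * 2 * pi)" using d K p by (simp add: e_def powr_powr)
    have "continuous_on (sphere 0 1) (\<lambda>w. \<bar>Re (poly Q w)\<bar> + e)" by (intro continuous_intros)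
    from Re_poly_dense_circle[OF this e] obtain R0 where
      R0: "\<And>w. norm w = 1 \<Longrightarrow> \<bar>\<bar>Re (poly Q w)\<bar> + e - Re (poly R0 w)\<bar> < e" by blast
    \<comment> \<open>Subtracting an imaginary constant makes the value at 0 real, as
      \<open>Riesz_positive\<close> demands, and leaves the real part on the circle alone.\<close>
    define R where "R = R0 - [:\<i> * Im (poly R0 0):]"
    have R: "\<bar>Re (poly Q w)\<bar> < Re (poly R w)" "Re (poly R w) < \<bar>Re (poly Q w)\<bar> + 2 * e" if "norm w = 1" for w
      using R0[OF that] by (auto simp: R_def)
    have ImR: "Im (poly R 0) = 0" by (simp add: R_def)
    define J where "J = integral {0..2*pi} (\<lambda>t. \<bar>Re (poly Q (cis t))\<bar> powr p)"
    have cont: "continuous_on {0..2*pi} (\<lambda>t. \<bar>Re (poly Q (cis t))\<bar> powr p)"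
      using p by (intro continuous_intros continuous_on_powr') auto
    have I2: "((\<lambda>t. 2 powr p * (2 powr p * (\<bar>Re (poly Q (cis t))\<bar> powr p + e powr p))) has_integral
       2 powr p * (2 powr p * (J + e powr p * (2 * pi)))) {0..2*pi}"
      using has_integral_const_real[of "e powr p" 0 "2*pi"] unfolding J_def
      by (intro has_integral_mult_right has_integral_add integrable_integral integrable_continuous_interval cont) (simp add: mult.commute)
    have bound: "integral {0..2*pi} (\<lambda>t. norm (poly S (cis t) + poly S 0) powr p) \<le> C * (2 powr p * (2 powr p * (J + e powr p * (2 * pi))))"
      if S: "Im (poly S 0) = 0" "\<And>w. norm w = 1 \<Longrightarrow> 0 < Re (poly S w) \<and> Re (poly S w) \<le> 2 * (\<bar>Re (poly Q w)\<bar> + e)" for S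
    proof -
      have "integral {0..2*pi} (\<lambda>t. norm (poly S (cis t) + poly S 0) powr p)
        \<le> C * integral {0..2*pi} (\<lambda>t. Re (poly S (cis t)) powr p)"
        using S by (intro C(2)) auto
      also have "\<dots> \<le> C * (2 powr p * (2 powr p * (J + e powr p * (2 * pi))))"
      proof (intro mult_left_mono)
        have "continuous_on {0..2*pi} (\<lambda>t. Re (poly S (cis t)) powr p)"
          using p S(2) by (intro continuous_intros continuous_on_powr') (auto intro: less_imp_le)
        then show "integral {0..2*pi} (\<lambda>t. Re (poly S (cis t)) powr p) \<le> 2 powr p * (2 powr p * (J + e powr p * (2 * pi)))"
        proof (rule has_integral_le[OF integrable_integral[OF integrable_continuous_interval] I2])
          fix t
          have "Re (poly S (cis t)) powr p \<le> (2 * (\<bar>Re (poly Q (cis t))\<bar> + e)) powr p"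
            using S(2)[of "cis t"] p by (intro powr_mono2) auto
          also have "\<dots> = 2 powr p * (\<bar>Re (poly Q (cis t))\<bar> + e) powr p" using e by (subst powr_mult) auto
          also have "\<dots> \<le> 2 powr p * (2 powr p * (\<bar>Re (poly Q (cis t))\<bar> powr p + e powr p))"
            using p e by (intro mult_left_mono abs_add_powr_le) auto
          finally show "Re (poly S (cis t)) powr p \<le> 2 powr p * (2 powr p * (\<bar>Re (poly Q (cis t))\<bar> powr p + e powr p))" .
        qed
      qed (use C in auto)
      finally show ?thesis .
    qed
    have sm: "0 < Re (poly (R + Q) w) \<and> Re (poly (R + Q) w) \<le> 2 * (\<bar>Re (poly Q w)\<bar> + e)"
       "0 < Re (poly (R - Q) w) \<and> Re (poly (R - Q) w) \<le> 2 * (\<bar>Re (poly Q w)\<bar> + e)" if "norm w = 1" for w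
      using R[OF that] by (auto simp: abs_if split: if_splits)
    have B1: "integral {0..2*pi} (\<lambda>t. norm (poly (R + Q) (cis t) + poly (R + Q) 0) powr p) \<le> C * (2 powr p * (2 powr p * (J + e powr p * (2 * pi))))"
      using sm ImR Im0 by (intro bound) auto
    have B2: "integral {0..2*pi} (\<lambda>t. norm (poly (R - Q) (cis t) + poly (R - Q) 0) powr p) \<le> C * (2 powr p * (2 powr p * (J + e powr p * (2 * pi))))"
      using sm ImR Im0 by (intro bound) auto
    have int: "(\<lambda>t. norm (poly S (cis t) + poly S 0) powr p) integrable_on {0..2*pi}" for S
      using p by (intro integrable_continuous_interval continuous_intros continuous_on_powr') auto
    have "integral {0..2*pi} (\<lambda>t. norm (poly Q (cis t) + poly Q 0) powr p) \<le>
      integral {0..2*pi} (\<lambda>t. norm (poly (R + Q) (cis t) + poly (R + Q) 0) powr p + norm (poly (R - Q) (cis t) + poly (R - Q) 0) powr p)"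
    proof (intro integral_le integrable_add int)
      fix t
      define a where "a = poly (R + Q) (cis t) + poly (R + Q) 0"
      define b where "b = poly (R - Q) (cis t) + poly (R - Q) 0"
      have "poly Q (cis t) + poly Q 0 = a / 2 + - b / 2" by (simp add: a_def b_def field_simps)
      also have "norm \<dots> powr p \<le> 2 powr p * (norm (a / 2) powr p + norm (- b / 2) powr p)"
        using p by (intro norm_add_powr_le) auto
      also have "\<dots> = norm a powr p + norm b powr p"
        by (simp add: norm_divide powr_divide field_simps)
      finally show "norm (poly Q (cis t) + poly Q 0) powr p \<le> norm a powr p + norm b powr p" .
    qed
    also have "\<dots> \<le> 2 * (C * (2 powr p * (2 powr p * (J + e powr p * (2 * pi)))))"
      using B1 B2 by (subst integral_add[OF int int]) linarith
    also have "\<dots> = K * (J + e powr p * (2 * pi))" by (simp add: K_def)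
    also have "\<dots> = K * J + d" using K by (simp add: ep distrib_left)
    finally show "integral {0..2*pi} (\<lambda>t. norm (poly Q (cis t) + poly Q 0) powr p) \<le> K * integral {0..2*pi} (\<lambda>t. \<bar>Re (poly Q (cis t))\<bar> powr p) + d"
      by (simp add: J_def)
  qed
  show ?thesis
  proof (rule that[OF K])
    fix Q :: "complex poly"
    \<comment> \<open>The same correction for a general Q; it turns the added value Q(0) into its
      conjugate, again giving twice the projection of Re Q to frequencies >= 0.\<close>
    define S where "S = Q - [:\<i> * Im (poly Q 0):]"
    have "poly S z + poly S 0 = poly Q z + cnj (poly Q 0)" for z by (simp add: S_def complex_eq_iff)
    moreover have "Re (poly S z) = Re (poly Q z)" for z by (simp add: S_def)
    moreover have "Im (poly S 0) = 0" by (simp add: S_def)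
    ultimately show "integral {0..2*pi} (\<lambda>t. norm (poly Q (cis t) + cnj (poly Q 0)) powr p)
        \<le> K * integral {0..2*pi} (\<lambda>t. \<bar>Re (poly Q (cis t))\<bar> powr p)"
      using main[of S] by simp
  qed
qed

text \<open>On the unit circle this polynomial has the real part of the trigonometric sum with
  coefficients \<open>c\<close> and frequencies \<open>k\<close>, since conjugation flips the negative frequencies.\<close>

definition half_poly :: "'i set \<Rightarrow> ('i \<Rightarrow> complex) \<Rightarrow> ('i \<Rightarrow> int) \<Rightarrow> complex poly" where
  "half_poly I c k = (\<Sum>i\<in>I. if 0 \<le> k i then monom (c i) (nat (k i)) else monom (cnj (c i)) (nat (- k i)))"

lemma cis_power_nat: "0 \<le> k \<Longrightarrow> cis t ^ nat k = cis (of_int k * t)"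
  unfolding Complex.DeMoivre by simp

lemma Re_half_poly: 
  "Re (poly (half_poly I c k) (cis t)) = Re (\<Sum>i\<in>I. c i * cis (of_int (k i) * t))"
proof -
  have "Re (cnj c * cis t ^ nat (- k)) = Re (c * cis (of_int k * t))" if "\<not> 0 \<le> k" for c k
    using that by (subst cis_power_nat) auto
  then show ?thesis
    unfolding half_poly_def poly_sum Re_sum by (intro sum.cong) (auto simp: poly_monom cis_power_nat simp del: times_complex.sel)
qed

text \<open>For a sum g with coefficients c, the two half polynomials have the boundary real parts
  Re g and Im g. At frequencies >= 0 the coefficients add up to 2 c. At negative ones they cancel,
  because i times the conjugate of -i c is minus the conjugate of c.\<close>

lemma half_poly_rotate:
  "poly (half_poly I c k) z + \<i> * poly (half_poly I (\<lambda>i. - \<i> * c i) k) z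
     = 2 * (\<Sum>i\<in>{i\<in>I. 0 \<le> k i}. c i * z ^ nat (k i))" if "finite I"
  using that by (auto simp: half_poly_def poly_sum poly_monom sum_distrib_left sum.inter_filter simp flip: sum.distrib mult.assoc intro!: sum.cong)

text \<open>The same cancellation at frequency 0 removes the values at 0 that the Riesz bound
  carries along.\<close>

lemma half_poly_rotate_0:
  "cnj (poly (half_poly I c k) 0) + \<i> * cnj (poly (half_poly I (\<lambda>i. - \<i> * c i) k) 0) = 0"
  by (auto simp: half_poly_def poly_sum poly_monom sum_distrib_left simp flip: sum.distrib mult.assoc intro!: sum.neutral)

text \<open>Re g and Im g are each controlled by \<open>Riesz_conjugate\<close>. By the two
  identities for \<open>half_poly\<close> the results combine to twice the projection of g, with no
  leftover constant.\<close>

lemma Riesz_projection: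
  assumes p: "1 < p" "p \<le> 2"
  obtains C :: real where "0 < C" 
    "\<And>(I::'i set) c k. finite I \<Longrightarrow>
      integral {0..2*pi} (\<lambda>t. norm (\<Sum>i\<in>{i\<in>I. 0 \<le> k i}. c i * cis (of_int (k i) * t)) powr p)
        \<le> C * integral {0..2*pi} (\<lambda>t. norm (\<Sum>i\<in>I. c i * cis (of_int (k i) * t)) powr p)"
proof -
  obtain C :: real where C: "0 < C" 
    "\<And>Q. integral {0..2*pi} (\<lambda>t. norm (poly Q (cis t) + cnj (poly Q 0)) powr p)
        \<le> C * integral {0..2*pi} (\<lambda>t. \<bar>Re (poly Q (cis t))\<bar> powr p)"
    using Riesz_conjugate[OF p] by metis
  show ?thesis
  proof (rule that[of "2 * C"])
    show "0 < 2 * C" using C by simp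
    fix I :: "'i set" and c k assume I: "finite I"
    define g where "g = (\<lambda>t. \<Sum>i\<in>I. c i * cis (of_int (k i) * t))"
    define P where "P = (\<lambda>t. \<Sum>i\<in>{i\<in>I. 0 \<le> k i}. c i * cis (of_int (k i) * t))"
    define A where "A = half_poly I c k"
    define B where "B = half_poly I (\<lambda>i. - \<i> * c i) k"
    have cg: "continuous_on S g" for S unfolding g_def by (intro continuous_intros continuous_on_cis)
    have cP: "continuous_on S P" for S unfolding P_def by (intro continuous_intros continuous_on_cis)
    have P: "2 * P t = (poly A (cis t) + cnj (poly A 0)) + \<i> * (poly B (cis t) + cnj (poly B 0))" for t
    proof -
      have "2 * P t = poly A (cis t) + \<i> * poly B (cis t)"
        unfolding A_def B_def half_poly_rotate[OF I] by (simp add: P_def cis_power_nat)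
      also have "\<dots> = poly A (cis t) + \<i> * poly B (cis t) + (cnj (poly A 0) + \<i> * cnj (poly B 0))"
        unfolding A_def B_def half_poly_rotate_0 by simp
      finally show ?thesis by (simp add: algebra_simps)
    qed
    have int: "(\<lambda>t. norm (poly S (cis t) + b) powr p) integrable_on {0..2*pi}" for S b
      using p by (intro integrable_continuous_interval continuous_intros continuous_on_powr') auto
    have le: "integral {0..2*pi} (\<lambda>t. norm (poly S (cis t) + cnj (poly S 0)) powr p) \<le> C * integral {0..2*pi} (\<lambda>t. norm (g t) powr p)"
      if "\<And>t. \<bar>Re (poly S (cis t))\<bar> \<le> norm (g t)" for S
    proof -
      have "integral {0..2*pi} (\<lambda>t. \<bar>Re (poly S (cis t))\<bar> powr p) \<le> integral {0..2*pi} (\<lambda>t. norm (g t) powr p)"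
        using p that by (intro integral_le powr_mono2 integrable_continuous_interval continuous_intros continuous_on_powr' cg) auto
      then have "C * integral {0..2*pi} (\<lambda>t. \<bar>Re (poly S (cis t))\<bar> powr p) \<le> C * integral {0..2*pi} (\<lambda>t. norm (g t) powr p)"
        using C by (intro mult_left_mono) auto
      then show ?thesis using C(2)[of S] by linarith
    qed
    have "integral {0..2*pi} (\<lambda>t. norm (P t) powr p) \<le> 
       integral {0..2*pi} (\<lambda>t. norm (poly A (cis t) + cnj (poly A 0)) powr p + norm (poly B (cis t) + cnj (poly B 0)) powr p)"
    proof (intro integral_le integrable_add int)
      show "(\<lambda>t. norm (P t) powr p) integrable_on {0..2*pi}"
        using p by (intro integrable_continuous_interval continuous_intros continuous_on_powr' cP) auto
      fix t
      define a where "a = poly A (cis t) + cnj (poly A 0)"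
      define b where "b = poly B (cis t) + cnj (poly B 0)"
      have "P t = (2 * P t) / 2" by simp
      also have "\<dots> = a / 2 + \<i> * b / 2" unfolding P[of t, folded a_def b_def] by (rule add_divide_distrib)
      also have "norm \<dots> powr p \<le> 2 powr p * (norm (a / 2) powr p + norm (\<i> * b / 2) powr p)"
        using p by (intro norm_add_powr_le) auto
      also have "\<dots> = norm a powr p + norm b powr p"
        by (simp add: norm_divide norm_mult powr_divide field_simps)
      finally show "norm (P t) powr p \<le> norm a powr p + norm b powr p" .
    qed
    also have "\<dots> \<le> 2 * C * integral {0..2*pi} (\<lambda>t. norm (g t) powr p)"
    proof -
      have "\<bar>Re (poly A (cis t))\<bar> \<le> norm (g t)" for t
        unfolding A_def Re_half_poly g_def by (rule abs_Re_le_cmod)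
      note 1 = le[OF this]
      have "\<bar>Re (poly B (cis t))\<bar> \<le> norm (g t)" for t
      proof -
        have "(\<Sum>i\<in>I. - \<i> * c i * cis (of_int (k i) * t)) = - \<i> * g t"
          by (simp add: g_def sum_distrib_left mult.assoc)
        then show ?thesis unfolding B_def Re_half_poly using abs_Re_le_cmod[of "- \<i> * g t"] by (simp add: norm_mult)
      qed
      note 2 = le[OF this]
      show ?thesis using 1 2 by (subst integral_add[OF int int]) linarith
    qed
    finally show "integral {0..2*pi} (\<lambda>t. norm (\<Sum>i\<in>{i\<in>I. 0 \<le> k i}. c i * cis (of_int (k i) * t)) powr p)
        \<le> 2 * C * integral {0..2*pi} (\<lambda>t. norm (\<Sum>i\<in>I. c i * cis (of_int (k i) * t)) powr p)"
      by (simp add: P_def g_def)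
  qed
qed

text \<open>A band is cut out by two one-sided projections: shift the frequencies by N and project,
  then conjugate, shift and project again. Shifts and conjugation do not change the modulus, so the
  constant does not involve N.\<close>

lemma trig_truncation_bound:
  assumes p: "1 < p" "p \<le> 2"
  obtains C :: real where "0 < C" 
    "\<And>(I::'i set) c k (N::nat). finite I \<Longrightarrow>
      integral {0..2*pi} (\<lambda>t. norm (\<Sum>i\<in>{i\<in>I. \<bar>k i\<bar> \<le> int N}. c i * cis (of_int (k i) * t)) powr p)
        \<le> C * integral {0..2*pi} (\<lambda>t. norm (\<Sum>i\<in>I. c i * cis (of_int (k i) * t)) powr p)"
proof -
  obtain C :: real where C: "0 < C" 
    "\<And>(I::'i set) c k. finite I \<Longrightarrow>
      integral {0..2*pi} (\<lambda>t. norm (\<Sum>i\<in>{i\<in>I. 0 \<le> k i}. c i * cis (of_int (k i) * t)) powr p)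
        \<le> C * integral {0..2*pi} (\<lambda>t. norm (\<Sum>i\<in>I. c i * cis (of_int (k i) * t)) powr p)"
    by (rule Riesz_projection[OF p, where 'i='i]) (rule that)
  show ?thesis
  proof (rule that[of "C * C"])
    show "0 < C * C" using C by simp
    fix I :: "'i set" and c k and N :: nat assume I: "finite I"
    have shift: "norm (\<Sum>i\<in>J. c i * cis (of_int (k i + int N) * t)) = norm (\<Sum>i\<in>J. c i * cis (of_int (k i) * t))" for J :: "'i set" and c k t
    proof -
      have "(\<Sum>i\<in>J. c i * cis (of_int (k i + int N) * t)) = cis (N * t) * (\<Sum>i\<in>J. c i * cis (of_int (k i) * t))"
        unfolding sum_distrib_left by (intro sum.cong) (auto simp: cis_mult algebra_simps)
      then show ?thesis by (simp add: norm_mult)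
    qed
    have flip: "norm (\<Sum>i\<in>J. cnj (c i) * cis (of_int (- k i) * t)) = norm (\<Sum>i\<in>J. c i * cis (of_int (k i) * t))" for J :: "'i set" and c k t
    proof -
      have "(\<Sum>i\<in>J. cnj (c i) * cis (of_int (- k i) * t)) = cnj (\<Sum>i\<in>J. c i * cis (of_int (k i) * t))"
        by (simp add: cis_cnj)
      then show ?thesis by (metis complex_mod_cnj)
    qed
    let ?J = "{i\<in>I. 0 \<le> k i + int N}"
    have eq: "{i\<in>I. \<bar>k i\<bar> \<le> int N} = {i\<in>?J. 0 \<le> - k i + int N}" by auto
    have "integral {0..2*pi} (\<lambda>t. norm (\<Sum>i\<in>{i\<in>I. \<bar>k i\<bar> \<le> int N}. c i * cis (of_int (k i) * t)) powr p)
      = integral {0..2*pi} (\<lambda>t. norm (\<Sum>i\<in>{i\<in>?J. 0 \<le> - k i + int N}. cnj (c i) * cis (of_int (- k i + int N) * t)) powr p)"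
      unfolding eq shift flip ..
    also have "\<dots> \<le> C * integral {0..2*pi} (\<lambda>t. norm (\<Sum>i\<in>?J. cnj (c i) * cis (of_int (- k i + int N) * t)) powr p)"
      using I by (intro C) auto
    also have "\<dots> = C * integral {0..2*pi} (\<lambda>t. norm (\<Sum>i\<in>?J. c i * cis (of_int (k i + int N) * t)) powr p)"
      unfolding shift flip ..
    also have "\<dots> \<le> C * (C * integral {0..2*pi} (\<lambda>t. norm (\<Sum>i\<in>I. c i * cis (of_int (k i + int N) * t)) powr p))"
      using I C by (intro mult_left_mono C) auto
    finally show "integral {0..2*pi} (\<lambda>t. norm (\<Sum>i\<in>{i\<in>I. \<bar>k i\<bar> \<le> int N}. c i * cis (of_int (k i) * t)) powr p)
        \<le> C * C * integral {0..2*pi} (\<lambda>t. norm (\<Sum>i\<in>I. c i * cis (of_int (k i) * t)) powr p)"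
      unfolding shift by (simp add: mult.assoc)
  qed
qed

section \<open>Truncation on the torus\<close>

lemma continuous_on_norm_powr:
  "0 < p \<Longrightarrow> continuous_on S f \<Longrightarrow> continuous_on S (\<lambda>x. norm (f x) powr p)"
  by (intro continuous_on_powr' continuous_intros) auto

definition torus_int :: "real \<Rightarrow> (real \<Rightarrow> real \<Rightarrow> 'a::real_normed_vector) \<Rightarrow> real" where
  "torus_int p F = integral {0..2*pi} (\<lambda>x. integral {0..2*pi} (\<lambda>y. norm (F x y) powr p))"

lemma integral_periodic_shift:
  fixes h :: "real \<Rightarrow> real"
  assumes c: "continuous_on UNIV h" and per: "\<And>y. h (y + T) = h y" and T: "0 < T"
  shows "integral {0..T} (\<lambda>y. h (y + a)) = integral {0..T} h"
proof -
  have int: "h integrable_on {u..v}" for u v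
    by (intro integrable_continuous_interval continuous_on_subset[OF c]) auto
  have sh: "integral {u + s..v + s} h = integral {u..v} (\<lambda>y. h (y + s))" for u v s :: real
    using integral_shift_real_ivl[of "u + s" s "v + s" h] by simp
  have small: "integral {0..T} (\<lambda>y. h (y + a)) = integral {0..T} h" if a: "0 \<le> a" "a \<le> T" for a
  proof -
    have "integral {0..T} (\<lambda>y. h (y + a)) = integral {a..T + a} h" using sh[of 0 a T] by simp
    also have "\<dots> = integral {a..T} h + integral {T..T + a} h"
      using Henstock_Kurzweil_Integration.integral_combine[where a=a and c=T and b="T + a" and f=h] a int by simp
    also have "integral {T..T + a} h = integral {0..a} h"
      using sh[of 0 T a] by (simp add: per add.commute)
    also have "integral {a..T} h + integral {0..a} h = integral {0..T} h"
      using Henstock_Kurzweil_Integration.integral_combine[where a=0 and c=a and b=T and f=h] a int by simp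
    finally show ?thesis .
  qed
  have perN: "h (y + of_int n * T) = h y" for y n
  proof (induction n rule: int_induct[where k = 0])
    case (step1 i) then show ?case using per[of "y + of_int i * T"] by (simp add: algebra_simps)
  next
    case (step2 i) then show ?case using per[of "y + of_int (i - 1) * T"] by (simp add: algebra_simps)
  qed simp
  define n where "n = \<lfloor>a / T\<rfloor>"
  define b where "b = a - of_int n * T"
  have "of_int n \<le> a / T" "a / T < of_int n + 1" unfolding n_def by linarith+
  then have b: "0 \<le> b" "b \<le> T" using T by (auto simp: b_def field_simps)
  have "h (y + a) = h (y + b)" for y using perN[of "y + b" n] by (simp add: b_def algebra_simps)
  then show ?thesis using small[OF b] by simp
qed

lemma continuous_on_inner_integral:
  fixes f :: "real \<Rightarrow> real \<Rightarrow> real"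
  assumes "continuous_on UNIV (\<lambda>(x, y). f x y)"
  shows "continuous_on S (\<lambda>x. integral {a..b} (f x))"
proof -
  have "continuous_on UNIV (\<lambda>x. integral (cbox a b) (f x))"
    by (rule integral_continuous_on_param) (rule continuous_on_subset[OF assms], simp)
  then show ?thesis by (auto intro: continuous_on_subset)
qed

lemma torus_int_swap:
  assumes p: "0 < p" and F: "continuous_on UNIV (\<lambda>(x, y). F x y)"
  shows "torus_int p (\<lambda>x y. F y x) = torus_int p F"
proof -
  have "continuous_on UNIV (\<lambda>(x, y). norm (F x y) powr p)"
    using F p unfolding case_prod_unfold by (intro continuous_on_norm_powr)
  then have "continuous_on (cbox (0,0) (2*pi,2*pi)) (\<lambda>(x, y). norm (F x y) powr p)"
    by (rule continuous_on_subset) simp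
  from integral_swap_continuous[OF this] show ?thesis by (simp add: torus_int_def)
qed

definition trig_sum :: "'i set \<Rightarrow> ('i \<Rightarrow> complex) \<Rightarrow> ('i \<Rightarrow> int) \<Rightarrow> ('i \<Rightarrow> int) \<Rightarrow> real \<Rightarrow> real \<Rightarrow> complex" where
  "trig_sum I c k l x y = (\<Sum>i\<in>I. c i * cis (of_int (k i) * x + of_int (l i) * y))"

lemma continuous_trig_sum: "continuous_on S (\<lambda>(x, y). trig_sum I c k l x y)"
  unfolding trig_sum_def case_prod_unfold by (intro continuous_intros continuous_on_cis)

lemma continuous_trig_sum': "continuous_on S (\<lambda>y. trig_sum I c k l x y)"
  unfolding trig_sum_def by (intro continuous_intros continuous_on_cis)

lemma torus_int_trig_sum_swap:
  assumes "0 < p" shows "torus_int p (trig_sum I c l k) = torus_int p (trig_sum I c k l)"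
proof -
  have "trig_sum I c l k = (\<lambda>x y. trig_sum I c k l y x)" by (auto simp: trig_sum_def fun_eq_iff add.commute)
  then show ?thesis using torus_int_swap[OF assms continuous_trig_sum] by simp
qed

text \<open>For fixed x the additional frequency \<open>j * l i\<close> amounts to translating y by
  j x, and an integral over a full period does not see translations.\<close>

lemma torus_int_trig_sum_shear:
  assumes "0 < p" shows "torus_int p (trig_sum I c (\<lambda>i. k i + j * l i) l) = torus_int p (trig_sum I c k l)"
  unfolding torus_int_def
proof (rule integral_cong)
  fix x :: real
  have per: "trig_sum I c k l x (y + 2 * pi) = trig_sum I c k l x y" for y
  proof -
    have "cis (of_int (k i) * x + of_int (l i) * (y + 2 * pi)) = cis (of_int (k i) * x + of_int (l i) * y)" for i
    proof -
      have "cis (of_int (k i) * x + of_int (l i) * (y + 2 * pi)) = cis (of_int (k i) * x + of_int (l i) * y) * cis (2 * pi * of_int (l i))"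
        by (simp add: cis_mult algebra_simps)
      then show ?thesis by (subst (asm) cis_multiple_2pi) auto
    qed
    then show ?thesis by (simp add: trig_sum_def)
  qed
  have "trig_sum I c (\<lambda>i. k i + j * l i) l x y = trig_sum I c k l x (y + of_int j * x)" for y
    by (simp add: trig_sum_def algebra_simps)
  then have "integral {0..2*pi} (\<lambda>y. norm (trig_sum I c (\<lambda>i. k i + j * l i) l x y) powr p)
    = integral {0..2*pi} (\<lambda>y. norm (trig_sum I c k l x (y + of_int j * x)) powr p)" by simp
  also have "\<dots> = integral {0..2*pi} (\<lambda>y. norm (trig_sum I c k l x y) powr p)"
    using assms by (intro integral_periodic_shift[where h = "\<lambda>y. norm (trig_sum I c k l x y) powr p"] 
      continuous_intros continuous_on_powr' continuous_trig_sum') (auto simp: per)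
  finally show "integral {0..2*pi} (\<lambda>y. norm (trig_sum I c (\<lambda>i. k i + j * l i) l x y) powr p)
    = integral {0..2*pi} (\<lambda>y. norm (trig_sum I c k l x y) powr p)" .
qed

text \<open>The second strip becomes a coordinate strip after the shear \<open>(x, y) \<mapsto> (x, y + j x)\<close>.\<close>

lemma trig_sum_truncation_bound:
  assumes p: "1 < p" "p \<le> 2"
  obtains C :: real where "0 < C" 
    "\<And>(I::'i set) c k l (N::nat). finite I \<Longrightarrow>
      torus_int p (trig_sum {i\<in>I. \<bar>l i\<bar> \<le> int N} c k l) \<le> C * torus_int p (trig_sum I c k l)"
    "\<And>(I::'i set) c k l j (N::nat). finite I \<Longrightarrow>
      torus_int p (trig_sum {i\<in>I. \<bar>k i + j * l i\<bar> \<le> int N} c k l) \<le> C * torus_int p (trig_sum I c k l)"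
proof -
  obtain C :: real where C: "0 < C" 
    "\<And>(I::'i set) c k (N::nat). finite I \<Longrightarrow>
      integral {0..2*pi} (\<lambda>t. norm (\<Sum>i\<in>{i\<in>I. \<bar>k i\<bar> \<le> int N}. c i * cis (of_int (k i) * t)) powr p)
        \<le> C * integral {0..2*pi} (\<lambda>t. norm (\<Sum>i\<in>I. c i * cis (of_int (k i) * t)) powr p)"
    by (rule trig_truncation_bound[OF p, where 'i='i]) (rule that)
  have y: "torus_int p (trig_sum {i\<in>I. \<bar>l i\<bar> \<le> int N} c k l) \<le> C * torus_int p (trig_sum I c k l)" 
    if I: "finite I" for I :: "'i set" and c k l and N :: nat
  proof -
    have eq: "trig_sum J c k l x y = (\<Sum>i\<in>J. c i * cis (of_int (k i) * x) * cis (of_int (l i) * y))" for J :: "'i set" and x y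
      by (simp add: trig_sum_def cis_mult mult.assoc)
    have int: "(\<lambda>x. integral {0..2*pi} (\<lambda>y. norm (trig_sum J c k l x y) powr p)) integrable_on {0..2*pi}" for J :: "'i set"
    proof (intro integrable_continuous_interval continuous_on_inner_integral)
      show "continuous_on UNIV (\<lambda>(x, y). norm (trig_sum J c k l x y) powr p)"
        using p continuous_trig_sum[of UNIV J c k l] unfolding case_prod_unfold
        by (intro continuous_on_norm_powr) auto
    qed
    have "torus_int p (trig_sum {i\<in>I. \<bar>l i\<bar> \<le> int N} c k l)
      \<le> integral {0..2*pi} (\<lambda>x. C * integral {0..2*pi} (\<lambda>y. norm (trig_sum I c k l x y) powr p))"
      unfolding torus_int_def
    proof (intro integral_le int integrable_on_mult_right)
      fix x
      show "integral {0..2*pi} (\<lambda>y. norm (trig_sum {i\<in>I. \<bar>l i\<bar> \<le> int N} c k l x y) powr p)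
        \<le> C * integral {0..2*pi} (\<lambda>y. norm (trig_sum I c k l x y) powr p)"
        unfolding eq by (rule C(2)[OF I])
    qed
    then show ?thesis by (simp add: torus_int_def)
  qed
  have x: "torus_int p (trig_sum {i\<in>I. \<bar>k i + j * l i\<bar> \<le> int N} c k l) \<le> C * torus_int p (trig_sum I c k l)" 
    if I: "finite I" for I :: "'i set" and c k l j and N :: nat
  proof -
    \<comment> \<open>The coordinates are exchanged so that the sheared frequency takes the second
      place, the one that is truncated by the first bound.\<close>
    have eq: "torus_int p (trig_sum J c l (\<lambda>i. k i + j * l i)) = torus_int p (trig_sum J c k l)" for J :: "'i set"
      using p by (subst torus_int_trig_sum_swap) (auto simp: torus_int_trig_sum_shear)
    show ?thesis using y[OF I, of "\<lambda>i. k i + j * l i" N c l] unfolding eq .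
  qed
  show ?thesis by (rule that[OF C(1)]) (rule y x, assumption)+
qed

text \<open>Each sine splits into two exponentials of opposite frequencies, tagged by a truth value,
  with the phases moved into the coefficients. The strips are symmetric about 0, so both halves of a
  sine are kept or dropped together. Three strips, two of them with shears 1 and -1, give the
  constant C^3.\<close>

lemma hexagon_truncation_bound:
  assumes p: "1 < p" "p \<le> 2"
  obtains C :: real where "0 < C" 
    "\<And>(I::'i set) c k l \<phi> (N::nat) (M::nat). finite I \<Longrightarrow>
      torus_int p (\<lambda>x y. \<Sum>i\<in>{i\<in>I. \<bar>l i\<bar> \<le> int N \<and> \<bar>k i + l i\<bar> \<le> int M \<and> \<bar>k i - l i\<bar> \<le> int M}. c i * sin (of_int (k i) * x + of_int (l i) * y + \<phi> i))
      \<le> C * torus_int p (\<lambda>x y. \<Sum>i\<in>I. c i * sin (of_int (k i) * x + of_int (l i) * y + \<phi> i) :: real)"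
proof -
  obtain C :: real where C: "0 < C" 
    "\<And>(I::('i \<times> bool) set) c k l (N::nat). finite I \<Longrightarrow>
      torus_int p (trig_sum {i\<in>I. \<bar>l i\<bar> \<le> int N} c k l) \<le> C * torus_int p (trig_sum I c k l)"
    "\<And>(I::('i \<times> bool) set) c k l j (N::nat). finite I \<Longrightarrow>
      torus_int p (trig_sum {i\<in>I. \<bar>k i + j * l i\<bar> \<le> int N} c k l) \<le> C * torus_int p (trig_sum I c k l)"
    by (rule trig_sum_truncation_bound[OF p, where 'i="'i \<times> bool"]) (rule that)
  show ?thesis
  proof (rule that[of "C * (C * C)"])
    show "0 < C * (C * C)" using C by simp
    fix I :: "'i set" and c :: "'i \<Rightarrow> real" and k l :: "'i \<Rightarrow> int" and \<phi> :: "'i \<Rightarrow> real" and N M :: nat assume I: "finite I"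
    define c' where "c' = (\<lambda>(i, b). if b then of_real (c i) * cis (\<phi> i) / (2 * \<i>) else - of_real (c i) * cis (- \<phi> i) / (2 * \<i>))"
    define k' where "k' = (\<lambda>(i, b). if b then k i else - k i)"
    define l' where "l' = (\<lambda>(i::'i, b). if b then l i else - l i)"
    have expand: "of_real (c i * sin (of_int (k i) * x + of_int (l i) * y + \<phi> i)) =
      (\<Sum>b\<in>UNIV. c' (i, b) * cis (of_int (k' (i, b)) * x + of_int (l' (i, b)) * y))" for i x y
    proof -
      define s where "s = of_int (k i) * x + of_int (l i) * y"
      have "(\<Sum>b\<in>UNIV. c' (i, b) * cis (of_int (k' (i, b)) * x + of_int (l' (i, b)) * y)) 
        = of_real (c i) * (cis (\<phi> i) * cis s - cis (- \<phi> i) * cis (- s)) / (2 * \<i>)"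
        by (simp add: UNIV_bool c'_def k'_def l'_def s_def field_simps)
      also have "cis (\<phi> i) * cis s - cis (- \<phi> i) * cis (- s) = cis (s + \<phi> i) - cis (- (s + \<phi> i))"
        by (simp add: cis_mult add.commute)
      also have "\<dots> = 2 * \<i> * of_real (sin (s + \<phi> i))"
        by (subst cis_cnj[symmetric]) (simp add: complex_eq_iff)
      also have "of_real (c i) * (2 * \<i> * of_real (sin (s + \<phi> i))) / (2 * \<i>) = of_real (c i) * of_real (sin (s + \<phi> i))"
        by (simp add: complex_eq_iff)
      finally show ?thesis by (simp only: s_def of_real_mult)
    qed
    have eq: "torus_int p (\<lambda>x y. \<Sum>i\<in>J. c i * sin (of_int (k i) * x + of_int (l i) * y + \<phi> i)) = torus_int p (trig_sum (J \<times> UNIV) c' k' l')" 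
      if "finite J" for J
    proof -
      have 1: "of_real (\<Sum>i\<in>J. c i * sin (of_int (k i) * x + of_int (l i) * y + \<phi> i)) = trig_sum (J \<times> UNIV) c' k' l' x y" for x y
        unfolding trig_sum_def using that by (simp only: of_real_sum expand sum.cartesian_product case_prod_unfold prod.collapse)
      have "norm (\<Sum>i\<in>J. c i * sin (of_int (k i) * x + of_int (l i) * y + \<phi> i)) = norm (trig_sum (J \<times> UNIV) c' k' l' x y)" for x y
        by (simp only: 1[symmetric] norm_of_real real_norm_def)
      then show ?thesis by (simp add: torus_int_def)
    qed
    let ?J = "{i\<in>I. \<bar>l i\<bar> \<le> int N \<and> \<bar>k i + l i\<bar> \<le> int M \<and> \<bar>k i - l i\<bar> \<le> int M}"
    let ?A = "{i\<in>I \<times> UNIV. \<bar>l' i\<bar> \<le> int N}"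
    let ?B = "{i\<in>?A. \<bar>k' i + 1 * l' i\<bar> \<le> int M}"
    have set: "?J \<times> UNIV = {i\<in>?B. \<bar>k' i + (-1) * l' i\<bar> \<le> int M}"
    proof -
      have "\<bar>l' (i, b)\<bar> = \<bar>l i\<bar>" "\<bar>k' (i, b) + 1 * l' (i, b)\<bar> = \<bar>k i + l i\<bar>" "\<bar>k' (i, b) + (-1) * l' (i, b)\<bar> = \<bar>k i - l i\<bar>" for i b
        unfolding k'_def l'_def by (cases b; simp; arith)+
      then show ?thesis by (simp only: set_eq_iff split_paired_All mem_Times_iff mem_Collect_eq) auto
    qed
    have "torus_int p (trig_sum (?J \<times> UNIV) c' k' l') \<le> C * torus_int p (trig_sum ?B c' k' l')"
      unfolding set using I by (intro C) auto
    also have "\<dots> \<le> C * (C * torus_int p (trig_sum ?A c' k' l'))"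
      using I C(1) by (intro mult_left_mono C) auto
    also have "\<dots> \<le> C * (C * (C * torus_int p (trig_sum (I \<times> UNIV) c' k' l')))"
      using I C(1) by (intro mult_left_mono C) auto
    finally show "torus_int p (\<lambda>x y. \<Sum>i\<in>?J. c i * sin (of_int (k i) * x + of_int (l i) * y + \<phi> i))
      \<le> C * (C * C) * torus_int p (\<lambda>x y. \<Sum>i\<in>I. c i * sin (of_int (k i) * x + of_int (l i) * y + \<phi> i))"
      using I by (simp add: eq mult.assoc)
  qed
qed

section \<open>Orthogonal expansions in Lp spaces\<close>

text \<open>The measure is a parameter because the half triangle, the whole triangle and the plane
  all occur.\<close>

definition Lp_fun :: "real \<Rightarrow> 'a measure \<Rightarrow> ('a \<Rightarrow> real) \<Rightarrow> bool" where
  "Lp_fun p M f \<longleftrightarrow> f \<in> borel_measurable M \<and> integrable M (\<lambda>x. \<bar>f x\<bar> powr p)"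

lemma Lp_fun_integrable: "Lp_fun p M f \<Longrightarrow> integrable M (\<lambda>x. \<bar>f x\<bar> powr p)"
  by (simp add: Lp_fun_def)

lemma abs_add_powr_le':
  fixes a b p :: real
  assumes "0 \<le> p"
  shows "\<bar>a + b\<bar> powr p \<le> 2 powr p * (\<bar>a\<bar> powr p + \<bar>b\<bar> powr p)"
  using norm_add_powr_le[OF assms, of a b] by simp

lemma Lp_fun_add:
  assumes "0 \<le> p" "Lp_fun p M f" "Lp_fun p M g" shows "Lp_fun p M (\<lambda>x. f x + g x)"
proof -
  have [measurable]: "f \<in> borel_measurable M" "g \<in> borel_measurable M" using assms by (auto simp: Lp_fun_def)
  have "integrable M (\<lambda>x. 2 powr p * (\<bar>f x\<bar> powr p + \<bar>g x\<bar> powr p))"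
    using assms by (auto simp: Lp_fun_def)
  then have "integrable M (\<lambda>x. \<bar>f x + g x\<bar> powr p)"
    by (rule Bochner_Integration.integrable_bound)
      (auto intro!: order_trans[OF _ abs_ge_self] abs_add_powr_le' assms(1))
  then show ?thesis by (simp add: Lp_fun_def)
qed

lemma Lp_fun_cmult: 
  assumes "Lp_fun p M f" shows "Lp_fun p M (\<lambda>x. c * f x)"
  using assms by (auto simp: Lp_fun_def abs_mult powr_mult)

lemma Lp_fun_minus_iff: "Lp_fun p M (\<lambda>x. - f x) \<longleftrightarrow> Lp_fun p M f"
  using Lp_fun_cmult[of p M f "-1"] Lp_fun_cmult[of p M "\<lambda>x. - f x" "-1"] by auto

lemma Lp_fun_diff:
  assumes "0 \<le> p" "Lp_fun p M f" "Lp_fun p M g" shows "Lp_fun p M (\<lambda>x. f x - g x)"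
  using Lp_fun_add[of p M f "\<lambda>x. - g x"] assms by (simp add: Lp_fun_minus_iff)

lemma integral_add_powr_le:
  assumes p: "0 \<le> p" and f: "Lp_fun p M f" and g: "Lp_fun p M g"
  shows "(LINT x|M. \<bar>f x + g x\<bar> powr p) \<le> 2 powr p * ((LINT x|M. \<bar>f x\<bar> powr p) + (LINT x|M. \<bar>g x\<bar> powr p))"
proof -
  have "(LINT x|M. \<bar>f x + g x\<bar> powr p) \<le> (LINT x|M. 2 powr p * (\<bar>f x\<bar> powr p + \<bar>g x\<bar> powr p))"
    using assms Lp_fun_add[OF assms] by (intro integral_mono abs_add_powr_le') (auto simp: Lp_fun_def)
  then show ?thesis using f g by (simp add: Lp_fun_def)
qed

section \<open>L^p functions on a finite measure space\<close>

context finite_measure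
begin

lemma Lp_fun_bounded:
  assumes "0 \<le> p" "f \<in> borel_measurable M" "\<And>x. x \<in> space M \<Longrightarrow> \<bar>f x\<bar> \<le> B" shows "Lp_fun p M f"
proof -
  have "integrable M (\<lambda>x. \<bar>f x\<bar> powr p)"
    using assms by (intro integrable_const_bound[where B="\<bar>B\<bar> powr p"] AE_I2) (auto intro!: powr_mono2 intro: order_trans[OF _ abs_ge_self])
  then show ?thesis using assms by (simp add: Lp_fun_def)
qed

lemma integrable_Lp_fun:
  assumes p: "1 \<le> p" and f: "Lp_fun p M f" shows "integrable M f"
proof (rule Bochner_Integration.integrable_bound)
  show "integrable M (\<lambda>x. 1 + \<bar>f x\<bar> powr p)" using f by (auto simp: Lp_fun_def)
  show "f \<in> borel_measurable M" using f by (simp add: Lp_fun_def)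
  have "y \<le> 1 + y powr p" if "0 \<le> y" for y :: real
  proof (cases "y \<le> 1")
    case False
    then have "y powr 1 \<le> y powr p" using p by (intro powr_mono) auto
    then show ?thesis using False by simp
  qed (use that in \<open>auto intro: add_increasing2\<close>)
  then show "AE x in M. norm (f x) \<le> norm (1 + \<bar>f x\<bar> powr p)" by auto
qed

text \<open>A weak form of Hoelder's inequality, obtained from y <= t + t^(1-p) y^p for t > 0. The
  choice t = A^(1/p) balances both terms; if A = 0, t tends to 0 instead.\<close>

lemma integral_abs_powr_le:
  assumes p: "1 < p" and f: "Lp_fun p M f"
  shows "(LINT x|M. \<bar>f x\<bar>) powr p \<le> (measure M (space M) + 1) powr p * (LINT x|M. \<bar>f x\<bar> powr p)"
proof -
  define A where "A = (LINT x|M. \<bar>f x\<bar> powr p)"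
  define m where "m = measure M (space M)"
  have A0: "0 \<le> A" by (simp add: A_def)
  have fi: "integrable M f" using integrable_Lp_fun[OF _ f] p by simp
  have *: "(LINT x|M. \<bar>f x\<bar>) \<le> t * m + t powr (1 - p) * A" if t: "0 < t" for t
  proof -
    have pt: "y \<le> t + t powr (1 - p) * y powr p" if "0 \<le> y" for y
    proof (cases "y \<le> t")
      case False
      then have y: "0 < y" "t < y" using t by auto
      have "y = y powr (1 - p) * y powr p" using y by (simp flip: powr_add)
      also have "\<dots> \<le> t powr (1 - p) * y powr p" using y t p by (intro mult_right_mono powr_mono2') auto
      finally show ?thesis using t by simp
    qed (auto intro: add_increasing2)
    have "(LINT x|M. \<bar>f x\<bar>) \<le> (LINT x|M. t + t powr (1 - p) * \<bar>f x\<bar> powr p)"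
      using fi f by (intro integral_mono pt) (auto simp: Lp_fun_def)
    also have "\<dots> = t * m + t powr (1 - p) * A"
      using f by (subst Bochner_Integration.integral_add) (auto simp: Lp_fun_def A_def m_def)
    finally show ?thesis .
  qed
  have "(LINT x|M. \<bar>f x\<bar>) \<le> (m + 1) * A powr (1 / p)"
  proof (cases "A = 0")
    case False
    then have "(A powr (1/p)) powr (1 - p) * A = A powr (1 / p * (1 - p)) * A powr 1" using A0 by (simp add: powr_powr)
    also have "\<dots> = A powr (1 / p * (1 - p) + 1)" by (simp only: powr_add)
    also have "1 / p * (1 - p) + 1 = 1 / p" using p by (simp add: field_simps)
    finally show ?thesis using *[of "A powr (1/p)"] False A0 by (simp add: algebra_simps)
  next
    case True
    have "(LINT x|M. \<bar>f x\<bar>) \<le> 0"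
    proof (rule field_le_epsilon)
      fix d :: real assume d: "0 < d"
      have m: "0 \<le> m" by (simp add: m_def)
      have "(LINT x|M. \<bar>f x\<bar>) \<le> d / (m + 1) * m" using *[of "d / (m + 1)"] True d m by simp
      also have "\<dots> \<le> 0 + d" using d m by (simp add: field_simps)
      finally show "(LINT x|M. \<bar>f x\<bar>) \<le> 0 + d" .
    qed
    then show ?thesis using True by simp
  qed
  then have "(LINT x|M. \<bar>f x\<bar>) powr p \<le> ((m + 1) * A powr (1 / p)) powr p"
    using p by (intro powr_mono2) auto
  also have "\<dots> = (m + 1) powr p * A" using p A0 by (simp add: powr_mult powr_powr m_def)
  finally show ?thesis by (simp add: A_def m_def)
qed

lemma Lp_fun_truncate:
  assumes p: "0 < p" and f: "Lp_fun p M f" and d: "0 < d"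
  obtains n :: nat where "(LINT x|M. \<bar>f x - max (- real n) (min (real n) (f x))\<bar> powr p) < d"
proof -
  have [measurable]: "f \<in> borel_measurable M" using f by (simp add: Lp_fun_def)
  have "(\<lambda>n. LINT x|M. \<bar>f x - max (- real n) (min (real n) (f x))\<bar> powr p) \<longlonglongrightarrow> (LINT x|M. 0)"
  proof (rule integral_dominated_convergence[where w="\<lambda>x. \<bar>f x\<bar> powr p"])
    show "integrable M (\<lambda>x. \<bar>f x\<bar> powr p)" using f by (simp add: Lp_fun_def)
    have "(\<lambda>n. \<bar>f x - max (- real n) (min (real n) (f x))\<bar> powr p) \<longlonglongrightarrow> 0" for x
    proof (rule tendsto_eventually)
      obtain n0 where "\<bar>f x\<bar> \<le> real n0" using real_arch_simple by blast
      then have "\<bar>f x - max (- real n) (min (real n) (f x))\<bar> powr p = 0" if "n0 \<le> n" for n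
      proof -
        have "\<bar>f x\<bar> \<le> real n" using that \<open>\<bar>f x\<bar> \<le> real n0\<close> by linarith
        then have "max (- real n) (min (real n) (f x)) = f x" by (auto simp: max_def min_def)
        then show ?thesis by simp
      qed
      then show "\<forall>\<^sub>F n in sequentially. \<bar>f x - max (- real n) (min (real n) (f x))\<bar> powr p = 0"
        by (auto simp: eventually_sequentially)
    qed
    then show "AE x in M. (\<lambda>n. \<bar>f x - max (- real n) (min (real n) (f x))\<bar> powr p) \<longlonglongrightarrow> 0" by simp
    show "AE x in M. norm (\<bar>f x - max (- real n) (min (real n) (f x))\<bar> powr p) \<le> \<bar>f x\<bar> powr p" for n
      using p by (intro AE_I2) (auto intro!: powr_mono2 simp: max_def min_def)
  qed measurable
  then have "\<forall>\<^sub>F n in sequentially. (LINT x|M. \<bar>f x - max (- real n) (min (real n) (f x))\<bar> powr p) < d"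
    using d by (intro order_tendstoD) auto
  then show ?thesis using that by (auto simp: eventually_sequentially)
qed

end

text \<open>Collects what the harmonic analysis has to supply: \<open>trunc_bound\<close> concerns
  finite combinations and exponents at most 2, \<open>dense_bounded\<close> only bounded targets.
  Both are extended to all exponents and to all of L^p inside the locale. It is used once for the
  odd and once for the even family; \<open>lev\<close> determines which terms enter the N-th partial
  sum.\<close>

locale orthogonal_system = finite_measure M for M :: "'a measure" +
  fixes K :: "'k set" and lev :: "'k \<Rightarrow> nat" and e :: "'k \<Rightarrow> 'a \<Rightarrow> real"
  assumes finite_lev: "finite {k\<in>K. lev k \<le> N}"
    and e_meas [measurable]: "e k \<in> borel_measurable M"
    and e_bdd: "\<exists>B. \<forall>x\<in>space M. \<bar>e k x\<bar> \<le> B"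
    and e_orth: "k \<in> K \<Longrightarrow> l \<in> K \<Longrightarrow> k \<noteq> l \<Longrightarrow> (LINT x|M. e k x * e l x) = 0"
    and e_nonzero: "k \<in> K \<Longrightarrow> (LINT x|M. e k x * e k x) \<noteq> 0"
    and trunc_bound: "1 < p \<Longrightarrow> p \<le> 2 \<Longrightarrow> \<exists>C>0. \<forall>I a N. finite I \<longrightarrow> I \<subseteq> K \<longrightarrow>
      (LINT x|M. \<bar>\<Sum>k\<in>{k\<in>I. lev k \<le> N}. a k * e k x\<bar> powr p) \<le> C * (LINT x|M. \<bar>\<Sum>k\<in>I. a k * e k x\<bar> powr p)"
    and dense_bounded: "1 < p \<Longrightarrow> f \<in> borel_measurable M \<Longrightarrow> (\<And>x. x \<in> space M \<Longrightarrow> \<bar>f x\<bar> \<le> B) \<Longrightarrow> 0 < d \<Longrightarrow>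
      \<exists>I a. finite I \<and> I \<subseteq> K \<and> (LINT x|M. \<bar>f x - (\<Sum>k\<in>I. a k * e k x)\<bar> powr p) < d"
begin

definition cf :: "('a \<Rightarrow> real) \<Rightarrow> 'k \<Rightarrow> real" where
  "cf f k = (LINT x|M. f x * e k x) / (LINT x|M. e k x * e k x)"

definition psum :: "nat \<Rightarrow> ('a \<Rightarrow> real) \<Rightarrow> 'a \<Rightarrow> real" where
  "psum N f x = (\<Sum>k\<in>{k\<in>K. lev k \<le> N}. cf f k * e k x)"

lemma comb_meas [measurable]: "(\<lambda>x. \<Sum>k\<in>I. a k * e k x) \<in> borel_measurable M"
  by measurable

lemma comb_bdd: "finite I \<Longrightarrow> \<exists>B. \<forall>x\<in>space M. \<bar>\<Sum>k\<in>I. a k * e k x\<bar> \<le> B"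
proof -
  obtain B where B: "\<And>k x. x \<in> space M \<Longrightarrow> \<bar>e k x\<bar> \<le> B k" using e_bdd by metis
  have "\<bar>\<Sum>k\<in>I. a k * e k x\<bar> \<le> (\<Sum>k\<in>I. \<bar>a k\<bar> * B k)" if "x \<in> space M" for x
    by (rule order_trans[OF sum_abs]) (auto simp: abs_mult intro!: sum_mono mult_left_mono B that)
  then show ?thesis by blast
qed

lemma Lp_comb: "finite I \<Longrightarrow> 0 \<le> p \<Longrightarrow> Lp_fun p M (\<lambda>x. \<Sum>k\<in>I. a k * e k x)"
  using comb_bdd[of I a] by (auto intro!: Lp_fun_bounded)

lemma Lp_psum: "0 \<le> p \<Longrightarrow> Lp_fun p M (psum N f)"
  unfolding psum_def[abs_def] by (intro Lp_comb finite_lev)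

lemma integrable_mult_e: "integrable M f \<Longrightarrow> integrable M (\<lambda>x. f x * e k x)"
proof -
  assume f: "integrable M f"
  obtain B where "\<And>x. x \<in> space M \<Longrightarrow> \<bar>e k x\<bar> \<le> B" using e_bdd by metis
  then have "\<bar>f x * e k x\<bar> \<le> \<bar>B * f x\<bar>" if "x \<in> space M" for x
    unfolding abs_mult mult.commute[of "\<bar>f x\<bar>"] using that
    by (intro mult_right_mono) (auto intro: order_trans[OF _ abs_ge_self])
  note le = this
  show ?thesis
  proof (rule Bochner_Integration.integrable_bound)
    show "integrable M (\<lambda>x. B * f x)" using f by simp
    show "(\<lambda>x. f x * e k x) \<in> borel_measurable M"
      by (rule borel_measurable_times[OF borel_measurable_integrable[OF f] e_meas])
    show "AE x in M. norm (f x * e k x) \<le> norm (B * f x)"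
      using le by (intro AE_I2) (simp only: real_norm_def)
  qed
qed

lemma integrable_e: "integrable M (e k)"
proof -
  obtain B where "\<And>x. x \<in> space M \<Longrightarrow> \<bar>e k x\<bar> \<le> B" using e_bdd by metis
  then show ?thesis by (intro integrable_const_bound[where B=B] AE_I2) auto
qed

lemma cf_add: "integrable M f \<Longrightarrow> integrable M g \<Longrightarrow> cf (\<lambda>x. f x + g x) k = cf f k + cf g k"
  by (simp add: cf_def distrib_right integrable_mult_e add_divide_distrib)

lemma psum_add: "integrable M f \<Longrightarrow> integrable M g \<Longrightarrow> psum N (\<lambda>x. f x + g x) x = psum N f x + psum N g x"
  by (simp add: psum_def cf_add distrib_right sum.distrib)

lemma cf_comb:
  assumes "finite I" "I \<subseteq> K" "l \<in> K"
  shows "cf (\<lambda>x. \<Sum>k\<in>I. a k * e k x) l = (if l \<in> I then a l else 0)"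
proof -
  have "(LINT x|M. (\<Sum>k\<in>I. a k * e k x) * e l x) = (LINT x|M. (\<Sum>k\<in>I. a k * (e k x * e l x)))"
    by (simp add: sum_distrib_right mult.assoc)
  also have "\<dots> = (\<Sum>k\<in>I. a k * (LINT x|M. e k x * e l x))"
    by (subst Bochner_Integration.integral_sum) (auto intro!: integrable_mult_e integrable_e)
  also have "\<dots> = (\<Sum>k\<in>I. if k = l then a l * (LINT x|M. e l x * e l x) else 0)"
    using assms by (intro sum.cong) (auto simp: e_orth)
  finally show ?thesis using assms e_nonzero by (simp add: cf_def)
qed

text \<open>By orthogonality the integrals defining the coefficients return those of the
  combination, so the partial sum is the truncation of \<open>trunc_bound\<close>.\<close>

lemma psum_comb:
  assumes "finite I" "I \<subseteq> K"
  shows "psum N (\<lambda>x. \<Sum>k\<in>I. a k * e k x) x = (\<Sum>k\<in>{k\<in>I. lev k \<le> N}. a k * e k x)"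
proof -
  have "psum N (\<lambda>x. \<Sum>k\<in>I. a k * e k x) x = (\<Sum>k\<in>{k\<in>K. lev k \<le> N}. if k \<in> I then a k * e k x else 0)"
    unfolding psum_def using assms by (intro sum.cong) (auto simp: cf_comb)
  also have "\<dots> = (\<Sum>k\<in>{k\<in>K. lev k \<le> N} \<inter> I. a k * e k x)"
    using finite_lev by (simp add: sum.inter_restrict)
  also have "{k\<in>K. lev k \<le> N} \<inter> I = {k\<in>I. lev k \<le> N}" using assms by auto
  finally show ?thesis .
qed

text \<open>Both sides are the same sum of products of coefficients. This self-adjointness is what
  the duality argument rests on.\<close>

lemma psum_symmetric:
  assumes f: "integrable M f" and h: "integrable M h"
  shows "(LINT x|M. psum N f x * h x) = (LINT x|M. f x * psum N h x)"
proof -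
  have "(LINT x|M. psum N f x * h x) = (LINT x|M. (\<Sum>k\<in>{k\<in>K. lev k \<le> N}. cf f k * (h x * e k x)))"
    by (simp add: psum_def sum_distrib_right sum_distrib_left ac_simps)
  also have "\<dots> = (\<Sum>k\<in>{k\<in>K. lev k \<le> N}. cf f k * (LINT x|M. h x * e k x))"
    by (subst Bochner_Integration.integral_sum) (auto intro!: integrable_mult_e h)
  also have "\<dots> = (\<Sum>k\<in>{k\<in>K. lev k \<le> N}. cf h k * (LINT x|M. f x * e k x))"
    by (simp add: cf_def mult.commute)
  also have "\<dots> = (LINT x|M. (\<Sum>k\<in>{k\<in>K. lev k \<le> N}. cf h k * (f x * e k x)))"
    by (subst Bochner_Integration.integral_sum) (auto intro!: integrable_mult_e f)
  also have "\<dots> = (LINT x|M. f x * psum N h x)"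
    by (simp add: psum_def sum_distrib_left ac_simps)
  finally show ?thesis .
qed

text \<open>Each coefficient is bounded by the L^1 norm and there are finitely many of them. The
  constant may depend on N; it will only multiply an approximation error chosen afterwards.\<close>

lemma psum_bound_N:
  assumes p: "1 < p"
  shows "\<exists>D. \<forall>h. Lp_fun p M h \<longrightarrow> (LINT x|M. \<bar>psum N h x\<bar> powr p) \<le> D * (LINT x|M. \<bar>h x\<bar> powr p)"
proof -
  obtain B where B: "\<And>k x. x \<in> space M \<Longrightarrow> \<bar>e k x\<bar> \<le> B k" using e_bdd by metis
  let ?K = "{k\<in>K. lev k \<le> N}"
  let ?m = "measure M (space M)"
  define E where "E = (\<Sum>k\<in>?K. B k / \<bar>LINT x|M. e k x * e k x\<bar> * \<bar>B k\<bar>)"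
  have "(LINT x|M. \<bar>psum N h x\<bar> powr p) \<le> ?m * (\<bar>E\<bar> powr p * (?m + 1) powr p) * (LINT x|M. \<bar>h x\<bar> powr p)" if h: "Lp_fun p M h" for h
  proof -
    have hi: "integrable M h" using integrable_Lp_fun[OF _ h] p by simp
    define H where "H = (LINT x|M. \<bar>h x\<bar>)"
    have H0: "0 \<le> H" by (simp add: H_def)
    have he: "\<bar>LINT x|M. h x * e k x\<bar> \<le> B k * H" for k
    proof -
      have "\<bar>LINT x|M. h x * e k x\<bar> \<le> (LINT x|M. \<bar>h x * e k x\<bar>)" by (rule integral_abs_bound)
      also have "\<dots> \<le> (LINT x|M. B k * \<bar>h x\<bar>)"
      proof (intro integral_mono)
        show "\<bar>h x * e k x\<bar> \<le> B k * \<bar>h x\<bar>" if "x \<in> space M" for x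
          using mult_right_mono[OF B[OF that, of k] abs_ge_zero[of "h x"]] by (simp add: abs_mult mult.commute)
      qed (use hi integrable_mult_e[OF hi, of k] in auto)
      finally show ?thesis by (simp add: H_def)
    qed
    have "\<bar>psum N h x\<bar> \<le> \<bar>E\<bar> * H" if x: "x \<in> space M" for x
    proof -
      have "\<bar>psum N h x\<bar> \<le> (\<Sum>k\<in>?K. \<bar>cf h k * e k x\<bar>)" unfolding psum_def by (rule sum_abs)
      also have "\<dots> \<le> (\<Sum>k\<in>?K. (B k * H / \<bar>LINT x|M. e k x * e k x\<bar>) * \<bar>B k\<bar>)"
        unfolding abs_mult cf_def abs_divide
        using B[OF x] H0 he by (intro sum_mono mult_mono divide_right_mono) 
           (auto intro: order_trans[OF _ abs_ge_self] order_trans[OF abs_ge_zero he] intro!: divide_nonneg_nonneg)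
      also have "\<dots> = E * H" by (simp add: E_def sum_distrib_right sum_distrib_left field_simps)
      also have "\<dots> \<le> \<bar>E\<bar> * H" using H0 by (intro mult_right_mono) auto
      finally show ?thesis .
    qed
    then have "(LINT x|M. \<bar>psum N h x\<bar> powr p) \<le> (LINT x|M. (\<bar>E\<bar> * H) powr p)"
      using p Lp_fun_integrable[OF Lp_psum] by (intro integral_mono powr_mono2) auto
    also have "\<dots> = ?m * (\<bar>E\<bar> powr p * H powr p)" using H0 by (simp add: powr_mult)
    also have "\<dots> \<le> ?m * (\<bar>E\<bar> powr p * ((?m + 1) powr p * (LINT x|M. \<bar>h x\<bar> powr p)))"
      unfolding H_def by (intro mult_left_mono integral_abs_powr_le p h) auto
    finally show ?thesis by (simp add: mult.assoc)
  qed
  then show ?thesis by blast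
qed

lemma dense:
  assumes p: "1 < p" and f: "Lp_fun p M f" and d: "0 < d"
  shows "\<exists>I a. finite I \<and> I \<subseteq> K \<and> (LINT x|M. \<bar>f x - (\<Sum>k\<in>I. a k * e k x)\<bar> powr p) < d"
proof -
  define d' where "d' = d / (2 * 2 powr p)"
  have d': "0 < d'" using d by (simp add: d'_def)
  have f_meas [measurable]: "f \<in> borel_measurable M" using f by (simp add: Lp_fun_def)
  obtain n :: nat where n: "(LINT x|M. \<bar>f x - max (- real n) (min (real n) (f x))\<bar> powr p) < d'"
    using Lp_fun_truncate[OF _ f d'] p by auto
  define g where "g = (\<lambda>x. max (- real n) (min (real n) (f x)))"
  have gm: "g \<in> borel_measurable M" unfolding g_def by measurable
  have gb: "\<bar>g x\<bar> \<le> real n" for x by (auto simp: g_def)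
  have gL: "Lp_fun p M g" using p gm gb by (intro Lp_fun_bounded) auto
  obtain I a where I: "finite I" "I \<subseteq> K" and a: "(LINT x|M. \<bar>g x - (\<Sum>k\<in>I. a k * e k x)\<bar> powr p) < d'"
    using dense_bounded[OF p gm gb d'] by blast
  have "(LINT x|M. \<bar>f x - (\<Sum>k\<in>I. a k * e k x)\<bar> powr p) = (LINT x|M. \<bar>(f x - g x) + (g x - (\<Sum>k\<in>I. a k * e k x))\<bar> powr p)" by simp
  also have "\<dots> \<le> 2 powr p * ((LINT x|M. \<bar>f x - g x\<bar> powr p) + (LINT x|M. \<bar>g x - (\<Sum>k\<in>I. a k * e k x)\<bar> powr p))"
    using p I by (intro integral_add_powr_le Lp_fun_diff f gL Lp_comb) auto
  also have "\<dots> < 2 powr p * (d' + d')" using n a by (intro mult_strict_left_mono add_strict_mono) (auto simp: g_def)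
  also have "\<dots> = d" by (simp add: d'_def)
  finally show ?thesis using I by blast
qed

text \<open>Split f = g + (f - g) with a finite combination g. The part from g obeys the bound with
  uniform C, the rest the one with the N-dependent D. Since g is picked after D, the second
  contribution can be pushed below any d.\<close>

lemma psum_bound_le2:
  assumes p: "1 < p" "p \<le> 2"
  shows "\<exists>C>0. \<forall>N f. Lp_fun p M f \<longrightarrow> (LINT x|M. \<bar>psum N f x\<bar> powr p) \<le> C * (LINT x|M. \<bar>f x\<bar> powr p)"
proof -
  obtain C where C: "0 < C" "\<And>I a N. finite I \<Longrightarrow> I \<subseteq> K \<Longrightarrow>
      (LINT x|M. \<bar>\<Sum>k\<in>{k\<in>I. lev k \<le> N}. a k * e k x\<bar> powr p) \<le> C * (LINT x|M. \<bar>\<Sum>k\<in>I. a k * e k x\<bar> powr p)"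
    using trunc_bound[OF p] by blast
  have "(LINT x|M. \<bar>psum N f x\<bar> powr p) \<le> 2 powr p * C * 2 powr p * (LINT x|M. \<bar>f x\<bar> powr p)" if f: "Lp_fun p M f" for N f
  proof (rule field_le_epsilon)
    fix d :: real assume d: "0 < d"
    obtain D where D: "\<And>h. Lp_fun p M h \<Longrightarrow> (LINT x|M. \<bar>psum N h x\<bar> powr p) \<le> D * (LINT x|M. \<bar>h x\<bar> powr p)"
      using psum_bound_N[OF p(1)] by blast
    \<comment> \<open>An upper bound for the factor that multiplies the approximation error
      \<open>G\<close> in the final estimate; the summand 1 keeps it positive.\<close>
    define t where "t = 2 powr p * (C * 2 powr p + \<bar>D\<bar>) + 1"
    have t: "0 < t" "2 powr p * (C * 2 powr p + \<bar>D\<bar>) \<le> t" using C by (auto simp: t_def intro!: add_nonneg_pos mult_nonneg_nonneg add_nonneg_nonneg)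
    obtain I a where I: "finite I" "I \<subseteq> K" and a: "(LINT x|M. \<bar>f x - (\<Sum>k\<in>I. a k * e k x)\<bar> powr p) < d / t"
      using dense[OF p(1) f, of "d / t"] d t by auto
    define g where "g = (\<lambda>x. \<Sum>k\<in>I. a k * e k x)"
    define G where "G = (LINT x|M. \<bar>f x - g x\<bar> powr p)"
    define F where "F = (LINT x|M. \<bar>f x\<bar> powr p)"
    have gL: "Lp_fun p M g" unfolding g_def using I p by (intro Lp_comb) auto
    have G: "G < d / t" "0 \<le> G" using a by (auto simp: G_def g_def)
    have fgL: "Lp_fun p M (\<lambda>x. f x - g x)" using p by (intro Lp_fun_diff f gL) auto
    note int = integrable_Lp_fun[OF _ gL] integrable_Lp_fun[OF _ fgL] 
    have "psum N f x = psum N g x + psum N (\<lambda>x. f x - g x) x" for x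
      using psum_add[of g "\<lambda>x. f x - g x" N x] int p by simp
    then have "(LINT x|M. \<bar>psum N f x\<bar> powr p) \<le> 2 powr p * ((LINT x|M. \<bar>psum N g x\<bar> powr p) + (LINT x|M. \<bar>psum N (\<lambda>x. f x - g x) x\<bar> powr p))"
      using p by (simp only:) (intro integral_add_powr_le Lp_psum, auto)
    also have "\<dots> \<le> 2 powr p * (C * (2 powr p * (F + G)) + \<bar>D\<bar> * G)"
    proof (intro mult_left_mono add_mono)
      have "(LINT x|M. \<bar>psum N g x\<bar> powr p) \<le> C * (LINT x|M. \<bar>g x\<bar> powr p)"
        unfolding g_def psum_comb[OF I] by (rule C(2)[OF I])
      also have "(LINT x|M. \<bar>g x\<bar> powr p) = (LINT x|M. \<bar>f x + - (f x - g x)\<bar> powr p)" by simp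
      also have "\<dots> \<le> 2 powr p * (F + (LINT x|M. \<bar>- (f x - g x)\<bar> powr p))" unfolding F_def
        using p by (intro integral_add_powr_le f) (simp_all only: Lp_fun_minus_iff fgL)
      also have "(LINT x|M. \<bar>- (f x - g x)\<bar> powr p) = G" by (simp only: G_def abs_minus_cancel)
      finally show "(LINT x|M. \<bar>psum N g x\<bar> powr p) \<le> C * (2 powr p * (F + G))" using C(1) by simp
      have "(LINT x|M. \<bar>psum N (\<lambda>x. f x - g x) x\<bar> powr p) \<le> D * G" unfolding G_def by (rule D[OF fgL])
      also have "\<dots> \<le> \<bar>D\<bar> * G" using G by (intro mult_right_mono) auto
      finally show "(LINT x|M. \<bar>psum N (\<lambda>x. f x - g x) x\<bar> powr p) \<le> \<bar>D\<bar> * G" .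
    qed simp
    also have "\<dots> = 2 powr p * C * 2 powr p * F + 2 powr p * (C * 2 powr p + \<bar>D\<bar>) * G" by (simp add: algebra_simps)
    also have "\<dots> \<le> 2 powr p * C * 2 powr p * F + t * G" using t G by (intro add_left_mono mult_right_mono) auto
    also have "t * G \<le> d" using G t by (simp add: field_simps)
    finally show "(LINT x|M. \<bar>psum N f x\<bar> powr p) \<le> 2 powr p * C * 2 powr p * (LINT x|M. \<bar>f x\<bar> powr p) + d"
      by (simp add: F_def)
  qed
  then show ?thesis using C(1) by (intro exI[of _ "2 powr p * C * 2 powr p"]) auto
qed

text \<open>For p > 2 let A be the integral of |psum N f|^p. Testing against h and moving the
  partial sum onto h gives A = integral of f G with G = psum N h. Young's inequality and the bound
  for the conjugate exponent yield A <= L^p times the integral of |f|^p, plus A/2; A is finite, so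
  A/2 can be absorbed.\<close>

lemma psum_bound:
  assumes p: "1 < p"
  shows "\<exists>C>0. \<forall>N f. Lp_fun p M f \<longrightarrow> (LINT x|M. \<bar>psum N f x\<bar> powr p) \<le> C * (LINT x|M. \<bar>f x\<bar> powr p)"
proof (cases "p \<le> 2")
  case True then show ?thesis using psum_bound_le2 p by blast
next
  case False
  then have p2: "2 < p" by simp
  define q where "q = p / (p - 1)"
  have q: "1 < q" "q \<le> 2" "1 / p + 1 / q = 1" "(p - 1) * q = p" using p2 by (auto simp: q_def field_simps)
  obtain C where C: "0 < C" "\<And>N f. Lp_fun q M f \<Longrightarrow> (LINT x|M. \<bar>psum N f x\<bar> powr q) \<le> C * (LINT x|M. \<bar>f x\<bar> powr q)"
    using psum_bound_le2[OF q(1,2)] by blast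
  \<comment> \<open>The weight in Young's inequality: with L^q = 2C the G-term is at most
    A/2.\<close>
  define L where "L = (2 * C) powr (1 / q)"
  have L: "0 < L" using C by (simp add: L_def)
  have Lq: "L powr q = 2 * C" using C q by (simp add: L_def powr_powr)
  have "(LINT x|M. \<bar>psum N f x\<bar> powr p) \<le> (2 * L powr p) * (LINT x|M. \<bar>f x\<bar> powr p)" if f: "Lp_fun p M f" for N f
  proof -
    define F where "F = psum N f"
    define A where "A = (LINT x|M. \<bar>F x\<bar> powr p)"
    \<comment> \<open>duality: \<open>h\<close> is chosen so that \<open>F h = \<bar>F\<bar>\<^sup>p = \<bar>h\<bar>\<^sup>q\<close>\<close>
    define h where "h = (\<lambda>x. sgn (F x) * \<bar>F x\<bar> powr (p - 1))"
    define G where "G = psum N h"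
    have Fm [measurable]: "F \<in> borel_measurable M" unfolding F_def psum_def[abs_def] by measurable
    have hm [measurable]: "h \<in> borel_measurable M" unfolding h_def by measurable
    have hq: "\<bar>h x\<bar> powr q = \<bar>F x\<bar> powr p" for x
      using q by (simp add: h_def abs_mult powr_mult powr_powr abs_sgn_eq)
    have Fh: "F x * h x = \<bar>F x\<bar> powr p" for x
    proof -
      have "F x * h x = (F x * sgn (F x)) * \<bar>F x\<bar> powr (p - 1)" by (simp add: h_def)
      also have "\<dots> = \<bar>F x\<bar> powr 1 * \<bar>F x\<bar> powr (p - 1)" unfolding abs_sgn[symmetric] by simp
      also have "\<dots> = \<bar>F x\<bar> powr p" by (subst powr_add[symmetric]) simp
      finally show ?thesis .
    qed
    have hL: "Lp_fun q M h"
      using Lp_fun_integrable[OF Lp_psum[of p N f]] p2 by (simp add: Lp_fun_def hq F_def)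
    have fi: "integrable M f" using integrable_Lp_fun[OF _ f] p by simp
    have hi: "integrable M h" using integrable_Lp_fun[OF _ hL] q by simp
    have GL: "Lp_fun q M G" unfolding G_def using q by (intro Lp_psum) auto
    have Gb: "(LINT x|M. \<bar>G x\<bar> powr q) \<le> C * A"
      unfolding G_def A_def using C(2)[OF hL, of N] by (simp add: hq)
    have Young: "f x * G x \<le> L powr p * \<bar>f x\<bar> powr p + \<bar>G x\<bar> powr q / (2 * C)" for x
    proof -
      have "f x * G x \<le> (L * \<bar>f x\<bar>) * (\<bar>G x\<bar> / L)" using L by (simp add: abs_mult[symmetric])
      also have "\<dots> \<le> (L * \<bar>f x\<bar>) powr p / p + (\<bar>G x\<bar> / L) powr q / q"
        using p q L by (intro Youngs_inequality) auto
      also have "\<dots> \<le> (L * \<bar>f x\<bar>) powr p + (\<bar>G x\<bar> / L) powr q"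
        using p q by (intro add_mono divide_le_eq[THEN iffD2]) (auto simp: mult_le_cancel_left1)
      also have "\<dots> = L powr p * \<bar>f x\<bar> powr p + \<bar>G x\<bar> powr q / (2 * C)"
        using L by (simp add: powr_mult powr_divide Lq)
      finally show ?thesis .
    qed
    have "A = (LINT x|M. F x * h x)" by (simp add: A_def Fh)
    also have "\<dots> = (LINT x|M. f x * G x)" unfolding F_def G_def by (rule psum_symmetric[OF fi hi])
    also have "\<dots> \<le> (LINT x|M. L powr p * \<bar>f x\<bar> powr p + \<bar>G x\<bar> powr q / (2 * C))"
    proof (intro integral_mono Young)
      show "integrable M (\<lambda>x. f x * G x)"
      proof -
        have "f x * G x = (\<Sum>k\<in>{k\<in>K. lev k \<le> N}. cf h k * (f x * e k x))" for x
          by (simp add: G_def psum_def sum_distrib_left ac_simps)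
        moreover have "integrable M (\<lambda>x. \<Sum>k\<in>{k\<in>K. lev k \<le> N}. cf h k * (f x * e k x))"
          using fi by (intro Bochner_Integration.integrable_sum integrable_mult_right integrable_mult_e)
        ultimately show ?thesis by simp
      qed
      show "integrable M (\<lambda>x. L powr p * \<bar>f x\<bar> powr p + \<bar>G x\<bar> powr q / (2 * C))"
        using f GL by (auto simp: Lp_fun_def)
    qed
    also have "\<dots> = L powr p * (LINT x|M. \<bar>f x\<bar> powr p) + (LINT x|M. \<bar>G x\<bar> powr q) / (2 * C)"
      using f GL by (subst Bochner_Integration.integral_add) (auto simp: Lp_fun_def)
    also have "(LINT x|M. \<bar>G x\<bar> powr q) / (2 * C) \<le> A / 2" using Gb C(1) by (simp add: field_simps)
    finally show ?thesis by (simp add: A_def F_def)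
  qed
  then show ?thesis using L by (intro exI[of _ "2 * L powr p"]) auto
qed

theorem psum_tendsto:
  assumes p: "1 < p" and f: "Lp_fun p M f"
  shows "(\<lambda>N. LINT x|M. \<bar>psum N f x - f x\<bar> powr p) \<longlonglongrightarrow> 0"
proof (rule LIMSEQ_I)
  fix r :: real assume r: "0 < r"
  obtain C where C: "0 < C" "\<And>N f. Lp_fun p M f \<Longrightarrow> (LINT x|M. \<bar>psum N f x\<bar> powr p) \<le> C * (LINT x|M. \<bar>f x\<bar> powr p)"
    using psum_bound[OF p] by blast
  define d where "d = r / (2 powr p * (C + 1))"
  have d: "0 < d" using r C by (simp add: d_def)
  obtain I a where I: "finite I" "I \<subseteq> K" and a: "(LINT x|M. \<bar>f x - (\<Sum>k\<in>I. a k * e k x)\<bar> powr p) < d"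
    using dense[OF p f d] by blast
  define g where "g = (\<lambda>x. \<Sum>k\<in>I. a k * e k x)"
  have gL: "Lp_fun p M g" unfolding g_def using I p by (intro Lp_comb) auto
  have fgL: "Lp_fun p M (\<lambda>x. f x - g x)" using p by (intro Lp_fun_diff f gL) auto
  have gfL: "Lp_fun p M (\<lambda>x. g x - f x)" using p by (intro Lp_fun_diff f gL) auto
  \<comment> \<open>From the largest level occurring in \<open>g\<close> on, the partial sums
    reproduce \<open>g\<close> exactly.\<close>
  obtain N0 where N0: "\<And>k. k \<in> I \<Longrightarrow> lev k \<le> N0" using I(1) finite_nat_set_iff_bounded_le[of "lev ` I"] by auto
  show "\<exists>N0. \<forall>N\<ge>N0. norm ((LINT x|M. \<bar>psum N f x - f x\<bar> powr p) - 0) < r"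
  proof (intro exI allI impI)
    fix N assume N: "N0 \<le> N"
    have "{k\<in>I. lev k \<le> N} = I" using N0 N by force
    then have g: "psum N g x = g x" for x unfolding g_def psum_comb[OF I] by simp
    have "psum N f x - f x = psum N (\<lambda>x. f x - g x) x + (g x - f x)" for x
      using psum_add[of g "\<lambda>x. f x - g x" N x] integrable_Lp_fun[OF _ gL] integrable_Lp_fun[OF _ fgL] p by (simp add: g)
    then have "(LINT x|M. \<bar>psum N f x - f x\<bar> powr p) \<le> 2 powr p * ((LINT x|M. \<bar>psum N (\<lambda>x. f x - g x) x\<bar> powr p) + (LINT x|M. \<bar>g x - f x\<bar> powr p))"
      using p gfL by (simp only:) (intro integral_add_powr_le Lp_psum, auto)
    also have "\<dots> \<le> 2 powr p * (C * (LINT x|M. \<bar>f x - g x\<bar> powr p) + (LINT x|M. \<bar>f x - g x\<bar> powr p))"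
      using C(2)[OF fgL] by (intro mult_left_mono add_mono) (auto simp: abs_minus_commute)
    also have "\<dots> = (2 powr p * (C + 1)) * (LINT x|M. \<bar>f x - g x\<bar> powr p)" by (simp add: algebra_simps)
    also have "\<dots> < (2 powr p * (C + 1)) * d" using a C by (intro mult_strict_left_mono) (auto simp: g_def)
    also have "\<dots> = r" using C by (simp add: d_def)
    finally show "norm ((LINT x|M. \<bar>psum N f x - f x\<bar> powr p) - 0) < r" by simp
  qed
qed

end

section \<open>Tiling by the alcove\<close>

text \<open>Two one-dimensional substitutions under Fubini's theorem: first in x with factor
  \<open>a\<close>, then in y with factor \<open>D\<close>, the shear being absorbed as a
  translation. The product \<open>a * D\<close> is the determinant.\<close>

lemma nn_integral_plane_affine:
  fixes h :: "real \<times> real \<Rightarrow> ennreal" and a b c d e f :: real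
  assumes h [measurable]: "h \<in> borel_measurable borel" and a: "a \<noteq> 0" and det: "a * d - b * c \<noteq> 0"
  shows "(\<integral>\<^sup>+z. h z \<partial>lborel) = \<bar>a * d - b * c\<bar> * (\<integral>\<^sup>+(x, y). h (a * x + b * y + e, c * x + d * y + f) \<partial>lborel)"
proof -
  define D where "D = (a * d - b * c) / a"
  have D: "D \<noteq> 0" using a det by (simp add: D_def)
  have [measurable]: "h \<in> borel_measurable (borel \<Otimes>\<^sub>M borel)" using h by (simp add: borel_prod)
  have "(\<integral>\<^sup>+(x, y). h (a * x + b * y + e, c * x + d * y + f) \<partial>lborel)
     = (\<integral>\<^sup>+z. (case z of (x, y) \<Rightarrow> h (a * x + b * y + e, c * x + d * y + f)) \<partial>(lborel \<Otimes>\<^sub>M lborel))"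
    by (simp add: lborel_prod)
  also have "\<dots> = (\<integral>\<^sup>+y. \<integral>\<^sup>+x. h (a * x + b * y + e, c * x + d * y + f) \<partial>lborel \<partial>lborel)"
    by (subst lborel_pair.nn_integral_snd[symmetric]) (auto simp: case_prod_unfold)
  also have "\<dots> = (\<integral>\<^sup>+y. \<bar>1 / a\<bar> * (\<integral>\<^sup>+s. h (s, (c / a * (s - e) + f) + D * y) \<partial>lborel) \<partial>lborel)"
  proof (intro nn_integral_cong)
    fix y
    have "(\<integral>\<^sup>+x. h (a * x + b * y + e, c * x + d * y + f) \<partial>lborel) = \<bar>1 / a\<bar> * (\<integral>\<^sup>+s. h (a * (- (b * y + e) / a + 1 / a * s) + b * y + e, c * (- (b * y + e) / a + 1 / a * s) + d * y + f) \<partial>lborel)"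
      using a by (intro nn_integral_real_affine) auto
    moreover have "(a * (- (b * y + e) / a + 1 / a * s) + b * y + e, c * (- (b * y + e) / a + 1 / a * s) + d * y + f)
      = (s, (c / a * (s - e) + f) + D * y)" for s using a by (simp add: D_def field_simps)
    ultimately show "(\<integral>\<^sup>+x. h (a * x + b * y + e, c * x + d * y + f) \<partial>lborel) = \<bar>1 / a\<bar> * (\<integral>\<^sup>+s. h (s, (c / a * (s - e) + f) + D * y) \<partial>lborel)"
      by (simp only:)
  qed
  also have "\<dots> = \<bar>1 / a\<bar> * (\<integral>\<^sup>+y. \<integral>\<^sup>+s. h (s, (c / a * (s - e) + f) + D * y) \<partial>lborel \<partial>lborel)"
    by (rule nn_integral_cmult) measurable
  also have "(\<integral>\<^sup>+y. \<integral>\<^sup>+s. h (s, (c / a * (s - e) + f) + D * y) \<partial>lborel \<partial>lborel) = (\<integral>\<^sup>+s. \<integral>\<^sup>+y. h (s, (c / a * (s - e) + f) + D * y) \<partial>lborel \<partial>lborel)"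
    by (rule lborel_pair.Fubini') measurable
  also have "\<dots> = (\<integral>\<^sup>+s. \<bar>1 / D\<bar> * (\<integral>\<^sup>+t. h (s, t) \<partial>lborel) \<partial>lborel)"
  proof (intro nn_integral_cong)
    fix s
    have "(\<integral>\<^sup>+t. h (s, t) \<partial>lborel) = \<bar>D\<bar> * (\<integral>\<^sup>+y. h (s, (c / a * (s - e) + f) + D * y) \<partial>lborel)"
      using D by (intro nn_integral_real_affine) auto
    then have "ennreal \<bar>1 / D\<bar> * (\<integral>\<^sup>+t. h (s, t) \<partial>lborel) = ennreal (\<bar>1 / D\<bar> * \<bar>D\<bar>) * (\<integral>\<^sup>+y. h (s, (c / a * (s - e) + f) + D * y) \<partial>lborel)"
      by (simp only: ennreal_mult abs_ge_zero mult.assoc)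
    also have "\<bar>1 / D\<bar> * \<bar>D\<bar> = 1" using D by (simp add: abs_mult[symmetric])
    finally show "(\<integral>\<^sup>+y. h (s, (c / a * (s - e) + f) + D * y) \<partial>lborel) = \<bar>1 / D\<bar> * (\<integral>\<^sup>+t. h (s, t) \<partial>lborel)" by simp
  qed
  also have "\<dots> = \<bar>1 / D\<bar> * (\<integral>\<^sup>+s. \<integral>\<^sup>+t. h (s, t) \<partial>lborel \<partial>lborel)"
    by (rule nn_integral_cmult) measurable
  also have "(\<integral>\<^sup>+s. \<integral>\<^sup>+t. h (s, t) \<partial>lborel \<partial>lborel) = (\<integral>\<^sup>+z. h z \<partial>(lborel \<Otimes>\<^sub>M lborel))"
    by (subst lborel.nn_integral_fst) auto
  also have "\<dots> = (\<integral>\<^sup>+z. h z \<partial>lborel)" by (simp add: lborel_prod)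
  finally have "ennreal \<bar>a * d - b * c\<bar> * (\<integral>\<^sup>+(x, y). h (a * x + b * y + e, c * x + d * y + f) \<partial>lborel)
    = ennreal (\<bar>a * d - b * c\<bar> * (\<bar>1 / a\<bar> * \<bar>1 / D\<bar>)) * (\<integral>\<^sup>+z. h z \<partial>lborel)"
    by (simp only: ennreal_mult abs_ge_zero mult_nonneg_nonneg mult.assoc)
  also have "\<bar>a * d - b * c\<bar> * (\<bar>1 / a\<bar> * \<bar>1 / D\<bar>) = 1"
    unfolding D_def using a det by (simp add: abs_mult[symmetric])
  finally show ?thesis by simp
qed

lemma lborel_plane_affine:
  fixes a b c d e f :: real
  assumes a: "a \<noteq> 0" and det: "a * d - b * c \<noteq> 0"
  defines "T \<equiv> \<lambda>(x, y). (a * x + b * y + e, c * x + d * y + f)"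
  shows "lborel = density (distr lborel borel T) (\<lambda>_. \<bar>a * d - b * c\<bar>)"
proof (rule measure_eqI)
  have T_meas [measurable]: "T \<in> borel \<rightarrow>\<^sub>M borel"
    unfolding T_def case_prod_unfold by (intro borel_measurable_continuous_onI continuous_intros)
  fix A :: "(real \<times> real) set" assume "A \<in> sets lborel"
  then have A [measurable]: "A \<in> sets borel" by simp
  have "emeasure lborel A = (\<integral>\<^sup>+z. indicator A z \<partial>lborel)" by simp
  also have "\<dots> = \<bar>a * d - b * c\<bar> * (\<integral>\<^sup>+(x, y). indicator A (a * x + b * y + e, c * x + d * y + f) \<partial>lborel)"
  proof -
    have "(indicator A :: real \<times> real \<Rightarrow> ennreal) \<in> borel_measurable borel" by simp
    note nn_integral_plane_affine[OF this a det, of e f]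
    then show ?thesis .
  qed
  also have "(\<integral>\<^sup>+(x, y). indicator A (a * x + b * y + e, c * x + d * y + f) \<partial>lborel) = (\<integral>\<^sup>+z. indicator A (T z) \<partial>lborel)"
    by (simp add: T_def case_prod_unfold)
  also have "(\<integral>\<^sup>+z. indicator A (T z) \<partial>lborel) = emeasure (distr lborel borel T) A"
    using nn_integral_distr[of T lborel borel "indicator A"] by simp
  finally show "emeasure lborel A = emeasure (density (distr lborel borel T) (\<lambda>_. \<bar>a * d - b * c\<bar>)) A"
    by (simp add: emeasure_density nn_integral_distr nn_integral_cmult)
qed simp

lemma lborel_integral_plane_affine:
  fixes h :: "real \<times> real \<Rightarrow> real"
  assumes h [measurable]: "h \<in> borel_measurable borel" and a: "a \<noteq> 0" and det: "a * d - b * c \<noteq> 0"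
  shows "(LINT z|lborel. h z) = \<bar>a * d - b * c\<bar> * (LINT z|lborel. h (a * fst z + b * snd z + e, c * fst z + d * snd z + f))"
proof -
  have T [measurable]: "(\<lambda>z::real \<times> real. (a * fst z + b * snd z + e, c * fst z + d * snd z + f)) \<in> borel \<rightarrow>\<^sub>M borel"
    by (intro borel_measurable_continuous_onI continuous_intros)
  show ?thesis
    by (subst lborel_plane_affine[OF a det, of e f])
       (simp add: integral_density integral_distr case_prod_unfold)
qed

lemma null_sets_plane_line:
  assumes "(a, b) \<noteq> (0, 0)"
  shows "{z :: real \<times> real. a * fst z + b * snd z = c} \<in> null_sets lborel"
proof -
  have "negligible {z. (a, b) \<bullet> z = c}"
    by (rule negligible_hyperplane) (use assms in \<open>auto simp: zero_prod_def\<close>)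
  moreover have "{z. (a, b) \<bullet> z = c} = {z. a * fst z + b * snd z = c}" by (auto simp: inner_prod_def)
  moreover have "closed {z. (a, b) \<bullet> z = c}" by (rule closed_hyperplane)
  ultimately show ?thesis
    by (auto simp: negligible_iff_null_sets null_sets_def)
qed

text \<open>The half triangle in the coordinates X = pi x / sqrt 3, Y = pi (1 - y). This scaling
  makes all frequencies integers, at the price that the reflections in the slanted sides are no
  longer orthogonal maps.\<close>

definition alcove :: "(real \<times> real) set" where
  "alcove = {(x, y). 0 \<le> x \<and> 3 * x \<le> y \<and> y \<le> pi}"

lemma alcove_alt: "alcove = {z. 0 \<le> fst z \<and> 3 * fst z \<le> snd z \<and> snd z \<le> pi}"
  by (auto simp: alcove_def)

lemma compact_alcove: "compact alcove"
proof -
  have "alcove = {z. 0 \<le> fst z} \<inter> {z. 3 * fst z \<le> snd z} \<inter> {z. snd z \<le> pi}" by (auto simp: alcove_alt)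
  also have "closed \<dots>" by (intro closed_Int closed_Collect_le continuous_intros)
  finally have "closed alcove" .
  moreover have "alcove \<subseteq> cbox (0, 0) (pi, pi)" by (auto simp: alcove_alt)
  then have "bounded alcove" using bounded_cbox bounded_subset by blast
  ultimately show ?thesis by (simp add: compact_eq_bounded_closed)
qed

text \<open>The square of side \<open>2 \<pi>\<close> is tiled by \<open>24\<close> copies of the alcove; the copies are exchanged by
  the reflections and the point reflection under which \<open>\<phi>\<close> is assumed invariant.\<close>

lemma integral_square_eq_alcove:
  fixes \<phi> :: "real \<times> real \<Rightarrow> real"
  assumes cont: "continuous_on UNIV \<phi>"
    and inv1: "\<And>x y. \<phi> ((y - x) / 2, (3 * x + y) / 2) = \<phi> (x, y)"
    and inv2: "\<And>x y. \<phi> ((2 * pi - x - y) / 2, (y - 3 * x + 2 * pi) / 2) = \<phi> (x, y)"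
    and inv3: "\<And>x y. \<phi> (pi - x, pi - y) = \<phi> (x, y)"
    and inv4: "\<And>x y. \<phi> (2 * pi - x, y) = \<phi> (x, y)"
    and inv5: "\<And>x y. \<phi> (x, 2 * pi - y) = \<phi> (x, y)"
  shows "(LINT z:cbox (0,0) (2*pi,2*pi)|lborel. \<phi> z) = 24 * (LINT z:alcove|lborel. \<phi> z)"
proof -
  define I where "I S = (LINT z:S|lborel. \<phi> z)" for S
  have \<phi>m [measurable]: "\<phi> \<in> borel_measurable borel" using cont by (rule borel_measurable_continuous_onI)
  have comp: "set_integrable lborel S \<phi>" if "S \<in> sets borel" "S \<subseteq> cbox (0,0) (2*pi,2*pi)" for S
  proof (rule set_integrable_subset)
    show "set_integrable lborel (cbox (0,0) (2*pi,2*pi)) \<phi>"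
      unfolding set_integrable_def real_scaleR_def[symmetric]
      by (intro borel_integrable_compact continuous_on_subset[OF cont]) auto
  qed (use that in auto)
  have Un: "I (A \<union> B) = I A + I B" 
    if "A \<in> sets borel" "B \<in> sets borel" "A \<subseteq> cbox (0,0) (2*pi,2*pi)" "B \<subseteq> cbox (0,0) (2*pi,2*pi)"
       "A \<inter> B \<subseteq> {z. a * fst z + b * snd z = c}" "(a, b) \<noteq> (0, 0)" for A B a b c
    unfolding I_def
  proof (rule set_integral_Un_AE)
    show "AE x in lborel. \<not> (x \<in> A \<and> x \<in> B)"
      by (rule AE_I'[OF null_sets_plane_line[OF that(6), of c]]) (use that(5) in auto)
  qed (use that in \<open>auto intro!: comp\<close>)
  have pre: "I {z. (a * fst z + b * snd z + e, c * fst z + d * snd z + f) \<in> S} = I S"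
    if S: "S \<in> sets borel" and inv: "\<And>x y. \<phi> (a * x + b * y + e, c * x + d * y + f) = \<phi> (x, y)" 
      and a: "a \<noteq> 0" and det: "\<bar>a * d - b * c\<bar> = 1" for S a b c d e f
  proof -
    have "I S = (LINT z|lborel. indicator S z * \<phi> z)" by (simp add: I_def set_lebesgue_integral_def)
    also have "\<dots> = \<bar>a * d - b * c\<bar> * (LINT z|lborel. indicator S (a * fst z + b * snd z + e, c * fst z + d * snd z + f) * \<phi> (a * fst z + b * snd z + e, c * fst z + d * snd z + f))"
      using S a det by (intro lborel_integral_plane_affine) auto
    also have "\<dots> = I {z. (a * fst z + b * snd z + e, c * fst z + d * snd z + f) \<in> S}"
      unfolding det inv I_def set_lebesgue_integral_def by (auto simp: indicator_def intro!: Bochner_Integration.integral_cong)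
    finally show ?thesis ..
  qed
  have box: "z \<in> cbox (0,0) (2*pi,2*pi) \<longleftrightarrow> 0 \<le> fst z \<and> fst z \<le> 2 * pi \<and> 0 \<le> snd z \<and> snd z \<le> 2 * pi" for z
    by (cases z) auto
  \<comment> \<open>\<open>T2\<close> mirrors the alcove in the line y = 3 x and \<open>T3\<close>
    mirrors \<open>T2\<close> in 3 x + y = 2 pi. Together the three fill the half square
    \<open>H\<close>. The point reflection and the reflections in x = pi and y = pi each double the
    area: 3 * 2 * 2 * 2 = 24.\<close>
  define T2 where "T2 = {z. fst z \<le> snd z \<and> snd z \<le> 3 * fst z \<and> 3 * fst z + snd z \<le> 2 * pi}"
  define T3 where "T3 = {z. fst z \<le> snd z \<and> snd z \<le> pi \<and> 2 * pi \<le> 3 * fst z + snd z}"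
  define H where "H = {z. 0 \<le> fst z \<and> fst z \<le> snd z \<and> snd z \<le> pi}"
  define H' where "H' = {z. 0 \<le> snd z \<and> snd z \<le> fst z \<and> fst z \<le> pi}"
  define Q where "Q = {z. 0 \<le> fst z \<and> fst z \<le> pi \<and> 0 \<le> snd z \<and> snd z \<le> pi}"
  define Q' where "Q' = {z. pi \<le> fst z \<and> fst z \<le> 2 * pi \<and> 0 \<le> snd z \<and> snd z \<le> pi}"
  define R where "R = {z. 0 \<le> fst z \<and> fst z \<le> 2 * pi \<and> 0 \<le> snd z \<and> snd z \<le> pi}"
  define R' where "R' = {z. 0 \<le> fst z \<and> fst z \<le> 2 * pi \<and> pi \<le> snd z \<and> snd z \<le> 2 * pi}"
  have m: "alcove \<in> sets borel" "T2 \<in> sets borel" "T3 \<in> sets borel" "H \<in> sets borel" "H' \<in> sets borel"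
     "Q \<in> sets borel" "Q' \<in> sets borel" "R \<in> sets borel" "R' \<in> sets borel"
    unfolding alcove_alt T2_def T3_def H_def H'_def Q_def Q'_def R_def R'_def
    by (intro borel_closed closed_Collect_conj closed_Collect_le continuous_intros)+
  have s: "alcove \<subseteq> cbox (0,0) (2*pi,2*pi)" "T2 \<subseteq> cbox (0,0) (2*pi,2*pi)" "T3 \<subseteq> cbox (0,0) (2*pi,2*pi)"
     "H \<subseteq> cbox (0,0) (2*pi,2*pi)" "H' \<subseteq> cbox (0,0) (2*pi,2*pi)" "Q \<subseteq> cbox (0,0) (2*pi,2*pi)"
     "Q' \<subseteq> cbox (0,0) (2*pi,2*pi)" "R \<subseteq> cbox (0,0) (2*pi,2*pi)" "R' \<subseteq> cbox (0,0) (2*pi,2*pi)"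
    unfolding subset_eq box
    by (auto simp: alcove_alt T2_def T3_def H_def H'_def Q_def Q'_def R_def R'_def)
  have "I T2 = I alcove"
  proof -
    have "{z. (-1/2 * fst z + 1/2 * snd z + 0, 3/2 * fst z + 1/2 * snd z + 0) \<in> alcove} = T2"
      by (auto simp: alcove_alt T2_def)
    then show ?thesis using pre[of alcove "-1/2" "1/2" 0 "3/2" "1/2" 0] m inv1
      by (simp add: field_simps)
  qed
  moreover have "I T3 = I T2"
  proof -
    have "{z. (-1/2 * fst z + -1/2 * snd z + pi, -3/2 * fst z + 1/2 * snd z + pi) \<in> T2} = T3"
      by (auto simp: T3_def T2_def)
    moreover have "\<phi> (-1/2 * x + -1/2 * y + pi, -3/2 * x + 1/2 * y + pi) = \<phi> (x, y)" for x y
      using inv2[of x y] by (simp add: field_simps)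
    ultimately show ?thesis using pre[of T2 "-1/2" "-1/2" pi "-3/2" "1/2" pi] m by simp
  qed
  moreover have "I H = I alcove + I T2 + I T3"
  proof -
    have "H = (alcove \<union> T2) \<union> T3" by (auto simp: alcove_alt H_def T2_def T3_def)
    moreover have "I ((alcove \<union> T2) \<union> T3) = I (alcove \<union> T2) + I T3"
      by (rule Un[where a = 3 and b = 1 and c = "2 * pi"]) 
         (use m s in \<open>auto simp: alcove_alt T2_def T3_def\<close>)
    moreover have "I (alcove \<union> T2) = I alcove + I T2"
      by (rule Un[where a = 3 and b = "-1" and c = 0]) 
         (use m s in \<open>auto simp: alcove_alt T2_def\<close>)
    ultimately show ?thesis by simp
  qed
  moreover have "I H' = I H"
  proof -
    have "{z. (-1 * fst z + 0 * snd z + pi, 0 * fst z + -1 * snd z + pi) \<in> H} = H'"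
      by (auto simp: H_def H'_def)
    moreover have "\<phi> (-1 * x + 0 * y + pi, 0 * x + -1 * y + pi) = \<phi> (x, y)" for x y
      using inv3[of x y] by simp
    ultimately show ?thesis using pre[of H "-1" 0 pi 0 "-1" pi] m by simp
  qed
  moreover have "I Q = I H + I H'"
  proof -
    have "Q = H \<union> H'" by (auto simp: H_def H'_def Q_def)
    moreover have "I (H \<union> H') = I H + I H'"
      by (rule Un[where a = 1 and b = "-1" and c = 0]) (use m s in \<open>auto simp: H_def H'_def\<close>)
    ultimately show ?thesis by simp
  qed
  moreover have "I Q' = I Q"
  proof -
    have "{z. (-1 * fst z + 0 * snd z + 2 * pi, 0 * fst z + 1 * snd z + 0) \<in> Q} = Q'"
      by (auto simp: Q_def Q'_def)
    moreover have "\<phi> (-1 * x + 0 * y + 2 * pi, 0 * x + 1 * y + 0) = \<phi> (x, y)" for x y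
      using inv4[of x y] by simp
    ultimately show ?thesis using pre[of Q "-1" 0 "2 * pi" 0 1 0] m by simp
  qed
  moreover have "I R = I Q + I Q'"
  proof -
    have "R = Q \<union> Q'" by (auto simp: Q_def Q'_def R_def)
    moreover have "I (Q \<union> Q') = I Q + I Q'"
      by (rule Un[where a = 1 and b = 0 and c = pi]) (use m s in \<open>auto simp: Q_def Q'_def\<close>)
    ultimately show ?thesis by simp
  qed
  moreover have "I R' = I R"
  proof -
    have "{z. (1 * fst z + 0 * snd z + 0, 0 * fst z + -1 * snd z + 2 * pi) \<in> R} = R'"
      by (auto simp: R_def R'_def)
    moreover have "\<phi> (1 * x + 0 * y + 0, 0 * x + -1 * y + 2 * pi) = \<phi> (x, y)" for x y
      using inv5[of x y] by simp
    ultimately show ?thesis using pre[of R 1 0 0 0 "-1" "2 * pi"] m by simp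
  qed
  moreover have "I (cbox (0,0) (2*pi,2*pi)) = I R + I R'"
  proof -
    have "cbox (0,0) (2*pi,2*pi) = R \<union> R'" by (auto simp: set_eq_iff box R_def R'_def)
    moreover have "I (R \<union> R') = I R + I R'"
      by (rule Un[where a = 0 and b = 1 and c = pi]) (use m s in \<open>auto simp: R_def R'_def\<close>)
    ultimately show ?thesis by simp
  qed
  ultimately have "I (cbox (0,0) (2*pi,2*pi)) = 24 * I alcove" by simp
  then show ?thesis by (simp add: I_def)
qed

lemma iterated_integral_square:
  fixes \<phi> :: "real \<times> real \<Rightarrow> real"
  assumes cont: "continuous_on UNIV \<phi>"
  shows "integral {a..b} (\<lambda>x. integral {c..d} (\<lambda>y. \<phi> (x, y))) = (LINT z:cbox (a,c) (b,d)|lborel. \<phi> z)"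
proof -
  have c: "continuous_on (cbox (a,c) (b,d)) \<phi>" by (rule continuous_on_subset[OF cont]) simp
  have "set_integrable lborel (cbox (a,c) (b,d)) \<phi>"
    unfolding set_integrable_def by (intro borel_integrable_compact c) auto
  then have "(LINT z:cbox (a,c) (b,d)|lborel. \<phi> z) = integral (cbox (a,c) (b,d)) \<phi>"
    by (rule set_borel_integral_eq_integral)
  also have "\<dots> = integral (cbox a b) (\<lambda>x. integral (cbox c d) (\<lambda>y. \<phi> (x, y)))"
    by (rule integral_prod_continuous[OF c])
  finally show ?thesis by simp
qed

section \<open>Eigenfunctions as reflection-odd exponential sums\<close>

text \<open>The phase \<theta> takes the values 0 and pi/2, so that cosine and sine in x, and with
  them the even and the odd family, are treated by one argument.\<close>

definition cos_sin :: "real \<Rightarrow> int \<Rightarrow> int \<Rightarrow> real \<times> real \<Rightarrow> real" where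
  "cos_sin \<theta> m n = (\<lambda>(x, y). cos (of_int m * x - \<theta>) * sin (of_int n * y))"

text \<open>
  With \<open>X = \<pi> x / \<surd>3\<close>, \<open>Y = \<pi> (1 - y)\<close>, \<open>q = (m + n) / 2\<close> and \<open>r = (n - m) / 2\<close> this is \<open>v\<^bsub>m,n\<^esub>\<close> for \<open>\<theta> = 0\<close> and
  \<open>u\<^bsub>m,n\<^esub>\<close> for \<open>\<theta> = \<pi> / 2\<close>, up to the factor \<open>- 2 (- 1)\<^sup>n\<close>. The frequencies of the three terms are
  \<open>(m, n)\<close> and its rotations by \<open>\<plusminus> 120\<close> degrees.
\<close>

definition tri_mode :: "real \<Rightarrow> int \<Rightarrow> int \<Rightarrow> real \<times> real \<Rightarrow> real" where
  "tri_mode \<theta> q r z = cos_sin \<theta> (q - r) (q + r) z + cos_sin \<theta> (- 2 * q - r) (- r) z + cos_sin \<theta> (q + 2 * r) (- q) z"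

lemma cos_sin_minus: "cos_sin \<theta> m (- n) z = - cos_sin \<theta> m n z"
  by (simp add: cos_sin_def case_prod_unfold)

lemma cos_sin_sin:
  "cos_sin \<theta> m n (x, y) = (sin (of_int m * x + of_int n * y - \<theta>) - sin (of_int m * x + of_int (- n) * y - \<theta>)) / 2"
proof -
  have "sin (a + b - \<theta>) - sin (a + - b - \<theta>) = sin ((a - \<theta>) + b) - sin ((a - \<theta>) - b)" for a b
    by (simp add: algebra_simps)
  then show ?thesis by (simp add: cos_sin_def sin_add sin_diff)
qed

lemma tri_mode_sin:
  "tri_mode \<theta> q r (x, y) =
    (sin (of_int (q - r) * x + of_int (q + r) * y - \<theta>) - sin (of_int (q - r) * x + of_int (- q - r) * y - \<theta>)
   + sin (of_int (- 2 * q - r) * x + of_int (- r) * y - \<theta>) - sin (of_int (- 2 * q - r) * x + of_int r * y - \<theta>)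
   + sin (of_int (q + 2 * r) * x + of_int (- q) * y - \<theta>) - sin (of_int (q + 2 * r) * x + of_int q * y - \<theta>)) / 2"
proof -
  have *: "- (q + r) = - q - r" "- (- r) = r" "- (- q) = q" by auto
  show ?thesis unfolding tri_mode_def cos_sin_sin * by (simp only: add_divide_distrib diff_divide_distrib)
qed

section \<open>Symmetries of the modes in the index and in the variable\<close>

lemma tri_mode_rotate: "tri_mode \<theta> (- q - r) q = tri_mode \<theta> q r"
proof -
  have *: "- q - r - q = - 2 * q - r" "- q - r + q = - r" "- 2 * (- q - r) - q = q + 2 * r"
    "- q - r + 2 * q = q - r" "- (- q - r) = q + r" by auto
  show ?thesis unfolding tri_mode_def[abs_def] * by (simp only: add_ac)
qed

lemma tri_mode_negate: "tri_mode \<theta> (- r) (- q) z = - tri_mode \<theta> q r z"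
proof -
  have *: "- r - - q = q - r" "- r + - q = - (q + r)" "- 2 * - r - - q = q + 2 * r"
    "- r + 2 * - q = - 2 * q - r" by auto
  show ?thesis unfolding tri_mode_def * cos_sin_minus by simp
qed

lemma tri_mode_0_right: "tri_mode \<theta> q 0 z = 0"
  by (simp add: tri_mode_def cos_sin_minus) (simp add: cos_sin_def case_prod_unfold)

text \<open>Here \<open>cos (2 * \<theta>)\<close> is 1 or -1; it serves throughout as the parity in
  x of the family.\<close>

lemma cos_reflect:
  assumes "\<theta> \<in> {0, pi / 2}"
  shows "cos (- u - \<theta>) = cos (2 * \<theta>) * cos (u - \<theta>)"
proof (cases "\<theta> = 0")
  case False
  then have "\<theta> = pi / 2" using assms by auto
  then show ?thesis unfolding \<open>\<theta> = pi / 2\<close> by (simp add: cos_diff)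
qed simp

lemma cos_sin_swap:
  assumes "\<theta> \<in> {0, pi / 2}"
  shows "cos_sin \<theta> (- m) n z = cos (2 * \<theta>) * cos_sin \<theta> m n z"
  using cos_reflect[OF assms, of "of_int m * fst z"] by (simp add: cos_sin_def case_prod_unfold)

lemma tri_mode_swap:
  assumes "\<theta> \<in> {0, pi / 2}"
  shows "tri_mode \<theta> r q z = cos (2 * \<theta>) * tri_mode \<theta> q r z"
proof -
  have *: "r - q = - (q - r)" "r + q = q + r" "- 2 * r - q = - (q + 2 * r)" "r + 2 * q = - (- 2 * q - r)" by auto
  show ?thesis unfolding tri_mode_def[of \<theta> r q] * cos_sin_swap[OF assms] by (simp add: tri_mode_def distrib_left)
qed

lemma tri_mode_swap_diag: "tri_mode (pi / 2) q q z = 0"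
  using tri_mode_swap[of "pi / 2" q q z] by simp

lemma continuous_tri_mode: "continuous_on S (tri_mode \<theta> q r)"
  unfolding tri_mode_def[abs_def] cos_sin_def case_prod_unfold by (intro continuous_intros)

text \<open>The linear reflection in y = 3 x permutes the six frequencies of
  \<open>tri_mode_sin\<close> and exchanges those with plus sign and those with minus sign.\<close>

lemma tri_mode_reflect1: "tri_mode \<theta> q r ((y - x) / 2, (3 * x + y) / 2) = - tri_mode \<theta> q r (x, y)"
proof -
  have *: "of_int (q - r) * ((y - x) / 2) + of_int (q + r) * ((3 * x + y) / 2) = of_int (q + 2 * r) * x + of_int q * y"
    "of_int (q - r) * ((y - x) / 2) + of_int (- q - r) * ((3 * x + y) / 2) = of_int (- 2 * q - r) * x + of_int (- r) * y"
    "of_int (- 2 * q - r) * ((y - x) / 2) + of_int (- r) * ((3 * x + y) / 2) = of_int (q - r) * x + of_int (- q - r) * y"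
    "of_int (- 2 * q - r) * ((y - x) / 2) + of_int r * ((3 * x + y) / 2) = of_int (q + 2 * r) * x + of_int (- q) * y"
    "of_int (q + 2 * r) * ((y - x) / 2) + of_int (- q) * ((3 * x + y) / 2) = of_int (- 2 * q - r) * x + of_int r * y"
    "of_int (q + 2 * r) * ((y - x) / 2) + of_int q * ((3 * x + y) / 2) = of_int (q - r) * x + of_int (q + r) * y"
    by (simp_all add: field_simps)
  have alt_sum1: "(a - b + c - d + e - f) / 2 = - ((f - c + b - e + d - a) / 2)" for a b c d e f :: real
    by (simp add: field_simps)
  show ?thesis unfolding tri_mode_sin * by (rule alt_sum1)
qed

lemma sin_add_2pi_int: "sin (u + of_int k * (2 * pi)) = sin u"
  by (simp add: sin_add cos_int_2pin sin_int_2pin mult.commute[of _ "2 * pi"])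

lemma cos_add_2pi_int: "cos (u + of_int k * (2 * pi)) = cos u"
  by (simp add: cos_add cos_int_2pin sin_int_2pin mult.commute[of _ "2 * pi"])

text \<open>As before, but with a translation by (pi, pi). It contributes phases that are multiples
  of 2 pi, since both components of each frequency have the same parity.\<close>

lemma tri_mode_reflect2:
  "tri_mode \<theta> q r ((2 * pi - x - y) / 2, (y - 3 * x + 2 * pi) / 2) = - tri_mode \<theta> q r (x, y)"
proof -
  have *: "of_int (q - r) * ((2 * pi - x - y) / 2) + of_int (q + r) * ((y - 3 * x + 2 * pi) / 2) - \<theta>
      = (of_int (- 2 * q - r) * x + of_int r * y - \<theta>) + of_int q * (2 * pi)"
    "of_int (q - r) * ((2 * pi - x - y) / 2) + of_int (- q - r) * ((y - 3 * x + 2 * pi) / 2) - \<theta>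
      = (of_int (q + 2 * r) * x + of_int (- q) * y - \<theta>) + of_int (- r) * (2 * pi)"
    "of_int (- 2 * q - r) * ((2 * pi - x - y) / 2) + of_int (- r) * ((y - 3 * x + 2 * pi) / 2) - \<theta>
      = (of_int (q + 2 * r) * x + of_int q * y - \<theta>) + of_int (- q - r) * (2 * pi)"
    "of_int (- 2 * q - r) * ((2 * pi - x - y) / 2) + of_int r * ((y - 3 * x + 2 * pi) / 2) - \<theta>
      = (of_int (q - r) * x + of_int (q + r) * y - \<theta>) + of_int (- q) * (2 * pi)"
    "of_int (q + 2 * r) * ((2 * pi - x - y) / 2) + of_int (- q) * ((y - 3 * x + 2 * pi) / 2) - \<theta>
      = (of_int (q - r) * x + of_int (- q - r) * y - \<theta>) + of_int r * (2 * pi)"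
    "of_int (q + 2 * r) * ((2 * pi - x - y) / 2) + of_int q * ((y - 3 * x + 2 * pi) / 2) - \<theta>
      = (of_int (- 2 * q - r) * x + of_int (- r) * y - \<theta>) + of_int (q + r) * (2 * pi)"
    by (simp_all add: field_simps)
  have alt_sum2: "(a - b + c - d + e - f) / 2 = - ((d - e + f - a + b - c) / 2)" for a b c d e f :: real
    by (simp add: field_simps)
  show ?thesis unfolding tri_mode_sin * sin_add_2pi_int by (rule alt_sum2)
qed

lemma tri_mode_2pi_minus_x:
  assumes "\<theta> \<in> {0, pi / 2}"
  shows "tri_mode \<theta> q r (2 * pi - x, y) = cos (2 * \<theta>) * tri_mode \<theta> q r (x, y)"
proof -
  have "cos (of_int m * (2 * pi - x) - \<theta>) = cos (2 * \<theta>) * cos (of_int m * x - \<theta>)" for m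
  proof -
    have "cos (of_int m * (2 * pi - x) - \<theta>) = cos ((- (of_int m * x) - \<theta>) + of_int m * (2 * pi))"
      by (simp add: algebra_simps)
    then show ?thesis by (simp only: cos_add_2pi_int cos_reflect[OF assms])
  qed
  then show ?thesis by (simp only: tri_mode_def cos_sin_def split distrib_left mult.assoc)
qed

lemma tri_mode_2pi_minus_y: "tri_mode \<theta> q r (x, 2 * pi - y) = - tri_mode \<theta> q r (x, y)"
proof -
  have "sin (of_int n * (2 * pi - y)) = - sin (of_int n * y)" for n
  proof -
    have "sin (of_int n * (2 * pi - y)) = sin (- (of_int n * y) + of_int n * (2 * pi))"
      by (simp add: algebra_simps)
    then show ?thesis by (simp only: sin_add_2pi_int sin_minus)
  qed
  note * = this
  show ?thesis by (simp only: tri_mode_def cos_sin_def split * mult_minus_right minus_add_distrib)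
qed

text \<open>Because m and n have the same parity, both factors pick up the same sign cos (m pi),
  whose square is 1.\<close>

lemma cos_sin_point_reflect:
  assumes "\<theta> \<in> {0, pi / 2}" and mn: "m + n = 2 * j"
  shows "cos_sin \<theta> m n (pi - x, pi - y) = - cos (2 * \<theta>) * cos_sin \<theta> m n (x, y)"
proof -
  have s0: "sin (of_int m * pi) = 0" by (simp add: sin_times_pi_eq_0)
  then have c1: "cos (of_int m * pi) * cos (of_int m * pi) = 1"
    using sin_cos_squared_add3[of "of_int m * pi"] by simp
  have n: "n = 2 * j - m" using mn by simp
  have "cos (of_int m * (pi - x) - \<theta>) = cos (of_int m * pi + (- (of_int m * x) - \<theta>))" by (simp add: algebra_simps)
  also have "\<dots> = cos (of_int m * pi) * (cos (2 * \<theta>) * cos (of_int m * x - \<theta>))"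
    by (simp add: cos_add s0 cos_reflect[OF assms(1)])
  finally have 1: "cos (of_int m * (pi - x) - \<theta>) = cos (of_int m * pi) * (cos (2 * \<theta>) * cos (of_int m * x - \<theta>))" .
  have "sin (of_int n * (pi - y)) = sin (- (of_int m * pi + of_int n * y) + of_int j * (2 * pi))"
    by (simp add: n algebra_simps)
  also have "\<dots> = - (cos (of_int m * pi) * sin (of_int n * y))"
    unfolding sin_add_2pi_int by (simp add: sin_add sin_diff s0)
  finally have 2: "sin (of_int n * (pi - y)) = - (cos (of_int m * pi) * sin (of_int n * y))" .
  have "cos_sin \<theta> m n (pi - x, pi - y) = - (cos (of_int m * pi) * cos (of_int m * pi)) * (cos (2 * \<theta>) * cos_sin \<theta> m n (x, y))"
    by (simp only: cos_sin_def split 1 2) (simp add: ac_simps)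
  then show ?thesis by (simp add: c1)
qed

lemma tri_mode_point_reflect:
  assumes "\<theta> \<in> {0, pi / 2}"
  shows "tri_mode \<theta> q r (pi - x, pi - y) = - cos (2 * \<theta>) * tri_mode \<theta> q r (x, y)"
  using cos_sin_point_reflect[OF assms, of "q - r" "q + r" q x y]
    cos_sin_point_reflect[OF assms, of "- 2 * q - r" "- r" "- q - r" x y]
    cos_sin_point_reflect[OF assms, of "q + 2 * r" "- q" r x y]
  by (simp add: tri_mode_def distrib_left)

text \<open>Half the sum of the exponentials with the six frequencies \<plusminus>(2, 0) and
  (\<plusminus>1, \<plusminus>1), which form one orbit of the linear symmetries. \<open>chi2\<close>
  does the same for the orbit of \<plusminus>(0, 2) and (\<plusminus>3, \<plusminus>1).\<close>

definition chi1 :: "real \<times> real \<Rightarrow> real" where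
  "chi1 = (\<lambda>(x, y). cos (2 * x) + 2 * cos x * cos y)"

definition chi2 :: "real \<times> real \<Rightarrow> real" where
  "chi2 = (\<lambda>(x, y). cos (2 * y) + 2 * cos (3 * x) * cos y)"

lemma chi1_mult_cos_sin:
  "2 * chi1 z * cos_sin \<theta> m n z = cos_sin \<theta> (m + 2) n z + cos_sin \<theta> (m - 2) n z
    + cos_sin \<theta> (m + 1) (n + 1) z + cos_sin \<theta> (m + 1) (n - 1) z + cos_sin \<theta> (m - 1) (n + 1) z + cos_sin \<theta> (m - 1) (n - 1) z"
proof -
  obtain x y where z: "z = (x, y)" by (cases z)
  have *: "2 * chi1 (x, y) * (cos A * sin B) = cos (A + 2 * x) * sin B + cos (A - 2 * x) * sin B
    + cos (A + x) * sin (B + y) + cos (A + x) * sin (B - y) + cos (A - x) * sin (B + y) + cos (A - x) * sin (B - y)" for A B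
    unfolding cos_add cos_diff sin_add sin_diff by (simp add: chi1_def algebra_simps)
  have "of_int (m + 2) * x - \<theta> = of_int m * x - \<theta> + 2 * x" "of_int (m - 2) * x - \<theta> = of_int m * x - \<theta> - 2 * x"
     "of_int (m + 1) * x - \<theta> = of_int m * x - \<theta> + x" "of_int (m - 1) * x - \<theta> = of_int m * x - \<theta> - x"
     "of_int (n + 1) * y = of_int n * y + y" "of_int (n - 1) * y = of_int n * y - y"
    by (simp_all add: algebra_simps)
  then show ?thesis unfolding z cos_sin_def split * by (simp only:)
qed

lemma chi2_mult_cos_sin:
  "2 * chi2 z * cos_sin \<theta> m n z = cos_sin \<theta> m (n + 2) z + cos_sin \<theta> m (n - 2) z
    + cos_sin \<theta> (m + 3) (n + 1) z + cos_sin \<theta> (m + 3) (n - 1) z + cos_sin \<theta> (m - 3) (n + 1) z + cos_sin \<theta> (m - 3) (n - 1) z"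
proof -
  obtain x y where z: "z = (x, y)" by (cases z)
  have *: "2 * chi2 (x, y) * (cos A * sin B) = cos A * sin (B + 2 * y) + cos A * sin (B - 2 * y)
    + cos (A + 3 * x) * sin (B + y) + cos (A + 3 * x) * sin (B - y) + cos (A - 3 * x) * sin (B + y) + cos (A - 3 * x) * sin (B - y)" for A B
    unfolding cos_add cos_diff sin_add sin_diff by (simp add: chi2_def algebra_simps)
  have "of_int (m + 3) * x - \<theta> = of_int m * x - \<theta> + 3 * x" "of_int (m - 3) * x - \<theta> = of_int m * x - \<theta> - 3 * x"
     "of_int (n + 2) * y = of_int n * y + 2 * y" "of_int (n - 2) * y = of_int n * y - 2 * y"
     "of_int (n + 1) * y = of_int n * y + y" "of_int (n - 1) * y = of_int n * y - y"
    by (simp_all add: algebra_simps)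
  then show ?thesis unfolding z cos_sin_def split * by (simp only:)
qed

lemma tri_mode_eqI:
  assumes "m1 = q - r" "n1 = q + r" "m2 = - 2 * q - r" "n2 = - r" "m3 = q + 2 * r" "n3 = - q"
  shows "tri_mode \<theta> q r z = cos_sin \<theta> m1 n1 z + cos_sin \<theta> m2 n2 z + cos_sin \<theta> m3 n3 z"
  unfolding assms tri_mode_def ..

text \<open>Multiplication shifts each of the three frequencies by the six vectors of the orbit. As
  the orbit is invariant under the rotations, the 18 terms regroup into six complete modes.\<close>

lemma chi1_mult_tri_mode:
  "2 * chi1 z * tri_mode \<theta> q r z = tri_mode \<theta> (q + 1) (r - 1) z + tri_mode \<theta> (q - 1) (r + 1) z
     + tri_mode \<theta> (q + 1) r z + tri_mode \<theta> (q - 1) r z + tri_mode \<theta> q (r - 1) z + tri_mode \<theta> q (r + 1) z"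
proof -
  let ?c = "\<lambda>m n. cos_sin \<theta> m n z"
  let ?a = "q - r" and ?b = "q + r" and ?c1 = "- 2 * q - r" and ?c2 = "- r" and ?d = "q + 2 * r" and ?e = "- q"
  have "tri_mode \<theta> (q + 1) (r - 1) z = ?c (?a + 2) ?b + ?c (?c1 - 1) (?c2 + 1) + ?c (?d - 1) (?e - 1)"
    "tri_mode \<theta> (q - 1) (r + 1) z = ?c (?a - 2) ?b + ?c (?c1 + 1) (?c2 - 1) + ?c (?d + 1) (?e + 1)"
    "tri_mode \<theta> (q + 1) r z = ?c (?a + 1) (?b + 1) + ?c (?c1 - 2) ?c2 + ?c (?d + 1) (?e - 1)"
    "tri_mode \<theta> (q - 1) r z = ?c (?a - 1) (?b - 1) + ?c (?c1 + 2) ?c2 + ?c (?d - 1) (?e + 1)"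
    "tri_mode \<theta> q (r - 1) z = ?c (?a + 1) (?b - 1) + ?c (?c1 + 1) (?c2 + 1) + ?c (?d - 2) ?e"
    "tri_mode \<theta> q (r + 1) z = ?c (?a - 1) (?b + 1) + ?c (?c1 - 1) (?c2 - 1) + ?c (?d + 2) ?e"
    by (rule tri_mode_eqI; simp)+
  then show ?thesis unfolding tri_mode_def[of \<theta> q r] distrib_left chi1_mult_cos_sin by simp
qed

lemma chi2_mult_tri_mode:
  "2 * chi2 z * tri_mode \<theta> q r z = tri_mode \<theta> (q + 1) (r + 1) z + tri_mode \<theta> (q - 1) (r - 1) z
     + tri_mode \<theta> (q + 2) (r - 1) z + tri_mode \<theta> (q - 2) (r + 1) z + tri_mode \<theta> (q + 1) (r - 2) z + tri_mode \<theta> (q - 1) (r + 2) z"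
proof -
  let ?c = "\<lambda>m n. cos_sin \<theta> m n z"
  let ?a = "q - r" and ?b = "q + r" and ?c1 = "- 2 * q - r" and ?c2 = "- r" and ?d = "q + 2 * r" and ?e = "- q"
  have "tri_mode \<theta> (q + 1) (r + 1) z = ?c ?a (?b + 2) + ?c (?c1 - 3) (?c2 - 1) + ?c (?d + 3) (?e - 1)"
    "tri_mode \<theta> (q - 1) (r - 1) z = ?c ?a (?b - 2) + ?c (?c1 + 3) (?c2 + 1) + ?c (?d - 3) (?e + 1)"
    "tri_mode \<theta> (q + 2) (r - 1) z = ?c (?a + 3) (?b + 1) + ?c (?c1 - 3) (?c2 + 1) + ?c ?d (?e - 2)"
    "tri_mode \<theta> (q - 2) (r + 1) z = ?c (?a - 3) (?b - 1) + ?c (?c1 + 3) (?c2 - 1) + ?c ?d (?e + 2)"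
    "tri_mode \<theta> (q + 1) (r - 2) z = ?c (?a + 3) (?b - 1) + ?c ?c1 (?c2 + 2) + ?c (?d - 3) (?e - 1)"
    "tri_mode \<theta> (q - 1) (r + 2) z = ?c (?a - 3) (?b + 1) + ?c ?c1 (?c2 - 2) + ?c (?d + 3) (?e + 1)"
    by (rule tri_mode_eqI; simp)+
  then show ?thesis unfolding tri_mode_def[of \<theta> q r] distrib_left chi2_mult_cos_sin by simp
qed

text \<open>A fundamental chamber: one representative for each orbit of frequencies. The wall q = r,
  that is m = 0, survives only in the even family.\<close>

definition mode_index :: "real \<Rightarrow> (int \<times> int) set" where
  "mode_index \<theta> = {(q, r). 1 \<le> r \<and> r \<le> q \<and> (\<theta> \<noteq> 0 \<longrightarrow> r < q)}"

definition mode_span :: "real \<Rightarrow> (real \<times> real \<Rightarrow> real) set" where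
  "mode_span \<theta> = {w. \<exists>I a. finite I \<and> I \<subseteq> mode_index \<theta> \<and> w = (\<lambda>z. \<Sum>k\<in>I. a k * tri_mode \<theta> (fst k) (snd k) z)}"

lemma mode_span_add:
  assumes "v \<in> mode_span \<theta>" "w \<in> mode_span \<theta>" shows "(\<lambda>z. v z + w z) \<in> mode_span \<theta>"
proof -
  obtain I a where I: "finite I" "I \<subseteq> mode_index \<theta>" "v = (\<lambda>z. \<Sum>k\<in>I. a k * tri_mode \<theta> (fst k) (snd k) z)"
    using assms(1) by (auto simp: mode_span_def)
  obtain J b where J: "finite J" "J \<subseteq> mode_index \<theta>" "w = (\<lambda>z. \<Sum>k\<in>J. b k * tri_mode \<theta> (fst k) (snd k) z)"
    using assms(2) by (auto simp: mode_span_def)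
  define c where "c k = (if k \<in> I then a k else 0) + (if k \<in> J then b k else 0)" for k
  have "v z + w z = (\<Sum>k\<in>I \<union> J. c k * tri_mode \<theta> (fst k) (snd k) z)" for z
  proof -
    have "v z = (\<Sum>k\<in>I \<union> J. (if k \<in> I then a k else 0) * tri_mode \<theta> (fst k) (snd k) z)"
      unfolding I(3) using I(1) J(1) by (intro sum.mono_neutral_cong_left) auto
    moreover have "w z = (\<Sum>k\<in>I \<union> J. (if k \<in> J then b k else 0) * tri_mode \<theta> (fst k) (snd k) z)"
      unfolding J(3) using I(1) J(1) by (intro sum.mono_neutral_cong_left) auto
    ultimately show ?thesis by (simp add: c_def distrib_right sum.distrib)
  qed
  then show ?thesis unfolding mode_span_def mem_Collect_eq
    using I(1,2) J(1,2) by (intro exI[of _ "I \<union> J"] exI[of _ c]) auto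
qed

lemma mode_span_cmult:
  assumes "w \<in> mode_span \<theta>" shows "(\<lambda>z. c * w z) \<in> mode_span \<theta>"
proof -
  obtain I a where I: "finite I" "I \<subseteq> mode_index \<theta>" "w = (\<lambda>z. \<Sum>k\<in>I. a k * tri_mode \<theta> (fst k) (snd k) z)"
    using assms by (auto simp: mode_span_def)
  then show ?thesis unfolding mode_span_def mem_Collect_eq
    by (intro exI[of _ I] exI[of _ "\<lambda>k. c * a k"]) (simp add: sum_distrib_left mult.assoc)
qed

lemma mode_span_zero: "(\<lambda>z. 0) \<in> mode_span \<theta>"
  unfolding mode_span_def mem_Collect_eq by (intro exI[of _ "{}"]) auto

lemma mode_span_sum:
  "finite A \<Longrightarrow> (\<And>i. i \<in> A \<Longrightarrow> w i \<in> mode_span \<theta>) \<Longrightarrow> (\<lambda>z. \<Sum>i\<in>A. w i z) \<in> mode_span \<theta>"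
  by (induction A rule: finite_induct) (auto intro: mode_span_zero mode_span_add)

text \<open>Rotation, negation and swap of the index change a mode at most by a sign and move every
  index to the chamber or to a wall where the mode is zero. This makes the span stable under the
  shifts produced by \<open>chi1\<close> and \<open>chi2\<close>.\<close>

lemma tri_mode_in_mode_span:
  assumes th: "\<theta> \<in> {0, pi / 2}"
  shows "tri_mode \<theta> q r \<in> mode_span \<theta>"
proof -
  have idx: "tri_mode \<theta> q r \<in> mode_span \<theta>" if "(q, r) \<in> mode_index \<theta>" for q r
    unfolding mode_span_def mem_Collect_eq using that
    by (intro exI[of _ "{(q, r)}"] exI[of _ "\<lambda>_. 1"]) auto
  have neg: "tri_mode \<theta> q r \<in> mode_span \<theta>" if "tri_mode \<theta> (- r) (- q) \<in> mode_span \<theta>" for q r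
    using mode_span_cmult[OF that, of "-1"] by (simp add: tri_mode_negate)
  have swap: "tri_mode \<theta> q r \<in> mode_span \<theta>" if "tri_mode \<theta> r q \<in> mode_span \<theta>" for q r
    using mode_span_cmult[OF that, of "cos (2 * \<theta>)"] by (simp add: tri_mode_swap[OF th, of q r, symmetric])
  have ord: "tri_mode \<theta> q r \<in> mode_span \<theta>" if "0 \<le> r" "r \<le> q" for q r
  proof -
    have "r = 0 \<or> (\<theta> = pi / 2 \<and> r = q) \<or> (q, r) \<in> mode_index \<theta>"
      by (cases "r = 0"; cases "r = q"; cases "\<theta> = 0") (use that th in \<open>simp_all add: mode_index_def\<close>)
    then consider "r = 0" | "\<theta> = pi / 2" "r = q" | "(q, r) \<in> mode_index \<theta>" by blast
    then show ?thesis
    proof cases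
      case 1 then show ?thesis using mode_span_zero by (simp add: tri_mode_0_right[abs_def] fun_eq_iff)
    next
      case 2
      have "tri_mode (pi / 2) q q = (\<lambda>z. 0)" by (rule ext) (rule tri_mode_swap_diag)
      then show ?thesis unfolding 2 using mode_span_zero by (simp only:)
    qed (rule idx)
  qed
  have pos: "tri_mode \<theta> q r \<in> mode_span \<theta>" if "0 \<le> r" "0 \<le> q" for q r
    using ord[of r q] ord[of q r] swap[of r q] that linear[of r q] by blast
  have same: "tri_mode \<theta> q r \<in> mode_span \<theta>" if "0 \<le> q \<and> 0 \<le> r \<or> q \<le> 0 \<and> r \<le> 0" for q r
    using that pos[of r q] pos[of "- q" "- r"] neg[of r q] by auto
  \<comment> \<open>Of the three numbers q, r and -q-r, which add up to 0, two have the same weak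
    sign; a rotation turns these two into the index.\<close>
  consider "0 \<le> q \<and> 0 \<le> r \<or> q \<le> 0 \<and> r \<le> 0" | "0 \<le> - q - r \<and> 0 \<le> q \<or> - q - r \<le> 0 \<and> q \<le> 0"
    | "0 \<le> r \<and> 0 \<le> - q - r \<or> r \<le> 0 \<and> - q - r \<le> 0" by linarith
  then show ?thesis
  proof cases
    case 1 then show ?thesis by (rule same)
  next
    case 2 then show ?thesis using same[of "- q - r" q] by (simp add: tri_mode_rotate)
  next
    case 3
    have "tri_mode \<theta> r (- q - r) = tri_mode \<theta> q r"
      using tri_mode_rotate[of \<theta> "- q - r" q] tri_mode_rotate[of \<theta> q r] by simp
    then show ?thesis using same[OF 3] by simp
  qed
qed

lemma chi_mult_mode_span:
  assumes th: "\<theta> \<in> {0, pi / 2}" and w: "w \<in> mode_span \<theta>"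
  shows "(\<lambda>z. chi1 z * w z) \<in> mode_span \<theta>" "(\<lambda>z. chi2 z * w z) \<in> mode_span \<theta>"
proof -
  obtain I a where I: "finite I" "I \<subseteq> mode_index \<theta>" "w = (\<lambda>z. \<Sum>k\<in>I. a k * tri_mode \<theta> (fst k) (snd k) z)"
    using w by (auto simp: mode_span_def)
  have "(\<lambda>z. chi1 z * tri_mode \<theta> q r z) \<in> mode_span \<theta>" for q r
  proof -
    have "chi1 z * tri_mode \<theta> q r z = 1/2 * (tri_mode \<theta> (q + 1) (r - 1) z + tri_mode \<theta> (q - 1) (r + 1) z
     + tri_mode \<theta> (q + 1) r z + tri_mode \<theta> (q - 1) r z + tri_mode \<theta> q (r - 1) z + tri_mode \<theta> q (r + 1) z)" for z
      using chi1_mult_tri_mode[of z \<theta> q r] by simp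
    then show ?thesis by (simp only:) (intro mode_span_cmult mode_span_add tri_mode_in_mode_span th)
  qed
  then have "(\<lambda>z. \<Sum>k\<in>I. a k * (chi1 z * tri_mode \<theta> (fst k) (snd k) z)) \<in> mode_span \<theta>"
    by (intro mode_span_sum mode_span_cmult I(1))
  moreover have "chi1 z * w z = (\<Sum>k\<in>I. a k * (chi1 z * tri_mode \<theta> (fst k) (snd k) z))" for z
    by (simp add: I(3) sum_distrib_left mult.left_commute)
  ultimately show "(\<lambda>z. chi1 z * w z) \<in> mode_span \<theta>" by simp
  have "(\<lambda>z. chi2 z * tri_mode \<theta> q r z) \<in> mode_span \<theta>" for q r
  proof -
    have "chi2 z * tri_mode \<theta> q r z = 1/2 * (tri_mode \<theta> (q + 1) (r + 1) z + tri_mode \<theta> (q - 1) (r - 1) z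
     + tri_mode \<theta> (q + 2) (r - 1) z + tri_mode \<theta> (q - 2) (r + 1) z + tri_mode \<theta> (q + 1) (r - 2) z + tri_mode \<theta> (q - 1) (r + 2) z)" for z
      using chi2_mult_tri_mode[of z \<theta> q r] by simp
    then show ?thesis by (simp only:) (intro mode_span_cmult mode_span_add tri_mode_in_mode_span th)
  qed
  then have "(\<lambda>z. \<Sum>k\<in>I. a k * (chi2 z * tri_mode \<theta> (fst k) (snd k) z)) \<in> mode_span \<theta>"
    by (intro mode_span_sum mode_span_cmult I(1))
  moreover have "chi2 z * w z = (\<Sum>k\<in>I. a k * (chi2 z * tri_mode \<theta> (fst k) (snd k) z))" for z
    by (simp add: I(3) sum_distrib_left mult.left_commute)
  ultimately show "(\<lambda>z. chi2 z * w z) \<in> mode_span \<theta>" by simp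
qed

section \<open>Orthogonality and norms of the modes\<close>

lemma has_integral_cos_int:
  "((\<lambda>t. cos (of_int k * t + c)) has_integral (if k = 0 then 2 * pi * cos c else 0)) {0..2*pi}"
proof (cases "k = 0")
  case True
  then show ?thesis using has_integral_const_real[of "cos c" 0 "2 * pi"] by simp
next
  case False
  have "((\<lambda>t. cos (of_int k * t + c)) has_integral (sin (of_int k * (2 * pi) + c) / of_int k - sin (of_int k * 0 + c) / of_int k)) {0..2*pi}"
  proof (rule fundamental_theorem_of_calculus)
    fix t :: real
    have "((\<lambda>t. sin (of_int k * t + c) / of_int k) has_real_derivative cos (of_int k * t + c)) (at t within {0..2*pi})"
      using False by (auto intro!: derivative_eq_intros simp: field_simps)
    then show "((\<lambda>t. sin (of_int k * t + c) / of_int k) has_vector_derivative cos (of_int k * t + c)) (at t within {0..2*pi})"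
      by (simp add: has_real_derivative_iff_has_vector_derivative)
  qed simp
  moreover have "sin (of_int k * (2 * pi) + c) = sin c" using sin_add_2pi_int[of c k] by (simp add: add.commute)
  ultimately show ?thesis using False by simp
qed

text \<open>Frequencies of both signs occur, hence two terms. For n = n' = 0 they cancel, as they
  must for the zero function; in \<open>cos_ip\<close> they add up to 2 pi for the constant.\<close>

definition sin_ip :: "int \<Rightarrow> int \<Rightarrow> real" where
  "sin_ip n n' = (if n = n' then pi else 0) - (if n = - n' then pi else 0)"

definition cos_ip :: "real \<Rightarrow> int \<Rightarrow> int \<Rightarrow> real" where
  "cos_ip \<theta> m m' = (if m = m' then pi else 0) + (if m = - m' then pi * cos (2 * \<theta>) else 0)"

lemma has_integral_sin_sin:
  "((\<lambda>t. sin (of_int n * t) * sin (of_int n' * t)) has_integral sin_ip n n') {0..2*pi}"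
proof -
  have "((\<lambda>t. (cos (of_int (n - n') * t + 0) - cos (of_int (n + n') * t + 0)) / 2) has_integral
     ((if n - n' = 0 then 2 * pi * cos 0 else 0) - (if n + n' = 0 then 2 * pi * cos 0 else 0)) / 2) {0..2*pi}"
    by (intro has_integral_divide has_integral_diff has_integral_cos_int)
  moreover have "(cos (of_int (n - n') * t + 0) - cos (of_int (n + n') * t + 0)) / 2 = sin (of_int n * t) * sin (of_int n' * t)" for t :: real
    by (simp add: distrib_right left_diff_distrib cos_add cos_diff)
  moreover have "((if n - n' = 0 then 2 * pi * cos 0 else 0) - (if n + n' = 0 then 2 * pi * cos 0 else 0)) / 2 = sin_ip n n'"
    by (auto simp: sin_ip_def)
  ultimately show ?thesis by simp
qed

lemma has_integral_cos_cos:
  "((\<lambda>t. cos (of_int m * t - \<theta>) * cos (of_int m' * t - \<theta>)) has_integral cos_ip \<theta> m m') {0..2*pi}"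
proof -
  have "((\<lambda>t. (cos (of_int (m - m') * t + 0) + cos (of_int (m + m') * t + - 2 * \<theta>)) / 2) has_integral
     ((if m - m' = 0 then 2 * pi * cos 0 else 0) + (if m + m' = 0 then 2 * pi * cos (- 2 * \<theta>) else 0)) / 2) {0..2*pi}"
    by (intro has_integral_divide has_integral_add has_integral_cos_int)
  moreover have "(cos (of_int (m - m') * t + 0) + cos (of_int (m + m') * t + - 2 * \<theta>)) / 2 = cos (of_int m * t - \<theta>) * cos (of_int m' * t - \<theta>)" for t :: real
  proof -
    have "cos (of_int (m - m') * t + 0) = cos ((of_int m * t - \<theta>) - (of_int m' * t - \<theta>))"
      "cos (of_int (m + m') * t + - 2 * \<theta>) = cos ((of_int m * t - \<theta>) + (of_int m' * t - \<theta>))"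
      by (simp_all add: algebra_simps)
    then show ?thesis unfolding cos_add[of "of_int m * t - \<theta>"] cos_diff[of "of_int m * t - \<theta>"] by simp
  qed
  moreover have "((if m - m' = 0 then 2 * pi * cos 0 else 0) + (if m + m' = 0 then 2 * pi * cos (- 2 * \<theta>) else 0)) / 2 = cos_ip \<theta> m m'"
    by (auto simp: cos_ip_def)
  ultimately show ?thesis by simp
qed

lemma has_integral_cos_sin_mult:
  "((\<lambda>z. cos_sin \<theta> m n z * cos_sin \<theta> m' n' z) has_integral cos_ip \<theta> m m' * sin_ip n n') (cbox (0,0) (2*pi,2*pi))"
proof -
  let ?f = "\<lambda>z. cos_sin \<theta> m n z * cos_sin \<theta> m' n' z"
  have c: "continuous_on (cbox (0,0) (2*pi,2*pi)) ?f"
    unfolding cos_sin_def case_prod_unfold by (intro continuous_intros)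
  have inner: "integral {0..2*pi} (\<lambda>y. ?f (x, y)) = (cos (of_int m * x - \<theta>) * cos (of_int m' * x - \<theta>)) * sin_ip n n'" for x
  proof (rule integral_unique)
    have "((\<lambda>y. (cos (of_int m * x - \<theta>) * cos (of_int m' * x - \<theta>)) * (sin (of_int n * y) * sin (of_int n' * y))) has_integral
       (cos (of_int m * x - \<theta>) * cos (of_int m' * x - \<theta>)) * sin_ip n n') {0..2*pi}"
      by (intro has_integral_mult_right has_integral_sin_sin)
    then show "((\<lambda>y. ?f (x, y)) has_integral (cos (of_int m * x - \<theta>) * cos (of_int m' * x - \<theta>)) * sin_ip n n') {0..2*pi}"
      by (simp add: cos_sin_def ac_simps)
  qed
  have "integral (cbox (0,0) (2*pi,2*pi)) ?f = integral {0..2*pi} (\<lambda>x. integral {0..2*pi} (\<lambda>y. ?f (x, y)))"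
    using integral_prod_continuous[OF c] by simp
  also have "\<dots> = integral {0..2*pi} (\<lambda>x. (cos (of_int m * x - \<theta>) * cos (of_int m' * x - \<theta>)) * sin_ip n n')"
    by (simp only: inner)
  also have "integral {0..2*pi} (\<lambda>x. (cos (of_int m * x - \<theta>) * cos (of_int m' * x - \<theta>)) * sin_ip n n') = cos_ip \<theta> m m' * sin_ip n n'"
    by (intro integral_unique has_integral_mult_left has_integral_cos_cos)
  finally show ?thesis using integrable_integral[OF integrable_continuous[OF c]] by simp
qed

lemma ip_eq_0:
  assumes "\<bar>m\<bar> \<noteq> \<bar>m'\<bar> \<or> \<bar>n\<bar> \<noteq> \<bar>n'\<bar>"
  shows "cos_ip \<theta> m m' * sin_ip n n' = 0"
proof (cases "\<bar>m\<bar> = \<bar>m'\<bar>")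
  case True
  then have "n \<noteq> n'" "n \<noteq> - n'" using assms by auto
  then show ?thesis by (simp add: sin_ip_def)
next
  case False
  then have "m \<noteq> m'" "m \<noteq> - m'" by auto
  then show ?thesis by (simp add: cos_ip_def)
qed

lemma has_integral_tri_mode_mult:
  "((\<lambda>z. tri_mode \<theta> q r z * tri_mode \<theta> q' r' z) has_integral
     (cos_ip \<theta> (q - r) (q' - r') * sin_ip (q + r) (q' + r')
    + cos_ip \<theta> (q - r) (- 2 * q' - r') * sin_ip (q + r) (- r')
    + cos_ip \<theta> (q - r) (q' + 2 * r') * sin_ip (q + r) (- q')
    + cos_ip \<theta> (- 2 * q - r) (q' - r') * sin_ip (- r) (q' + r')
    + cos_ip \<theta> (- 2 * q - r) (- 2 * q' - r') * sin_ip (- r) (- r')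
    + cos_ip \<theta> (- 2 * q - r) (q' + 2 * r') * sin_ip (- r) (- q')
    + cos_ip \<theta> (q + 2 * r) (q' - r') * sin_ip (- q) (q' + r')
    + cos_ip \<theta> (q + 2 * r) (- 2 * q' - r') * sin_ip (- q) (- r')
    + cos_ip \<theta> (q + 2 * r) (q' + 2 * r') * sin_ip (- q) (- q'))) (cbox (0,0) (2*pi,2*pi))"
proof -
  have *: "(a1 + a2 + a3) * (b1 + b2 + b3) = a1 * b1 + a1 * b2 + a1 * b3 + a2 * b1 + a2 * b2 + a2 * b3 + a3 * b1 + a3 * b2 + a3 * b3"
    for a1 a2 a3 b1 b2 b3 :: real by (simp add: algebra_simps)
  show ?thesis unfolding tri_mode_def * by (intro has_integral_add has_integral_cos_sin_mult)
qed

text \<open>Within the chamber two different modes share no frequency, even up to the signs of its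
  components, so all nine products integrate to 0.\<close>

lemma tri_mode_orthogonal:
  assumes "(q, r) \<in> mode_index \<theta>" "(q', r') \<in> mode_index \<theta>" "(q, r) \<noteq> (q', r')"
  shows "((\<lambda>z. tri_mode \<theta> q r z * tri_mode \<theta> q' r' z) has_integral 0) (cbox (0,0) (2*pi,2*pi))"
proof -
  have a: "1 \<le> r" "r \<le> q" "1 \<le> r'" "r' \<le> q'" "q \<noteq> q' \<or> r \<noteq> r'" using assms by (auto simp: mode_index_def)
  have z: "cos_ip \<theta> (q - r) (q' - r') * sin_ip (q + r) (q' + r') = 0"
    "cos_ip \<theta> (q - r) (- 2 * q' - r') * sin_ip (q + r) (- r') = 0"
    "cos_ip \<theta> (q - r) (q' + 2 * r') * sin_ip (q + r) (- q') = 0"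
    "cos_ip \<theta> (- 2 * q - r) (q' - r') * sin_ip (- r) (q' + r') = 0"
    "cos_ip \<theta> (- 2 * q - r) (- 2 * q' - r') * sin_ip (- r) (- r') = 0"
    "cos_ip \<theta> (q + 2 * r) (q' - r') * sin_ip (- q) (q' + r') = 0"
    "cos_ip \<theta> (q + 2 * r) (q' + 2 * r') * sin_ip (- q) (- q') = 0"
    using a by (intro ip_eq_0; arith)+
  \<comment> \<open>These two products vanish only because the indices differ: for q = r = q' = r'
    the frequencies would agree up to sign.\<close>
  have z': "cos_ip \<theta> (- 2 * q - r) (q' + 2 * r') * sin_ip (- r) (- q') = 0"
    "cos_ip \<theta> (q + 2 * r) (- 2 * q' - r') * sin_ip (- q) (- r') = 0"
    using a by (intro ip_eq_0; arith)+
  show ?thesis using has_integral_tri_mode_mult[of \<theta> q r q' r'] unfolding z z' by simp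
qed

text \<open>Generically only the three squares contribute, each pi^2. For q = r the first term is
  constant in x and counts twice, and the other two terms have frequencies equal up to sign and give
  two cross terms: 2 + 1 + 1 + 1 + 1 = 6.\<close>

lemma tri_mode_norm:
  assumes "(q, r) \<in> mode_index \<theta>" "\<theta> \<in> {0, pi / 2}"
  shows "((\<lambda>z. tri_mode \<theta> q r z * tri_mode \<theta> q r z) has_integral (if q = r then 6 else 3) * pi\<^sup>2) (cbox (0,0) (2*pi,2*pi))"
proof -
  have a: "1 \<le> r" "r \<le> q" using assms by (auto simp: mode_index_def)
  have th: "cos (2 * \<theta>) = 1" if "q = r" using assms that by (auto simp: mode_index_def)
  have z: "cos_ip \<theta> (q - r) (- 2 * q - r) * sin_ip (q + r) (- r) = 0"
    "cos_ip \<theta> (q - r) (q + 2 * r) * sin_ip (q + r) (- q) = 0"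
    "cos_ip \<theta> (- 2 * q - r) (q - r) * sin_ip (- r) (q + r) = 0"
    "cos_ip \<theta> (q + 2 * r) (q - r) * sin_ip (- q) (q + r) = 0"
    using a by (intro ip_eq_0; arith)+
  have d: "cos_ip \<theta> (- 2 * q - r) (- 2 * q - r) * sin_ip (- r) (- r) = pi\<^sup>2"
    "cos_ip \<theta> (q + 2 * r) (q + 2 * r) * sin_ip (- q) (- q) = pi\<^sup>2"
    "cos_ip \<theta> (q - r) (q - r) * sin_ip (q + r) (q + r) = (if q = r then 2 else 1) * pi\<^sup>2"
    using a th by (auto simp: cos_ip_def sin_ip_def power2_eq_square)
  have c: "cos_ip \<theta> (- 2 * q - r) (q + 2 * r) * sin_ip (- r) (- q) = (if q = r then 1 else 0) * pi\<^sup>2"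
    "cos_ip \<theta> (q + 2 * r) (- 2 * q - r) * sin_ip (- q) (- r) = (if q = r then 1 else 0) * pi\<^sup>2"
    using a th by (auto simp: cos_ip_def sin_ip_def power2_eq_square)
  show ?thesis using has_integral_tri_mode_mult[of \<theta> q r q r] unfolding z d c by (cases "q = r") simp_all
qed

text \<open>
  Here \<open>a\<^sub>i = cos x\<^sub>i\<close>, \<open>b\<^sub>i = cos y\<^sub>i\<close>, and the upper bound on \<open>b\<^sub>1\<close> says \<open>3 x\<^sub>1 \<le> y\<^sub>1\<close>. Along a level set of the
  first invariant the second one is strictly decreasing in \<open>a\<^sup>2\<close>.
\<close>

lemma alcove_separation_aux:
  fixes a1 a2 b1 b2 :: real
  assumes a: "1 / 2 \<le> a1" "a1 < a2" "a2 \<le> 1" and b1: "b1 \<le> 4 * a1 ^ 3 - 3 * a1"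
    and 1: "a1\<^sup>2 + a1 * b1 = a2\<^sup>2 + a2 * b2"
    and 2: "b1\<^sup>2 + b1 * (4 * a1 ^ 3 - 3 * a1) = b2\<^sup>2 + b2 * (4 * a2 ^ 3 - 3 * a2)"
  shows False
proof -
  define s1 where "s1 = a1\<^sup>2"
  define s2 where "s2 = a2\<^sup>2"
  define q where "q = s1 + a1 * b1"
  have s: "1 / 4 \<le> s1" "s1 < s2" "s2 \<le> 1"
  proof -
    show "1 / 4 \<le> s1" using power_mono[of "1/2" a1 2] a by (simp add: s1_def power2_eq_square)
    show "s1 < s2" using a by (simp add: s1_def s2_def power_strict_mono)
    show "s2 \<le> 1" using power_mono[of a2 1 2] a by (simp add: s2_def)
  qed
  have ab: "a1 * b1 = q - s1" "a2 * b2 = q - s2" using 1 by (simp_all add: q_def s1_def s2_def)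
  \<comment> \<open>With b = (q - s) / a on the level set, multiplying the second invariant by s1 s2
    clears the denominators. The difference of both sides then has the factor s2 - s1, and the
    remaining factor is shown to be positive.\<close>
  have "s2 * (q - s1)\<^sup>2 + s1 * s2 * ((q - s1) * (4 * s1 - 3)) = s2 * (a1 * b1)\<^sup>2 + s1 * s2 * ((a1 * b1) * (4 * s1 - 3))"
    by (simp only: ab)
  also have "\<dots> = s1 * s2 * (b1\<^sup>2 + b1 * (4 * a1 ^ 3 - 3 * a1))"
    unfolding s1_def s2_def by (simp add: power2_eq_square power3_eq_cube algebra_simps)
  also have "\<dots> = s1 * (a2 * b2)\<^sup>2 + s1 * s2 * ((a2 * b2) * (4 * s2 - 3))"
    unfolding 2 s1_def s2_def by (simp add: power2_eq_square power3_eq_cube algebra_simps)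
  also have "\<dots> = s1 * (q - s2)\<^sup>2 + s1 * s2 * ((q - s2) * (4 * s2 - 3))"
    by (simp only: ab)
  finally have eq: "(s2 - s1) * (q\<^sup>2 - 4 * q * (s1 * s2) + 4 * (s1 * s2) * (s1 + s2 - 1)) = 0"
    by (simp add: power2_eq_square algebra_simps)
  have "a1 * b1 \<le> a1 * (4 * a1 ^ 3 - 3 * a1)" using a b1 by (intro mult_left_mono) auto
  then have "q \<le> 4 * s1\<^sup>2 - 2 * s1"
    unfolding ab s1_def by (simp add: power2_eq_square power3_eq_cube algebra_simps)
  \<comment> \<open>As a quadratic in q the remaining factor is (2 s1 s2 - q)^2 - 4 s1 s2 (1 - s1)
    (1 - s2). The bound on \<open>b1\<close> keeps the base of the square away from 0.\<close>
  then have w: "2 * s1 * (1 + s2 - 2 * s1) \<le> 2 * s1 * s2 - q" by (simp add: power2_eq_square algebra_simps)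
  have "0 \<le> 2 * s1 * (1 + s2 - 2 * s1)" using s by (intro mult_nonneg_nonneg) auto
  then have w2: "(2 * s1 * (1 + s2 - 2 * s1))\<^sup>2 \<le> (2 * s1 * s2 - q)\<^sup>2" using w by (intro power_mono) auto
  define d where "d = s2 - s1"
  define e where "e = 1 - s1"
  have "s1 * (1 + s2 - 2 * s1)\<^sup>2 - s2 * ((1 - s1) * (1 - s2)) = d * (e * (3 * s1 - e) + s1 * d + e * d)"
    by (simp add: d_def e_def power2_eq_square algebra_simps)
  moreover have "0 < d * (e * (3 * s1 - e) + s1 * d + e * d)"
    using s by (intro mult_pos_pos add_nonneg_pos add_pos_nonneg mult_nonneg_nonneg) (auto simp: d_def e_def)
  ultimately have "0 < 4 * s1 * (s1 * (1 + s2 - 2 * s1)\<^sup>2 - s2 * ((1 - s1) * (1 - s2)))" using s by simp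
  also have "\<dots> = (2 * s1 * (1 + s2 - 2 * s1))\<^sup>2 - 4 * s1 * s2 * ((1 - s1) * (1 - s2))"
    by (simp add: power2_eq_square algebra_simps)
  also have "\<dots> \<le> (2 * s1 * s2 - q)\<^sup>2 - 4 * s1 * s2 * ((1 - s1) * (1 - s2))" using w2 by simp
  also have "\<dots> = q\<^sup>2 - 4 * q * (s1 * s2) + 4 * (s1 * s2) * (s1 + s2 - 1)"
    by (simp add: power2_eq_square algebra_simps)
  finally show False using eq s by simp
qed

lemma alcove_cos:
  assumes "(x, y) \<in> alcove"
  shows "0 \<le> x" "x \<le> pi" "0 \<le> y" "y \<le> pi" "1 / 2 \<le> cos x" "cos x \<le> 1" "cos y \<le> 4 * cos x ^ 3 - 3 * cos x"
proof -
  have xy: "0 \<le> x" "3 * x \<le> y" "y \<le> pi" using assms by (auto simp: alcove_def)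
  then show "0 \<le> x" "x \<le> pi" "0 \<le> y" "y \<le> pi" by auto
  have "cos (pi / 3) \<le> cos x" using xy by (intro cos_monotone_0_pi_le) auto
  then show "1 / 2 \<le> cos x" by (simp add: cos_60)
  have "cos y \<le> cos (3 * x)" using xy by (intro cos_monotone_0_pi_le) auto
  then show "cos y \<le> 4 * cos x ^ 3 - 3 * cos x" by (simp add: cos_treble_cos)
qed simp

lemma chi_separate:
  assumes z: "z1 \<in> alcove" "z2 \<in> alcove" and 1: "chi1 z1 = chi1 z2" and 2: "chi2 z1 = chi2 z2"
  shows "z1 = z2"
proof -
  obtain x1 y1 where z1: "z1 = (x1, y1)" by (cases z1)
  obtain x2 y2 where z2: "z2 = (x2, y2)" by (cases z2)
  note c1 = alcove_cos[OF z(1)[unfolded z1]] and c2 = alcove_cos[OF z(2)[unfolded z2]]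
  have e1: "(cos x1)\<^sup>2 + cos x1 * cos y1 = (cos x2)\<^sup>2 + cos x2 * cos y2"
    using 1 unfolding chi1_def z1 z2 split cos_double_cos by (simp add: algebra_simps)
  have e2: "(cos y1)\<^sup>2 + cos y1 * (4 * cos x1 ^ 3 - 3 * cos x1) = (cos y2)\<^sup>2 + cos y2 * (4 * cos x2 ^ 3 - 3 * cos x2)"
    using 2 unfolding chi2_def z1 z2 split cos_double_cos cos_treble_cos by (simp add: algebra_simps)
  have "\<not> cos x1 < cos x2" using alcove_separation_aux[OF c1(5) _ c2(6) c1(7) e1 e2] by blast
  moreover have "\<not> cos x2 < cos x1" using alcove_separation_aux[OF c2(5) _ c1(6) c2(7) e1[symmetric] e2[symmetric]] by blast
  ultimately have cx: "cos x1 = cos x2" by simp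
  then have "cos y1 = cos y2" using e1 c1(5) by auto
  then show ?thesis using cx c1 c2 by (simp add: z1 z2 cos_inj_pi)
qed

text \<open>The functions that multiply the span into itself form an algebra.\<close>

lemma mode_span_dense:
  assumes th: "\<theta> \<in> {0, pi / 2}" and \<rho>: "\<rho> \<in> mode_span \<theta>" and f: "continuous_on alcove f" and e: "0 < e"
  shows "\<exists>w\<in>mode_span \<theta>. \<forall>z\<in>alcove. \<bar>\<rho> z * f z - w z\<bar> < e"
proof -
  define R where "R = {h. continuous_on alcove h \<and> (\<forall>w\<in>mode_span \<theta>. (\<lambda>z. h z * w z) \<in> mode_span \<theta>)}"
  have i: "chi1 \<in> R" "chi2 \<in> R"
    unfolding R_def mem_Collect_eq using chi_mult_mode_span[OF th]
    by (auto simp: chi1_def chi2_def case_prod_unfold intro!: continuous_intros)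
  interpret function_ring_on R alcove
  proof
    show "compact alcove" by (rule compact_alcove)
    show "continuous_on alcove f" if "f \<in> R" for f using that by (simp add: R_def)
    show "(\<lambda>x. f x + g x) \<in> R" if "f \<in> R" "g \<in> R" for f g
      using that by (auto simp: R_def distrib_right intro!: continuous_intros mode_span_add)
    show "(\<lambda>x. f x * g x) \<in> R" if "f \<in> R" "g \<in> R" for f g
      using that by (auto simp: R_def mult.assoc intro!: continuous_intros)
    show "(\<lambda>_. c) \<in> R" for c by (auto simp: R_def intro: mode_span_cmult)
    show "\<exists>f\<in>R. f x \<noteq> f y" if "x \<in> alcove" "y \<in> alcove" "x \<noteq> y" for x y
      using chi_separate[OF that(1,2)] that(3) i by blast
  qed
  have "compact (\<rho> ` alcove)"
  proof (rule compact_continuous_image[OF _ compact_alcove])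
    obtain I a where "\<rho> = (\<lambda>z. \<Sum>k\<in>I. a k * tri_mode \<theta> (fst k) (snd k) z)" using \<rho> by (auto simp: mode_span_def)
    then show "continuous_on alcove \<rho>" by (auto intro!: continuous_intros continuous_tri_mode)
  qed
  then obtain B where B: "0 < B" "\<And>z. z \<in> alcove \<Longrightarrow> \<bar>\<rho> z\<bar> \<le> B"
    using compact_imp_bounded[of "\<rho> ` alcove"] by (auto simp: bounded_pos)
  obtain h where h: "h \<in> R" "\<forall>z\<in>alcove. \<bar>f z - h z\<bar> < e / B"
    using Stone_Weierstrass_basic[OF f, of "e / B"] e B by auto
  have "\<bar>\<rho> z * f z - h z * \<rho> z\<bar> < e" if "z \<in> alcove" for z
  proof -
    have "\<bar>\<rho> z * f z - h z * \<rho> z\<bar> = \<bar>\<rho> z\<bar> * \<bar>f z - h z\<bar>" by (simp add: abs_mult[symmetric] algebra_simps)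
    also have "\<dots> \<le> B * \<bar>f z - h z\<bar>" using B(2)[OF that] by (intro mult_right_mono) auto
    also have "\<dots> < B * (e / B)" using h(2) that B(1) by (intro mult_strict_left_mono) auto
    finally show ?thesis using B(1) by simp
  qed
  then show ?thesis using h(1) \<rho> by (intro bexI[of _ "\<lambda>z. h z * \<rho> z"]) (auto simp: R_def)
qed

text \<open>The lowest mode is a Weyl denominator, hence a product of sines.\<close>

lemma tri_mode_nonvanishing:
  assumes th: "\<theta> \<in> {0, pi / 2}"
  shows "\<exists>\<rho>\<in>mode_span \<theta>. \<forall>x y. 0 < x \<longrightarrow> 3 * x < y \<longrightarrow> y < pi \<longrightarrow> \<rho> (x, y) \<noteq> 0"
proof -
  have ne: "sin y \<noteq> 0 \<and> sin x \<noteq> 0 \<and> cos y \<noteq> cos x \<and> cos y \<noteq> cos (3 * x)"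
    if "0 < x" "3 * x < y" "y < pi" for x y :: real
  proof -
    have "0 < sin y" "0 < sin x" using that by (auto intro!: sin_gt_zero)
    moreover have "cos y < cos x" "cos y < cos (3 * x)" using that by (auto intro!: cos_monotone_0_pi)
    ultimately show ?thesis by auto
  qed
  show ?thesis
  proof (cases "\<theta> = 0")
    case True
    have "tri_mode \<theta> 1 1 (x, y) = 2 * sin y * (cos y - cos (3 * x))" for x y
    proof -
      have "tri_mode \<theta> 1 1 (x, y) = sin (2 * y) - 2 * cos (3 * x) * sin y"
        by (simp add: tri_mode_def cos_sin_def True)
      then show ?thesis unfolding sin_double by (simp add: algebra_simps)
    qed
    then show ?thesis using ne tri_mode_in_mode_span[OF th, of 1 1]
      by (intro bexI[of _ "tri_mode \<theta> 1 1"]) auto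
  next
    case False
    then have th': "\<theta> = pi / 2" using th by simp
    \<comment> \<open>In the odd family the index (1, 1) lies on a wall, so (2, 1) is the lowest
      one. Expanding everything in sin x, sin y and the two cosines turns the factorisation into a
      polynomial identity.\<close>
    have "tri_mode \<theta> 2 1 (x, y) = 4 * sin x * sin y * (cos y - cos x) * (cos y - cos (3 * x))" for x y
    proof -
      have c2: "cos (2 * t) = 2 * cos t * cos t - 1" for t :: real by (simp add: cos_double_cos power2_eq_square)
      have "sin (3 * y) = sin (2 * y + y)" by simp
      then have s3: "sin (3 * y) = sin y * (4 * cos y * cos y - 1)"
        unfolding sin_add sin_double c2 by (simp add: algebra_simps)
      have "sin (4 * x) = sin (2 * (2 * x))" "cos (4 * x) = cos (2 * (2 * x))" by simp_all
      then have s4: "sin (4 * x) = 4 * sin x * cos x * (2 * cos x * cos x - 1)" 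
        and c4: "cos (4 * x) = 2 * (2 * cos x * cos x - 1) * (2 * cos x * cos x - 1) - 1"
        unfolding sin_double c2 by (simp_all add: algebra_simps)
      have "sin (5 * x) = sin (4 * x + x)" by simp
      then have s5: "sin (5 * x) = 4 * sin x * cos x * (2 * cos x * cos x - 1) * cos x + (2 * (2 * cos x * cos x - 1) * (2 * cos x * cos x - 1) - 1) * sin x"
        unfolding sin_add s4 c4 by simp
      have "tri_mode \<theta> 2 1 (x, y) = sin x * sin (3 * y) + sin (5 * x) * sin y - sin (4 * x) * sin (2 * y)"
        by (simp add: tri_mode_def cos_sin_def th' cos_diff)
      also have "\<dots> = 4 * sin x * sin y * (cos y - cos x) * (cos y - cos (3 * x))"
        unfolding s3 s4 s5 cos_treble_cos sin_double by (simp add: algebra_simps power3_eq_cube)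
      finally show ?thesis .
    qed
    then show ?thesis using ne tri_mode_in_mode_span[OF th, of 2 1]
      by (intro bexI[of _ "tri_mode \<theta> 2 1"]) auto
  qed
qed

section \<open>The hemiequilateral triangle\<close>

lemma hemi_triangle_eq: "hemi_triangle = {(x, y). 0 \<le> x \<and> 0 \<le> y \<and> sqrt 3 * x + y \<le> 1}"
proof -
  have "(x, y) \<in> hemi_triangle \<longleftrightarrow> 0 \<le> x \<and> 0 \<le> y \<and> sqrt 3 * x + y \<le> 1" for x y
  proof
    assume "(x, y) \<in> hemi_triangle"
    then obtain u v w where uvw: "0 \<le> u" "0 \<le> v" "0 \<le> w" "u + v + w = 1" and x: "x = v / sqrt 3" and y: "y = w"
      by (auto simp: hemi_triangle_def convex_hull_3)
    then show "0 \<le> x \<and> 0 \<le> y \<and> sqrt 3 * x + y \<le> 1" by simp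
  next
    assume *: "0 \<le> x \<and> 0 \<le> y \<and> sqrt 3 * x + y \<le> 1"
    have "(x, y) = (1 - sqrt 3 * x - y) *\<^sub>R (0, 0) + (sqrt 3 * x) *\<^sub>R (1 / sqrt 3, 0) + y *\<^sub>R (0, 1)" by simp
    then show "(x, y) \<in> hemi_triangle"
      unfolding hemi_triangle_def convex_hull_3 mem_Collect_eq using *
      by (intro exI[of _ "1 - sqrt 3 * x - y"] exI[of _ "sqrt 3 * x"] exI[of _ y]) auto
  qed
  then show ?thesis by auto
qed

lemma equi_triangle_eq: "equi_triangle = {(x, y). 0 \<le> y \<and> sqrt 3 * \<bar>x\<bar> + y \<le> 1}"
proof -
  have "(x, y) \<in> equi_triangle \<longleftrightarrow> 0 \<le> y \<and> sqrt 3 * \<bar>x\<bar> + y \<le> 1" for x y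
  proof
    assume "(x, y) \<in> equi_triangle"
    then obtain u v w where uvw: "0 \<le> u" "0 \<le> v" "0 \<le> w" "u + v + w = 1" and x: "x = v / sqrt 3 - u / sqrt 3" and y: "y = w"
      by (auto simp: equi_triangle_def convex_hull_3)
    have "sqrt 3 * \<bar>x\<bar> = \<bar>sqrt 3 * x\<bar>" by (simp add: abs_mult)
    also have "sqrt 3 * x = v - u" by (simp add: x field_simps)
    finally show "0 \<le> y \<and> sqrt 3 * \<bar>x\<bar> + y \<le> 1" using uvw y by auto
  next
    assume *: "0 \<le> y \<and> sqrt 3 * \<bar>x\<bar> + y \<le> 1"
    have "sqrt 3 * \<bar>x\<bar> = \<bar>sqrt 3 * x\<bar>" by (simp add: abs_mult)
    with * have **: "0 \<le> y" "\<bar>sqrt 3 * x\<bar> + y \<le> 1" by auto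
    have "(x, y) = ((1 - y - sqrt 3 * x) / 2) *\<^sub>R (- 1 / sqrt 3, 0) + ((1 - y + sqrt 3 * x) / 2) *\<^sub>R (1 / sqrt 3, 0) + y *\<^sub>R (0, 1)"
      by (simp add: field_simps)
    then show "(x, y) \<in> equi_triangle"
      unfolding equi_triangle_def convex_hull_3 mem_Collect_eq using **
      by (intro exI[of _ "(1 - y - sqrt 3 * x) / 2"] exI[of _ "(1 - y + sqrt 3 * x) / 2"] exI[of _ y]) (auto simp: field_simps)
  qed
  then show ?thesis by auto
qed

lemma compact_hemi: "compact hemi_triangle" and compact_equi: "compact equi_triangle"
  unfolding hemi_triangle_def equi_triangle_def by (rule compact_convex_hull[OF finite_imp_compact]; simp)+

lemma sets_hemi [measurable, simp]: "hemi_triangle \<in> sets borel" and sets_equi [measurable, simp]: "equi_triangle \<in> sets borel"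
  using compact_hemi compact_equi by (auto intro: borel_compact)

abbreviation "hemi_leb \<equiv> lebesgue_on hemi_triangle"

definition to_alcove :: "real \<times> real \<Rightarrow> real \<times> real" where
  "to_alcove = (\<lambda>(x, y). (pi * x / sqrt 3, pi * (1 - y)))"

definition of_alcove :: "real \<times> real \<Rightarrow> real \<times> real" where
  "of_alcove = (\<lambda>(x, y). (sqrt 3 * x / pi, 1 - y / pi))"

lemma of_to_alcove [simp]: "of_alcove (to_alcove z) = z"
  by (cases z) (simp add: of_alcove_def to_alcove_def)

lemma to_alcove_mem_iff: "to_alcove z \<in> alcove \<longleftrightarrow> z \<in> hemi_triangle"
proof -
  obtain x y where z: "z = (x, y)" by (cases z)
  have "0 \<le> pi * x / sqrt 3 \<longleftrightarrow> 0 \<le> x" by (simp add: zero_le_divide_iff zero_le_mult_iff not_le[THEN iffD2, OF pi_gt_zero])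
  moreover have "3 * (pi * x / sqrt 3) \<le> pi * (1 - y) \<longleftrightarrow> sqrt 3 * x + y \<le> 1"
  proof -
    have "3 * (pi * x / sqrt 3) = pi * (sqrt 3 * x)" by (simp add: field_simps)
    then show ?thesis unfolding mult_le_cancel_left_pos[OF pi_gt_zero] by (auto simp: mult_le_cancel_left_pos[OF pi_gt_zero])
  qed
  moreover have "pi * (1 - y) \<le> pi \<longleftrightarrow> 0 \<le> y"
    by (simp add: algebra_simps zero_le_mult_iff not_le[THEN iffD2, OF pi_gt_zero])
  ultimately show ?thesis by (auto simp: z to_alcove_def alcove_def hemi_triangle_eq)
qed

lemma continuous_to_alcove [continuous_intros]: "continuous_on S to_alcove"
  unfolding to_alcove_def case_prod_unfold by (intro continuous_intros) auto

lemma continuous_of_alcove [continuous_intros]: "continuous_on S of_alcove"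
  unfolding of_alcove_def case_prod_unfold by (intro continuous_intros) auto

lemma borel_imp_lebesgue_on:
  fixes f :: "real \<times> real \<Rightarrow> real"
  shows "f \<in> borel_measurable borel \<Longrightarrow> f \<in> borel_measurable (lebesgue_on S)"
  by (intro measurable_restrict_space1 measurable_completion) simp

lemma continuous_imp_lebesgue_on:
  fixes f :: "real \<times> real \<Rightarrow> real"
  shows "continuous_on UNIV f \<Longrightarrow> f \<in> borel_measurable (lebesgue_on S)"
  by (intro borel_imp_lebesgue_on borel_measurable_continuous_onI)

lemma integral_hemi_eq_alcove:
  fixes \<phi> :: "real \<times> real \<Rightarrow> real"
  assumes cont: "continuous_on UNIV \<phi>"
  shows "(LINT z|hemi_leb. \<phi> (to_alcove z)) = sqrt 3 / pi\<^sup>2 * (LINT z:alcove|lborel. \<phi> z)"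
proof -
  have [measurable]: "\<phi> \<in> borel_measurable borel" "to_alcove \<in> borel_measurable borel"
    using cont by (auto intro!: borel_measurable_continuous_onI continuous_to_alcove)
  have [measurable]: "alcove \<in> sets borel" using compact_alcove by (rule borel_compact)
  have "(LINT z|hemi_leb. \<phi> (to_alcove z)) = (LINT z|lebesgue. indicator hemi_triangle z *\<^sub>R \<phi> (to_alcove z))"
    by (rule integral_restrict_space) auto
  also have "\<dots> = (LINT z|lborel. indicator hemi_triangle z *\<^sub>R \<phi> (to_alcove z))"
    by (rule integral_completion) measurable
  also have "\<dots> = (LINT z|lborel. indicator alcove (to_alcove z) * \<phi> (to_alcove z))"
    by (intro Bochner_Integration.integral_cong) (auto simp: indicator_def to_alcove_mem_iff)
  finally have 1: "(LINT z|hemi_leb. \<phi> (to_alcove z)) = (LINT z|lborel. indicator alcove (to_alcove z) * \<phi> (to_alcove z))" .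
  have "(LINT z:alcove|lborel. \<phi> z) = (LINT z|lborel. indicator alcove z * \<phi> z)"
    by (simp add: set_lebesgue_integral_def)
  also have "\<dots> = \<bar>(pi / sqrt 3) * (- pi) - 0 * 0\<bar> * (LINT z|lborel. indicator alcove ((pi / sqrt 3) * fst z + 0 * snd z + 0, 0 * fst z + (- pi) * snd z + pi)
       * \<phi> ((pi / sqrt 3) * fst z + 0 * snd z + 0, 0 * fst z + (- pi) * snd z + pi))"
    by (rule lborel_integral_plane_affine) auto
  also have "(\<lambda>z. ((pi / sqrt 3) * fst z + 0 * snd z + 0, 0 * fst z + (- pi) * snd z + pi)) = to_alcove"
    by (auto simp: to_alcove_def fun_eq_iff algebra_simps)
  then have "((pi / sqrt 3) * fst z + 0 * snd z + 0, 0 * fst z + (- pi) * snd z + pi) = to_alcove z" for z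
    by (simp only: fun_eq_iff)
  then have "(LINT z|lborel. indicator alcove ((pi / sqrt 3) * fst z + 0 * snd z + 0, 0 * fst z + (- pi) * snd z + pi)
       * \<phi> ((pi / sqrt 3) * fst z + 0 * snd z + 0, 0 * fst z + (- pi) * snd z + pi)) = (LINT z|lborel. indicator alcove (to_alcove z) * \<phi> (to_alcove z))"
    by (simp only:)
  also have "\<bar>(pi / sqrt 3) * (- pi) - 0 * 0\<bar> = pi\<^sup>2 / sqrt 3" by (simp add: power2_eq_square abs_mult)
  finally show ?thesis unfolding 1 by (simp add: field_simps)
qed

lemma mode_span_symmetries:
  assumes th: "\<theta> \<in> {0, pi / 2}" and w: "w \<in> mode_span \<theta>"
  shows "w ((y - x) / 2, (3 * x + y) / 2) = - w (x, y)"
    "w ((2 * pi - x - y) / 2, (y - 3 * x + 2 * pi) / 2) = - w (x, y)"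
    "w (pi - x, pi - y) = - cos (2 * \<theta>) * w (x, y)"
    "w (2 * pi - x, y) = cos (2 * \<theta>) * w (x, y)"
    "w (x, 2 * pi - y) = - w (x, y)"
proof -
  obtain I a where "w = (\<lambda>z. \<Sum>k\<in>I. a k * tri_mode \<theta> (fst k) (snd k) z)" using w by (auto simp: mode_span_def)
  then show "w ((y - x) / 2, (3 * x + y) / 2) = - w (x, y)"
    "w ((2 * pi - x - y) / 2, (y - 3 * x + 2 * pi) / 2) = - w (x, y)"
    "w (pi - x, pi - y) = - cos (2 * \<theta>) * w (x, y)"
    "w (2 * pi - x, y) = cos (2 * \<theta>) * w (x, y)"
    "w (x, 2 * pi - y) = - w (x, y)"
    by (simp_all only: tri_mode_reflect1 tri_mode_reflect2 tri_mode_point_reflect[OF th] tri_mode_2pi_minus_x[OF th] tri_mode_2pi_minus_y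
        sum_distrib_left sum_negf[symmetric] mult_minus_right mult.left_commute[of "cos (2 * \<theta>)"] mult.left_commute[of "- cos (2 * \<theta>)"])
qed

lemma continuous_mode_span: "w \<in> mode_span \<theta> \<Longrightarrow> continuous_on S w"
  by (auto simp: mode_span_def intro!: continuous_intros continuous_tri_mode)

text \<open>Each symmetry multiplies \<open>v\<close> and \<open>w\<close> by the same sign, so an
  even \<open>G\<close> makes \<open>G (v z) (w z)\<close> invariant. The instances are the product,
  for orthogonality, and |s|^p, for the truncation bound.\<close>

lemma integral_hemi_eq_square:
  fixes G :: "real \<Rightarrow> real \<Rightarrow> real"
  assumes th: "\<theta> \<in> {0, pi / 2}" and v: "v \<in> mode_span \<theta>" and w: "w \<in> mode_span \<theta>"
    and G: "continuous_on UNIV (\<lambda>z. G (v z) (w z))" and sym: "\<And>s t. G (- s) (- t) = G s t"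
  shows "(LINT z|hemi_leb. G (v (to_alcove z)) (w (to_alcove z)))
    = sqrt 3 / (24 * pi\<^sup>2) * (LINT z:cbox (0,0) (2*pi,2*pi)|lborel. G (v z) (w z))"
proof -
  have "cos (2 * (pi / 2)) = - 1" by simp
  then have c: "cos (2 * \<theta>) = 1 \<or> cos (2 * \<theta>) = - 1" using th by (elim insertE emptyE) (simp_all only:, auto)
  have "(LINT z:cbox (0,0) (2*pi,2*pi)|lborel. G (v z) (w z)) = 24 * (LINT z:alcove|lborel. G (v z) (w z))"
    by (rule integral_square_eq_alcove[OF G])
      (use c in \<open>auto simp: mode_span_symmetries[OF th v] mode_span_symmetries[OF th w] sym\<close>)
  then show ?thesis using integral_hemi_eq_alcove[OF G] by simp
qed

lemma LINT_square_eq_integral: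
  fixes \<phi> :: "real \<times> real \<Rightarrow> real"
  assumes "continuous_on UNIV \<phi>"
  shows "(LINT z:cbox a b|lborel. \<phi> z) = integral (cbox a b) \<phi>"
proof (rule set_borel_integral_eq_integral)
  show "set_integrable lborel (cbox a b) \<phi>"
    unfolding set_integrable_def by (intro borel_integrable_compact continuous_on_subset[OF assms]) auto
qed

section \<open>The modes on the half triangle as an orthogonal system\<close>

definition tri_lev :: "int \<times> int \<Rightarrow> nat" where
  "tri_lev k = nat (fst k + snd k)"

definition tri_fun :: "real \<Rightarrow> int \<times> int \<Rightarrow> real \<times> real \<Rightarrow> real" where
  "tri_fun \<theta> k z = tri_mode \<theta> (fst k) (snd k) (to_alcove z)"

lemma continuous_tri_fun: "continuous_on S (tri_fun \<theta> k)"
proof -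
  have "continuous_on S (tri_mode \<theta> (fst k) (snd k) \<circ> to_alcove)"
    by (intro continuous_on_compose continuous_to_alcove continuous_tri_mode)
  then show ?thesis by (simp add: tri_fun_def[abs_def] o_def)
qed

lemma abs_tri_fun_le: "\<bar>tri_fun \<theta> k z\<bar> \<le> 3"
proof -
  have *: "\<bar>cos_sin \<theta> m n z\<bar> \<le> 1" for m n z
    unfolding cos_sin_def case_prod_unfold abs_mult by (intro mult_le_one) auto
  show ?thesis unfolding tri_fun_def tri_mode_def
    using *[of "fst k - snd k" "fst k + snd k" "to_alcove z"] *[of "- 2 * fst k - snd k" "- snd k" "to_alcove z"]
      *[of "fst k + 2 * snd k" "- fst k" "to_alcove z"] by linarith
qed

text \<open>The torus norms 3 pi^2 and 6 pi^2 times the factor sqrt 3 / (24 pi^2) from the tiling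
  and the change of variables.\<close>

lemma tri_fun_inner:
  assumes th: "\<theta> \<in> {0, pi / 2}"
  shows "k \<in> mode_index \<theta> \<Longrightarrow> l \<in> mode_index \<theta> \<Longrightarrow> k \<noteq> l \<Longrightarrow> (LINT z|hemi_leb. tri_fun \<theta> k z * tri_fun \<theta> l z) = 0"
    and "k \<in> mode_index \<theta> \<Longrightarrow> (LINT z|hemi_leb. tri_fun \<theta> k z * tri_fun \<theta> k z) = (if fst k = snd k then sqrt 3 / 4 else sqrt 3 / 8)"
proof -
  have *: "(LINT z|hemi_leb. tri_fun \<theta> k z * tri_fun \<theta> l z) = sqrt 3 / (24 * pi\<^sup>2) *
      integral (cbox (0,0) (2*pi,2*pi)) (\<lambda>z. tri_mode \<theta> (fst k) (snd k) z * tri_mode \<theta> (fst l) (snd l) z)" for k l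
    unfolding tri_fun_def
    by (subst integral_hemi_eq_square[OF th, where G = "(*)"], (intro tri_mode_in_mode_span th continuous_intros continuous_tri_mode | simp)+)
      (intro arg_cong2[where f="(*)"] refl LINT_square_eq_integral continuous_intros continuous_tri_mode)
  show "(LINT z|hemi_leb. tri_fun \<theta> k z * tri_fun \<theta> l z) = 0" if "k \<in> mode_index \<theta>" "l \<in> mode_index \<theta>" "k \<noteq> l"
    unfolding * using tri_mode_orthogonal[of "fst k" "snd k" \<theta> "fst l" "snd l"] that
    by (simp add: integral_unique prod_eq_iff)
  show "(LINT z|hemi_leb. tri_fun \<theta> k z * tri_fun \<theta> k z) = (if fst k = snd k then sqrt 3 / 4 else sqrt 3 / 8)" if "k \<in> mode_index \<theta>"
    unfolding * using tri_mode_norm[of "fst k" "snd k" \<theta>] that th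
    by (simp add: integral_unique)
qed

text \<open>The six frequencies \<open>(k, l)\<close> of a mode, paired so that \<open>l\<close> changes sign within a pair.\<close>

definition hex_k :: "(int \<times> int) \<times> nat \<Rightarrow> int" where
  "hex_k = (\<lambda>((q, r), j). [q - r, q - r, - 2 * q - r, - 2 * q - r, q + 2 * r, q + 2 * r] ! j)"

definition hex_l :: "(int \<times> int) \<times> nat \<Rightarrow> int" where
  "hex_l = (\<lambda>((q, r), j). [q + r, - q - r, - r, r, - q, q] ! j)"

lemma tri_mode_hex:
  "tri_mode \<theta> (fst k) (snd k) (x, y) = (\<Sum>j<6. (- 1) ^ j / 2 * sin (of_int (hex_k (k, j)) * x + of_int (hex_l (k, j)) * y + - \<theta>))"
proof -
  have *: "{..<6::nat} = {0, 1, 2, 3, 4, 5}" by auto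
  show ?thesis unfolding tri_mode_sin *
    by (simp add: hex_k_def hex_l_def case_prod_unfold eval_nat_numeral) (simp add: field_simps)?
qed

text \<open>For each of the six frequencies the largest of 2|l|, |k + l|, |k - l| equals 2 (q + r) =
  2 n. So a mode lies in the hexagon entirely if n <= N and not at all otherwise.\<close>

lemma hexagon_filter:
  assumes "I \<subseteq> mode_index \<theta>"
  shows "{i \<in> I \<times> {..<6}. \<bar>hex_l i\<bar> \<le> int N \<and> \<bar>hex_k i + hex_l i\<bar> \<le> int (2 * N) \<and> \<bar>hex_k i - hex_l i\<bar> \<le> int (2 * N)}
    = {k \<in> I. tri_lev k \<le> N} \<times> {..<6}"
proof -
  have "(\<bar>hex_l ((q, r), j)\<bar> \<le> int N \<and> \<bar>hex_k ((q, r), j) + hex_l ((q, r), j)\<bar> \<le> int (2 * N) \<and> \<bar>hex_k ((q, r), j) - hex_l ((q, r), j)\<bar> \<le> int (2 * N))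
     \<longleftrightarrow> tri_lev (q, r) \<le> N" if "(q, r) \<in> I" and j: "j < 6" for q r j
  proof -
    have qr: "1 \<le> r" "r \<le> q" using assms that by (auto simp: mode_index_def)
    have "j \<in> {0, 1, 2, 3, 4, 5}" using j by auto
    then show ?thesis using qr by (auto simp: hex_k_def hex_l_def tri_lev_def)
  qed
  then show ?thesis by (auto simp only: set_eq_iff mem_Collect_eq mem_Times_iff lessThan_iff fst_conv snd_conv split_paired_All)
qed

lemma tri_trunc_bound:
  assumes th: "\<theta> \<in> {0, pi / 2}" and p: "1 < p" "p \<le> 2"
  shows "\<exists>C>0. \<forall>I a N. finite I \<longrightarrow> I \<subseteq> mode_index \<theta> \<longrightarrow>
      (LINT z|hemi_leb. \<bar>\<Sum>k\<in>{k\<in>I. tri_lev k \<le> N}. a k * tri_fun \<theta> k z\<bar> powr p)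
      \<le> C * (LINT z|hemi_leb. \<bar>\<Sum>k\<in>I. a k * tri_fun \<theta> k z\<bar> powr p)"
proof -
  obtain C :: real where C: "0 < C" 
    "\<And>(I::((int \<times> int) \<times> nat) set) c k l \<phi> (N::nat) (M::nat). finite I \<Longrightarrow>
      torus_int p (\<lambda>x y. \<Sum>i\<in>{i\<in>I. \<bar>l i\<bar> \<le> int N \<and> \<bar>k i + l i\<bar> \<le> int M \<and> \<bar>k i - l i\<bar> \<le> int M}. c i * sin (of_int (k i) * x + of_int (l i) * y + \<phi> i))
      \<le> C * torus_int p (\<lambda>x y. \<Sum>i\<in>I. c i * sin (of_int (k i) * x + of_int (l i) * y + \<phi> i) :: real)"
    by (rule hexagon_truncation_bound[OF p, where 'i="(int \<times> int) \<times> nat"]) (rule that)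
  define \<kappa> where "\<kappa> = sqrt 3 / (24 * pi\<^sup>2)"
  have \<kappa>: "0 \<le> \<kappa>" by (simp add: \<kappa>_def)
  have T: "(LINT z|hemi_leb. \<bar>\<Sum>k\<in>J. a k * tri_fun \<theta> k z\<bar> powr p)
      = \<kappa> * torus_int p (\<lambda>x y. \<Sum>i\<in>J \<times> {..<6}. (a (fst i) * ((- 1) ^ snd i / 2)) * sin (of_int (hex_k i) * x + of_int (hex_l i) * y + - \<theta>))"
    if J: "finite J" "J \<subseteq> mode_index \<theta>" for J a
  proof -
    define w where "w = (\<lambda>z. \<Sum>k\<in>J. a k * tri_mode \<theta> (fst k) (snd k) z)"
    have w: "w \<in> mode_span \<theta>" using J by (auto simp: mode_span_def w_def)
    have c: "continuous_on UNIV (\<lambda>z. \<bar>w z\<bar> powr p)"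
      using continuous_on_norm_powr[OF _ continuous_mode_span[OF w], of p UNIV] p by simp
    have "(LINT z|hemi_leb. \<bar>\<Sum>k\<in>J. a k * tri_fun \<theta> k z\<bar> powr p) = (LINT z|hemi_leb. \<bar>w (to_alcove z)\<bar> powr p)"
      by (simp add: w_def tri_fun_def)
    also have "\<dots> = \<kappa> * (LINT z:cbox (0,0) (2*pi,2*pi)|lborel. \<bar>w z\<bar> powr p)"
      unfolding \<kappa>_def by (rule integral_hemi_eq_square[OF th w w, where G = "\<lambda>s t. \<bar>s\<bar> powr p"]) (use c in auto)
    also have "(LINT z:cbox (0,0) (2*pi,2*pi)|lborel. \<bar>w z\<bar> powr p) = torus_int p (\<lambda>x y. w (x, y))"
      unfolding torus_int_def real_norm_def by (rule iterated_integral_square[OF c, symmetric])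
    also have "(\<lambda>x y. w (x, y)) = (\<lambda>x y. \<Sum>i\<in>J \<times> {..<6}. (a (fst i) * ((- 1) ^ snd i / 2)) * sin (of_int (hex_k i) * x + of_int (hex_l i) * y + - \<theta>))"
      unfolding w_def tri_mode_hex sum_distrib_left sum.cartesian_product
      by (intro ext sum.cong) (auto simp: case_prod_unfold)
    finally show ?thesis .
  qed
  have "(LINT z|hemi_leb. \<bar>\<Sum>k\<in>{k\<in>I. tri_lev k \<le> N}. a k * tri_fun \<theta> k z\<bar> powr p)
      \<le> C * (LINT z|hemi_leb. \<bar>\<Sum>k\<in>I. a k * tri_fun \<theta> k z\<bar> powr p)"
    if I: "finite I" "I \<subseteq> mode_index \<theta>" for I a N
  proof -
    have J: "finite {k\<in>I. tri_lev k \<le> N}" "{k\<in>I. tri_lev k \<le> N} \<subseteq> mode_index \<theta>" using I by auto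
    have fin: "finite (I \<times> {..<6::nat})" using I by simp
    show ?thesis
      unfolding T[OF J] T[OF I] hexagon_filter[OF I(2), symmetric]
      unfolding mult.left_commute[of C \<kappa>] by (intro mult_left_mono \<kappa> C(2)[OF fin])
  qed
  then show ?thesis using C(1) by blast
qed

lemma AE_hemi_interior:
  "AE z in hemi_leb. 0 < fst (to_alcove z) \<and> 3 * fst (to_alcove z) < snd (to_alcove z) \<and> snd (to_alcove z) < pi"
proof -
  let ?L = "{z::real \<times> real. 1 * fst z + 0 * snd z = 0} \<union> {z. 0 * fst z + 1 * snd z = 0} \<union> {z. sqrt 3 * fst z + 1 * snd z = 1}"
  have "?L \<in> null_sets lborel" by (intro null_sets.Un null_sets_plane_line) auto
  then have L: "?L \<in> null_sets lebesgue" by (rule null_sets_completionI)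
  have "0 < fst (to_alcove z) \<and> 3 * fst (to_alcove z) < snd (to_alcove z) \<and> snd (to_alcove z) < pi"
    if "z \<in> hemi_triangle" "z \<notin> ?L" for z
  proof -
    obtain x y where z: "z = (x, y)" by (cases z)
    have xy: "0 < x" "0 < y" "sqrt 3 * x + y < 1" using that by (auto simp: z hemi_triangle_eq)
    have "pi * (sqrt 3 * x) < pi * (1 - y)" using xy by (intro mult_strict_left_mono) auto
    moreover have "3 * (pi * x / sqrt 3) = pi * (sqrt 3 * x)" by (simp add: field_simps)
    ultimately show ?thesis using xy by (simp add: z to_alcove_def algebra_simps)
  qed
  then have "AE z in lebesgue. z \<in> hemi_triangle \<longrightarrow> 0 < fst (to_alcove z) \<and> 3 * fst (to_alcove z) < snd (to_alcove z) \<and> snd (to_alcove z) < pi"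
    by (intro AE_I'[OF L]) auto
  then show ?thesis by (subst AE_restrict_space_iff) auto
qed

text \<open>Continuous functions tending to f almost everywhere are clipped to [-|B|, |B|], factored
  through \<open>\<rho>\<close>, and approximated uniformly from the span. Dominated convergence
  gives the claim, as \<open>\<rho>\<close> has no zeros off the sides.\<close>

lemma tri_dense:
  assumes th: "\<theta> \<in> {0, pi / 2}" and p: "1 < p" and f: "f \<in> borel_measurable (hemi_leb)"
    and B: "\<And>z. z \<in> hemi_triangle \<Longrightarrow> \<bar>f z\<bar> \<le> B" and d: "0 < d"
  shows "\<exists>I a. finite I \<and> I \<subseteq> mode_index \<theta> \<and>
    (LINT z|hemi_leb. \<bar>f z - (\<Sum>k\<in>I. a k * tri_fun \<theta> k z)\<bar> powr p) < d"
proof -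
  have hl: "hemi_triangle \<in> sets lebesgue" by auto
  interpret finite_measure "hemi_leb"
    by (rule finite_measure_lebesgue_on) (use compact_hemi lmeasurable_compact in blast)
  obtain \<rho> where \<rho>: "\<rho> \<in> mode_span \<theta>" and \<rho>0: "\<And>x y. 0 < x \<Longrightarrow> 3 * x < y \<Longrightarrow> y < pi \<Longrightarrow> \<rho> (x, y) \<noteq> 0"
    using tri_mode_nonvanishing[OF th] by blast
  have "f measurable_on hemi_triangle" using f hl by (simp add: measurable_on_iff_borel_measurable)
  then obtain N g where N: "negligible N" and g: "\<And>n. continuous_on UNIV (g n)"
    and lim: "\<And>z. z \<notin> N \<Longrightarrow> (\<lambda>n. g n z) \<longlonglongrightarrow> (if z \<in> hemi_triangle then f z else 0)"
    by (auto simp: measurable_on_def)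
  define t where "t n = inverse (real (Suc n))" for n
  have t: "0 < t n" "t n \<le> 1" for n by (auto simp: t_def field_simps)
  have t0: "t \<longlonglongrightarrow> 0" unfolding t_def by (rule LIMSEQ_inverse_real_of_nat)
  define c where "c n z = max (- \<bar>B\<bar>) (min \<bar>B\<bar> (g n z))" for n z
  \<comment> \<open>A continuous substitute for \<open>c n / \<rho>\<close>. The product
    \<open>\<rho> * F n\<close> differs from \<open>c n\<close> by a factor in [0, 1] that tends to
    1 wherever \<open>\<rho>\<close> is not 0.\<close>
  define F where "F n Z = \<rho> Z / ((\<rho> Z)\<^sup>2 + t n) * c n (of_alcove Z)" for n Z
  have pos: "0 < (\<rho> Z)\<^sup>2 + t n" for Z n using t(1)[of n] by (intro add_nonneg_pos) auto
  have "continuous_on alcove (F n)" for n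
  proof -
    have "continuous_on alcove (c n \<circ> of_alcove)"
      unfolding c_def by (intro continuous_on_compose continuous_of_alcove continuous_intros continuous_on_subset[OF g]) auto
    then show ?thesis unfolding F_def using pos
      by (intro continuous_intros continuous_mode_span[OF \<rho>]) (auto simp: o_def pos[THEN less_imp_neq, THEN not_sym])
  qed
  then have "\<exists>w\<in>mode_span \<theta>. \<forall>Z\<in>alcove. \<bar>\<rho> Z * F n Z - w Z\<bar> < t n" for n
    by (intro mode_span_dense th \<rho> t)
  then obtain w where w: "\<And>n. w n \<in> mode_span \<theta>" "\<And>n Z. Z \<in> alcove \<Longrightarrow> \<bar>\<rho> Z * F n Z - w n Z\<bar> < t n"
    by metis
  have \<rho>F: "\<rho> Z * F n Z = (\<rho> Z)\<^sup>2 / ((\<rho> Z)\<^sup>2 + t n) * c n (of_alcove Z)" for n Z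
    by (simp add: F_def power2_eq_square)
  have "(\<lambda>n. LINT z|hemi_leb. \<bar>f z - w n (to_alcove z)\<bar> powr p) \<longlonglongrightarrow> (LINT z|hemi_leb. 0)"
  proof (rule integral_dominated_convergence[where w = "\<lambda>z. (2 * \<bar>B\<bar> + 1) powr p"])
    have wm: "(\<lambda>z. w n (to_alcove z)) \<in> borel_measurable (hemi_leb)" for n
      using continuous_on_compose[OF continuous_to_alcove continuous_mode_span[OF w(1)], of UNIV n] 
      by (intro continuous_imp_lebesgue_on) (simp add: o_def)
    show "(\<lambda>z. \<bar>f z - w n (to_alcove z)\<bar> powr p) \<in> borel_measurable (hemi_leb)" for n
      using f wm[of n] by measurable
    show "AE z in hemi_leb. norm (\<bar>f z - w n (to_alcove z)\<bar> powr p) \<le> (2 * \<bar>B\<bar> + 1) powr p" for n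
    proof (rule AE_I2)
      fix z assume "z \<in> space (hemi_leb)"
      then have z: "z \<in> hemi_triangle" by simp
      let ?Z = "to_alcove z"
      have "\<bar>\<rho> ?Z * F n ?Z\<bar> \<le> 1 * \<bar>B\<bar>"
        unfolding \<rho>F abs_mult
      proof (rule mult_mono)
        show "\<bar>(\<rho> ?Z)\<^sup>2 / ((\<rho> ?Z)\<^sup>2 + t n)\<bar> \<le> 1" using pos[of ?Z n] t(1)[of n] by simp
      qed (auto simp: c_def)
      moreover have "\<bar>\<rho> ?Z * F n ?Z - w n ?Z\<bar> < t n" using w(2) z by (simp add: to_alcove_mem_iff)
      moreover have "\<bar>f z\<bar> \<le> \<bar>B\<bar>" using B[OF z] by simp
      ultimately have "\<bar>f z - w n ?Z\<bar> \<le> 2 * \<bar>B\<bar> + 1" using t(2)[of n] by linarith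
      then show "norm (\<bar>f z - w n ?Z\<bar> powr p) \<le> (2 * \<bar>B\<bar> + 1) powr p" using p by (simp add: powr_mono2)
    qed
    have "AE z in lebesgue. z \<in> hemi_triangle \<longrightarrow> z \<notin> N"
      using N by (intro AE_I'[of N]) (auto simp: negligible_iff_null_sets)
    then have "AE z in hemi_leb. z \<notin> N" by (subst AE_restrict_space_iff) auto
    then show "AE z in hemi_leb. (\<lambda>n. \<bar>f z - w n (to_alcove z)\<bar> powr p) \<longlonglongrightarrow> 0"
      using AE_hemi_interior AE_space
    proof eventually_elim
      case (elim z)
      then have z: "z \<in> hemi_triangle" by simp
      let ?Z = "to_alcove z"
      have \<rho>Z: "\<rho> ?Z \<noteq> 0" using \<rho>0[of "fst ?Z" "snd ?Z"] elim by simp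
      have "(\<lambda>n. c n z) \<longlonglongrightarrow> max (- \<bar>B\<bar>) (min \<bar>B\<bar> (f z))"
        unfolding c_def using lim[of z] elim z by (intro tendsto_intros) auto
      moreover have "max (- \<bar>B\<bar>) (min \<bar>B\<bar> (f z)) = f z" using B[OF z] by auto
      moreover have "(\<lambda>n. (\<rho> ?Z)\<^sup>2 / ((\<rho> ?Z)\<^sup>2 + t n)) \<longlonglongrightarrow> (\<rho> ?Z)\<^sup>2 / ((\<rho> ?Z)\<^sup>2 + 0)"
        using \<rho>Z by (intro tendsto_intros t0) auto
      ultimately have 1: "(\<lambda>n. \<rho> ?Z * F n ?Z) \<longlonglongrightarrow> f z"
        unfolding \<rho>F using \<rho>Z tendsto_mult by fastforce
      have "(\<lambda>n. \<rho> ?Z * F n ?Z - w n ?Z) \<longlonglongrightarrow> 0"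
      proof (rule Lim_null_comparison[OF _ t0], intro always_eventually allI)
        show "norm (\<rho> ?Z * F n ?Z - w n ?Z) \<le> t n" for n
          using w(2)[of ?Z n] z by (simp add: to_alcove_mem_iff)
      qed
      from tendsto_diff[OF 1 this] have "(\<lambda>n. w n ?Z) \<longlonglongrightarrow> f z" by simp
      from tendsto_rabs[OF tendsto_diff[OF tendsto_const[of "f z"] this]]
      have "(\<lambda>n. \<bar>f z - w n ?Z\<bar>) \<longlonglongrightarrow> 0" by simp
      then show ?case using p by (intro tendsto_zero_powrI[where b = p]) auto
    qed
  qed auto
  then have "\<forall>\<^sub>F n in sequentially. (LINT z|hemi_leb. \<bar>f z - w n (to_alcove z)\<bar> powr p) < d"
    using d by (intro order_tendstoD) auto
  then obtain n where n: "(LINT z|hemi_leb. \<bar>f z - w n (to_alcove z)\<bar> powr p) < d"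
    by (auto simp: eventually_sequentially)
  obtain I a where I: "finite I" "I \<subseteq> mode_index \<theta>" "w n = (\<lambda>z. \<Sum>k\<in>I. a k * tri_mode \<theta> (fst k) (snd k) z)"
    using w(1)[of n] unfolding mode_span_def by blast
  then show ?thesis using n by (intro exI[of _ I] exI[of _ a]) (simp add: tri_fun_def)
qed

lemma tri_orthogonal_system:
  assumes th: "\<theta> \<in> {0, pi / 2}"
  shows "orthogonal_system (hemi_leb) (mode_index \<theta>) tri_lev (tri_fun \<theta>)"
proof -
  interpret finite_measure "hemi_leb"
    by (rule finite_measure_lebesgue_on) (use compact_hemi lmeasurable_compact in blast)
  show ?thesis
  proof
    show "finite {k \<in> mode_index \<theta>. tri_lev k \<le> N}" for N
      by (rule finite_subset[of _ "{0..int N} \<times> {0..int N}"]) (auto simp: mode_index_def tri_lev_def)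
    show "tri_fun \<theta> k \<in> borel_measurable (hemi_leb)" for k
      by (intro continuous_imp_lebesgue_on continuous_tri_fun)
    show "\<exists>B. \<forall>x\<in>space (hemi_leb). \<bar>tri_fun \<theta> k x\<bar> \<le> B" for k
      using abs_tri_fun_le by blast
    show "(LINT x|hemi_leb. tri_fun \<theta> k x * tri_fun \<theta> l x) = 0" if "k \<in> mode_index \<theta>" "l \<in> mode_index \<theta>" "k \<noteq> l" for k l
      by (rule tri_fun_inner(1)[OF th that])
    show "(LINT x|hemi_leb. tri_fun \<theta> k x * tri_fun \<theta> k x) \<noteq> 0" if "k \<in> mode_index \<theta>" for k
      using tri_fun_inner(2)[OF th that] by auto
  next
    fix p :: real assume "1 < p" "p \<le> 2"
    then show "\<exists>C>0. \<forall>I a N. finite I \<longrightarrow> I \<subseteq> mode_index \<theta> \<longrightarrow>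
        (LINT x|hemi_leb. \<bar>\<Sum>k\<in>{k\<in>I. tri_lev k \<le> N}. a k * tri_fun \<theta> k x\<bar> powr p)
        \<le> C * (LINT x|hemi_leb. \<bar>\<Sum>k\<in>I. a k * tri_fun \<theta> k x\<bar> powr p)"
      by (rule tri_trunc_bound[OF th])
  next
    fix p B d :: real and f
    assume "1 < p" "f \<in> borel_measurable (hemi_leb)"
      "\<And>x. x \<in> space (hemi_leb) \<Longrightarrow> \<bar>f x\<bar> \<le> B" "0 < d"
    then show "\<exists>I a. finite I \<and> I \<subseteq> mode_index \<theta> \<and>
        (LINT x|hemi_leb. \<bar>f x - (\<Sum>k\<in>I. a k * tri_fun \<theta> k x)\<bar> powr p) < d"
      by (intro tri_dense[OF th, where B = B]) auto
  qed
qed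

section \<open>Reflection in the axis of the triangle\<close>

definition flip_x :: "real \<times> real \<Rightarrow> real \<times> real" where
  "flip_x = (\<lambda>(x, y). (- x, y))"

lemma flip_x_flip_x [simp]: "flip_x (flip_x z) = z"
  by (cases z) (simp add: flip_x_def)

lemma lebesgue_flip_x: "flip_x \<in> lebesgue \<rightarrow>\<^sub>M lebesgue" "distr lebesgue lebesgue flip_x = lebesgue"
proof -
  define c where "c = (\<lambda>j::real \<times> real. if j = (1, 0) then - 1 else 1 :: real)"
  have c: "c j \<noteq> 0" for j by (simp add: c_def)
  have T: "(\<lambda>x. 0 + (\<Sum>j\<in>Basis. (c j * (x \<bullet> j)) *\<^sub>R j)) = flip_x"
    by (auto simp: fun_eq_iff flip_x_def c_def Basis_prod_def sum.union_disjoint)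
  have p: "(\<Prod>j\<in>Basis. \<bar>c j\<bar>) = 1" by (intro prod.neutral) (auto simp: c_def)
  show "flip_x \<in> lebesgue \<rightarrow>\<^sub>M lebesgue"
    using lebesgue_affine_measurable[of c 0] c unfolding T by blast
  have "lebesgue = density (distr lebesgue lebesgue flip_x) (\<lambda>_. ennreal 1)"
    using lebesgue_affine_euclidean[of c 0] c unfolding T p by blast
  then show "distr lebesgue lebesgue flip_x = lebesgue" by (simp add: density_1)
qed

lemma integral_lebesgue_flip_x:
  fixes h :: "real \<times> real \<Rightarrow> real"
  assumes "h \<in> borel_measurable lebesgue"
  shows "(LINT z|lebesgue. h (flip_x z)) = (LINT z|lebesgue. h z)"
    and "integrable lebesgue (\<lambda>z. h (flip_x z)) \<longleftrightarrow> integrable lebesgue h"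
  using integral_distr[OF lebesgue_flip_x(1) assms] integrable_distr_eq[OF lebesgue_flip_x(1) assms]
  by (simp_all add: lebesgue_flip_x(2))

lemma Lp_fun_flip_x:
  assumes "Lp_fun p lebesgue h" shows "Lp_fun p lebesgue (\<lambda>z. h (flip_x z))"
proof -
  have h: "h \<in> borel_measurable lebesgue" and i: "integrable lebesgue (\<lambda>z. \<bar>h z\<bar> powr p)"
    using assms by (auto simp: Lp_fun_def)
  have "(\<lambda>z. \<bar>h z\<bar> powr p) \<in> borel_measurable lebesgue" using h by measurable
  then have "integrable lebesgue (\<lambda>z. \<bar>h (flip_x z)\<bar> powr p)"
    using integral_lebesgue_flip_x(2)[of "\<lambda>z. \<bar>h z\<bar> powr p"] i by simp
  moreover have "(\<lambda>z. h (flip_x z)) \<in> borel_measurable lebesgue"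
    using measurable_compose[OF lebesgue_flip_x(1) h] .
  ultimately show ?thesis by (simp add: Lp_fun_def)
qed

lemma Lp_fun_lebesgue_on_iff:
  fixes f :: "real \<times> real \<Rightarrow> real"
  assumes S: "S \<in> sets lebesgue"
  shows "Lp_fun p (lebesgue_on S) f \<longleftrightarrow> Lp_fun p lebesgue (\<lambda>z. indicator S z * f z)"
proof -
  have "f \<in> borel_measurable (lebesgue_on S) \<longleftrightarrow> (\<lambda>z. indicator S z * f z) \<in> borel_measurable lebesgue"
    using S by (subst borel_measurable_restrict_space_iff) (auto simp: mult.commute)
  moreover have "integrable (lebesgue_on S) (\<lambda>z. \<bar>f z\<bar> powr p) \<longleftrightarrow> integrable lebesgue (\<lambda>z. \<bar>indicator S z * f z\<bar> powr p)"
  proof -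
    have "indicator S z *\<^sub>R \<bar>f z\<bar> powr p = \<bar>indicator S z * f z\<bar> powr p" for z by (simp add: indicator_def)
    then show ?thesis using S by (subst integrable_restrict_space) auto
  qed
  ultimately show ?thesis by (simp add: Lp_fun_def)
qed

lemma Lp_fun_parts:
  assumes p: "0 \<le> p" and f: "Lp_fun p (lebesgue_on equi_triangle) f"
  shows "Lp_fun p (hemi_leb) (antisym_part f)" "Lp_fun p (hemi_leb) (sym_part f)"
proof -
  \<comment> \<open>Values of \<open>f\<close> off the triangle are arbitrary. Extension by 0 makes
    the reflection act on functions on the plane, and on the half triangle both parts only look at
    points of T.\<close>
  define g where "g z = indicator equi_triangle z * f z" for z
  have g: "Lp_fun p lebesgue g"
    using f unfolding g_def by (subst (asm) Lp_fun_lebesgue_on_iff) auto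
  have "Lp_fun p lebesgue (\<lambda>z. 1/2 * (g z - g (flip_x z)))" "Lp_fun p lebesgue (\<lambda>z. 1/2 * (g z + g (flip_x z)))"
    by (intro Lp_fun_cmult Lp_fun_diff Lp_fun_add Lp_fun_flip_x g p)+
  moreover have restr: "Lp_fun p (hemi_leb) h" if "Lp_fun p lebesgue h'" "\<And>z. z \<in> hemi_triangle \<Longrightarrow> h z = h' z" for h h'
  proof -
    have h': "h' \<in> borel_measurable lebesgue" "integrable lebesgue (\<lambda>z. \<bar>h' z\<bar> powr p)" using that(1) by (auto simp: Lp_fun_def)
    have "integrable (hemi_leb) (\<lambda>z. \<bar>h' z\<bar> powr p)"
      using integrable_mult_indicator[OF _ h'(2), of hemi_triangle] by (subst integrable_restrict_space) auto
    moreover have "h' \<in> borel_measurable (hemi_leb)" using h'(1) by (rule measurable_restrict_space1)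
    ultimately have "Lp_fun p (hemi_leb) h'" by (simp add: Lp_fun_def)
    moreover have "Lp_fun p (hemi_leb) h' \<longleftrightarrow> Lp_fun p (hemi_leb) h"
      unfolding Lp_fun_def using that(2)
      by (intro conj_cong measurable_cong Bochner_Integration.integrable_cong) auto
    ultimately show ?thesis by simp
  qed
  have sub: "z \<in> equi_triangle" "flip_x z \<in> equi_triangle" if "z \<in> hemi_triangle" for z
    using that by (auto simp: hemi_triangle_eq equi_triangle_eq flip_x_def)
  have "antisym_part f z = 1/2 * (g z - g (flip_x z))" "sym_part f z = 1/2 * (g z + g (flip_x z))" if "z \<in> hemi_triangle" for z
    using sub[OF that] by (cases z, simp add: g_def antisym_part_def sym_part_def flip_x_def)+
  ultimately show "Lp_fun p (hemi_leb) (antisym_part f)" "Lp_fun p (hemi_leb) (sym_part f)"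
    by (auto intro: restr)
qed

section \<open>Return to the functions u and v\<close>

lemma minus_one_powi: 
  "cos (of_int k * pi) = (- 1) powi k" "((- 1) powi k)\<^sup>2 = (1::real)" "(- 1) powi (- k) = ((- 1) powi k :: real)"
  by (auto simp: mult.commute[of _ pi] power_int_minus_left)

lemma sin_reflect_height: "sin (of_int k * (pi * y)) = - ((- 1) powi k) * sin (of_int k * (pi * (1 - y)))"
proof -
  have "of_int k * (pi * y) = of_int k * pi - of_int k * (pi * (1 - y))" by (simp add: algebra_simps)
  moreover have "sin (of_int k * pi) = 0" by (simp add: sin_times_pi_eq_0)
  ultimately show ?thesis by (simp add: sin_diff minus_one_powi)
qed

text \<open>Moving the origin to the vertex (0, 1) multiplies sin (k pi y) by -(-1)^k. Together with
  the explicit signs in u and v this yields the same factor (-1)^(q+r) in all three terms.\<close>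

lemma tri_fun_original_coordinates:
  fixes x y :: real
  defines "X \<equiv> pi * x / sqrt 3"
  shows "2 * cos (of_int (q - r) * X - \<theta>) * sin (of_int (q + r) * (pi * y))
     + 2 * (- 1) powi q * cos (of_int (- 2 * q - r) * X - \<theta>) * sin (of_int (- r) * (pi * y))
     - 2 * (- 1) powi (- r) * cos (of_int (q + 2 * r) * X - \<theta>) * sin (of_int q * (pi * y))
    = - 2 * (- 1) powi (q + r) * tri_fun \<theta> (q, r) (x, y)"
proof -
  define s where "s k = sin (of_int k * (pi * (1 - y)))" for k
  have e: "(- 1) powi (q + r) = ((- 1) powi q * (- 1) powi r :: real)" by (simp add: power_int_add)
  have "s (- q) = - s q" by (simp add: s_def)
  then have tri: "tri_fun \<theta> (q, r) (x, y) = cos (of_int (q - r) * X - \<theta>) * s (q + r)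
     + cos (of_int (- 2 * q - r) * X - \<theta>) * s (- r) - cos (of_int (q + 2 * r) * X - \<theta>) * s q"
    unfolding tri_fun_def tri_mode_def cos_sin_def to_alcove_def split fst_conv snd_conv X_def[symmetric] s_def[symmetric] by simp
  show ?thesis
    unfolding tri sin_reflect_height[where y = y] s_def[symmetric] e minus_one_powi by (simp add: algebra_simps)
qed

lemma u_fun_eq: "u_fun (q - r) (q + r) z = - 2 * (- 1) powi (q + r) * tri_fun (pi / 2) (q, r) z"
  and v_fun_eq: "v_fun (q - r) (q + r) z = - 2 * (- 1) powi (q + r) * tri_fun 0 (q, r) z"
proof -
  obtain x y where z: "z = (x, y)" by (cases z)
  define X where "X = pi * x / sqrt 3"
  have d: "(q - r + (q + r)) div 2 = q" "(q - r - (q + r)) div 2 = - r" by auto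
  have a: "pi * of_int (q - r) * x / sqrt 3 = of_int (q - r) * X" "pi * of_int (q + r) * y = of_int (q + r) * (pi * y)"
    "pi * x / (2 * sqrt 3) * of_int (q - r + 3 * (q + r)) = - (of_int (- 2 * q - r) * X)"
    "pi * y / 2 * of_int (q - r - (q + r)) = of_int (- r) * (pi * y)"
    "pi * x / (2 * sqrt 3) * of_int (q - r - 3 * (q + r)) = - (of_int (q + 2 * r) * X)"
    "pi * x / (2 * sqrt 3) * of_int (3 * (q + r) - (q - r)) = of_int (q + 2 * r) * X"
    "pi * y / 2 * of_int (q - r + (q + r)) = of_int q * (pi * y)"
    by (simp_all add: X_def field_simps)
  have c: "cos (t - pi / 2) = sin t" for t :: real by (simp add: cos_diff)
  show "u_fun (q - r) (q + r) z = - 2 * (- 1) powi (q + r) * tri_fun (pi / 2) (q, r) z"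
    unfolding z tri_fun_original_coordinates[symmetric] c X_def[symmetric] u_fun_def split a d sin_minus by simp
  show "v_fun (q - r) (q + r) z = - 2 * (- 1) powi (q + r) * tri_fun 0 (q, r) z"
    unfolding z tri_fun_original_coordinates[symmetric] X_def[symmetric] v_fun_def split a d cos_minus diff_zero by simp
qed

abbreviation tri_psum :: "real \<Rightarrow> nat \<Rightarrow> (real \<times> real \<Rightarrow> real) \<Rightarrow> real \<times> real \<Rightarrow> real" where
  "tri_psum \<theta> \<equiv> orthogonal_system.psum (hemi_leb) (mode_index \<theta>) tri_lev (tri_fun \<theta>)"

text \<open>The substitution m = q - r, n = q + r; equal parity of m and n is what makes q and r
  integers, and m = 0 corresponds to q = r.\<close>

lemma sum_mode_index:
  "(\<Sum>(m, n)\<in>{(m, n). 0 \<le> m \<and> (\<theta> \<noteq> 0 \<longrightarrow> m \<noteq> 0) \<and> m < n \<and> n \<le> int N \<and> [m = n] (mod 2)}. g m n)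
    = (\<Sum>(q, r)\<in>{k\<in>mode_index \<theta>. tri_lev k \<le> N}. g (q - r) (q + r))"
proof (rule sum.reindex_bij_witness[of _ "\<lambda>(q, r). (q - r, q + r)" "\<lambda>(m, n). ((m + n) div 2, (n - m) div 2)"])
  fix a assume "a \<in> {(m, n). 0 \<le> m \<and> (\<theta> \<noteq> 0 \<longrightarrow> m \<noteq> 0) \<and> m < n \<and> n \<le> int N \<and> [m = n] (mod 2)}"
  then obtain m n where a: "a = (m, n)" "0 \<le> m" "\<theta> \<noteq> 0 \<longrightarrow> m \<noteq> 0" "m < n" "n \<le> int N" "m mod 2 = n mod 2"
    by (auto simp: cong_def)
  define q where "q = (m + n) div 2"
  define r where "r = (n - m) div 2"
  have mn: "m = q - r" "n = q + r" using a(6) unfolding q_def r_def by presburger+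
  have e: "(case a of (m, n) \<Rightarrow> ((m + n) div 2, (n - m) div 2)) = (q, r)" by (simp add: a(1) q_def r_def)
  have k: "(q, r) \<in> mode_index \<theta>" "tri_lev (q, r) \<le> N" using a unfolding mn by (auto simp: mode_index_def tri_lev_def)
  show "(case case a of (m, n) \<Rightarrow> ((m + n) div 2, (n - m) div 2) of (q, r) \<Rightarrow> (q - r, q + r)) = a"
    "(case case a of (m, n) \<Rightarrow> ((m + n) div 2, (n - m) div 2) of (q, r) \<Rightarrow> g (q - r) (q + r)) = (case a of (m, n) \<Rightarrow> g m n)"
    unfolding e by (simp_all add: a(1) mn)
  show "(case a of (m, n) \<Rightarrow> ((m + n) div 2, (n - m) div 2)) \<in> {k \<in> mode_index \<theta>. tri_lev k \<le> N}"
    unfolding e using k by simp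
next
  have par: "(q - r) mod 2 = (q + r) mod 2" for q r :: int by presburger
  fix b assume "b \<in> {k \<in> mode_index \<theta>. tri_lev k \<le> N}"
  then show "(case b of (q, r) \<Rightarrow> (q - r, q + r)) \<in> {(m, n). 0 \<le> m \<and> (\<theta> \<noteq> 0 \<longrightarrow> m \<noteq> 0) \<and> m < n \<and> n \<le> int N \<and> [m = n] (mod 2)}"
    "(case case b of (q, r) \<Rightarrow> (q - r, q + r) of (m, n) \<Rightarrow> ((m + n) div 2, (n - m) div 2)) = b"
    by (auto simp: mode_index_def tri_lev_def cong_def par split: prod.splits)
qed

text \<open>The factor c = -2 (-1)^n between u or v and the mode enters once through the coefficient
  and once through the function. Its square 4 cancels against the normalisation: 4 * sqrt 3 / 8 is
  the reciprocal of 2 / sqrt 3, and for v the norm itself carries the 4.\<close>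

lemma partial_sum_eq: "partial_sum N f z = tri_psum (pi / 2) N (antisym_part f) z + tri_psum 0 N (sym_part f) z"
proof -
  interpret A: orthogonal_system "hemi_leb" "mode_index (pi / 2)" tri_lev "tri_fun (pi / 2)"
    by (rule tri_orthogonal_system) simp
  interpret S: orthogonal_system "hemi_leb" "mode_index 0" tri_lev "tri_fun 0"
    by (rule tri_orthogonal_system) simp
  have sq: "(- 2 * (- 1) powi k)\<^sup>2 = (4::real)" for k :: int
    by (simp add: power_mult_distrib minus_one_powi)
  have a: "antisym_coeff f (q - r) (q + r) * u_fun (q - r) (q + r) z = A.cf (antisym_part f) (q, r) * tri_fun (pi / 2) (q, r) z"
    if k: "(q, r) \<in> mode_index (pi / 2)" for q r
  proof -
    have I: "(LINT z|hemi_leb. tri_fun (pi / 2) (q, r) z * tri_fun (pi / 2) (q, r) z) = sqrt 3 / 8"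
      using tri_fun_inner(2)[OF _ k] k by (auto simp: mode_index_def)
    define c :: real where "c = - 2 * (- 1) powi (q + r)"
    have "antisym_coeff f (q - r) (q + r) * u_fun (q - r) (q + r) z
       = 2 / sqrt 3 * c\<^sup>2 * (LINT z|hemi_leb. antisym_part f z * tri_fun (pi / 2) (q, r) z) * tri_fun (pi / 2) (q, r) z"
      unfolding antisym_coeff_def u_fun_eq c_def[symmetric] by (simp add: mult.left_commute[of _ c] power2_eq_square)
    then show ?thesis unfolding A.cf_def I c_def sq by (simp add: field_simps)
  qed
  have s: "sym_coeff f (q - r) (q + r) * v_fun (q - r) (q + r) z = S.cf (sym_part f) (q, r) * tri_fun 0 (q, r) z"
    if k: "(q, r) \<in> mode_index 0" for q r
  proof -
    define I where "I = (LINT z|hemi_leb. tri_fun 0 (q, r) z * tri_fun 0 (q, r) z)"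
    have I0: "0 < I" unfolding I_def using tri_fun_inner(2)[OF _ k] by auto
    define c :: real where "c = - 2 * (- 1) powi (q + r)"
    have c2: "c\<^sup>2 = 4" unfolding c_def by (rule sq)
    have "\<bar>v_fun (q - r) (q + r) z\<bar> powr 2 = c\<^sup>2 * (tri_fun 0 (q, r) z * tri_fun 0 (q, r) z)" for z
      unfolding v_fun_eq c_def[symmetric] by (simp add: power2_eq_square)
    then have "(LINT z|hemi_leb. \<bar>v_fun (q - r) (q + r) z\<bar> powr 2) = 4 * I"
      by (simp add: I_def c2)
    then have n2: "(Lp_norm 2 hemi_triangle (v_fun (q - r) (q + r)))\<^sup>2 = 4 * I"
      unfolding Lp_norm_def using I0 by (simp only:) (simp add: powr_half_sqrt)
    have "sym_coeff f (q - r) (q + r) * v_fun (q - r) (q + r) z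
       = 1 / (4 * I) * c\<^sup>2 * (LINT z|hemi_leb. sym_part f z * tri_fun 0 (q, r) z) * tri_fun 0 (q, r) z"
      unfolding sym_coeff_def n2 unfolding v_fun_eq c_def[symmetric] by (simp add: mult.left_commute[of _ c] power2_eq_square)
    then show ?thesis unfolding S.cf_def I_def[symmetric] c2 by (simp add: field_simps)
  qed
  have "U_index N = {(m, n). 0 \<le> m \<and> (pi / 2 \<noteq> 0 \<longrightarrow> m \<noteq> 0) \<and> m < n \<and> n \<le> int N \<and> [m = n] (mod 2)}"
    by (auto simp: U_index_def)
  then have "(\<Sum>(m, n)\<in>U_index N. antisym_coeff f m n * u_fun m n z) = A.psum N (antisym_part f) z"
    unfolding A.psum_def by (simp only: sum_mode_index) (auto intro!: sum.cong simp: a)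
  moreover have "V_index N = {(m, n). 0 \<le> m \<and> ((0::real) \<noteq> 0 \<longrightarrow> m \<noteq> 0) \<and> m < n \<and> n \<le> int N \<and> [m = n] (mod 2)}"
    by (auto simp: V_index_def)
  then have "(\<Sum>(m, n)\<in>V_index N. sym_coeff f m n * v_fun m n z) = S.psum N (sym_part f) z"
    unfolding S.psum_def by (simp only: sum_mode_index) (auto intro!: sum.cong simp: s)
  ultimately show ?thesis by (simp add: partial_sum_def)
qed

lemma tri_fun_flip_x:
  assumes th: "\<theta> \<in> {0, pi / 2}"
  shows "tri_fun \<theta> k (flip_x z) = cos (2 * \<theta>) * tri_fun \<theta> k z"
proof -
  obtain x y where z: "z = (x, y)" by (cases z)
  define X where "X = pi * x / sqrt 3"
  have "cos_sin \<theta> m n (- X, Y) = cos (2 * \<theta>) * cos_sin \<theta> m n (X, Y)" for m n Y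
    using cos_reflect[OF th, of "of_int m * X"] by (simp add: cos_sin_def)
  moreover have "to_alcove (flip_x z) = (- X, pi * (1 - y))" "to_alcove z = (X, pi * (1 - y))"
    by (simp_all add: z flip_x_def to_alcove_def X_def)
  ultimately show ?thesis by (simp add: tri_fun_def tri_mode_def distrib_left)
qed

theorem theorem14:
  fixes p :: real and f :: "real \<times> real \<Rightarrow> real"
  assumes "1 < p"
    and "f \<in> Lp_space p equi_triangle"
  shows "converges_in_Lp p equi_triangle (\<lambda>N. partial_sum N f) f"
proof -
  let ?H = "hemi_leb" and ?T = "lebesgue_on equi_triangle"
  have p: "1 < p" "0 \<le> p" "0 < p" using assms(1) by auto
  have f: "Lp_fun p ?T f" using assms(2) by (simp add: Lp_space_def Lp_fun_def)
  interpret A: orthogonal_system ?H "mode_index (pi / 2)" tri_lev "tri_fun (pi / 2)"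
    by (rule tri_orthogonal_system) simp
  interpret S: orthogonal_system ?H "mode_index 0" tri_lev "tri_fun 0"
    by (rule tri_orthogonal_system) simp
  interpret T: finite_measure ?T
    by (rule finite_measure_lebesgue_on) (use compact_equi lmeasurable_compact in blast)
  define fa where "fa = antisym_part f"
  define fs where "fs = sym_part f"
  have fa: "Lp_fun p ?H fa" and fs: "Lp_fun p ?H fs"
    unfolding fa_def fs_def by (rule Lp_fun_parts[OF p(2) f])+
  define a where "a N z = A.psum N fa z - fa z" for N z
  define s where "s N z = S.psum N fs z - fs z" for N z
  have aL: "Lp_fun p ?H (a N)" and sL: "Lp_fun p ?H (s N)" for N
    unfolding a_def s_def using p by (intro Lp_fun_diff A.Lp_psum S.Lp_psum fa fs; simp)+
  have contP: "continuous_on UNIV (partial_sum N f)" for N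
    unfolding partial_sum_eq[abs_def] A.psum_def S.psum_def by (intro continuous_intros continuous_tri_fun)
  have PL: "Lp_fun p ?T (partial_sum N f)" for N
  proof -
    have "bounded (partial_sum N f ` equi_triangle)"
      by (intro compact_imp_bounded compact_continuous_image continuous_on_subset[OF contP] compact_equi) auto
    then obtain B where "\<forall>z\<in>equi_triangle. \<bar>partial_sum N f z\<bar> \<le> B" by (auto simp: bounded_iff)
    then show ?thesis using p by (intro T.Lp_fun_bounded[where B = B] continuous_imp_lebesgue_on contP) auto
  qed
  have dL: "Lp_fun p ?T (\<lambda>z. partial_sum N f z - f z)" for N by (intro Lp_fun_diff PL f p)
  have on_H: "partial_sum N f z - f z = a N z + s N z" for N z
  proof -
    have "f z = fa z + fs z" by (cases z) (simp add: fa_def fs_def antisym_part_def sym_part_def field_simps)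
    then show ?thesis by (simp add: a_def s_def partial_sum_eq fa_def fs_def)
  qed
  \<comment> \<open>At the mirror point only the odd error changes sign, so the errors of both parts
    on the half triangle control the error on all of T.\<close>
  have on_flip: "partial_sum N f (flip_x z) - f (flip_x z) = - a N z + s N z" for N z
  proof -
    have "f (flip_x z) = - fa z + fs z" by (cases z) (simp add: fa_def fs_def antisym_part_def sym_part_def flip_x_def field_simps)
    moreover have "A.psum N fa (flip_x z) = - A.psum N fa z" "S.psum N fs (flip_x z) = S.psum N fs z"
      by (simp_all add: A.psum_def S.psum_def tri_fun_flip_x sum_negf)
    ultimately show ?thesis by (simp add: a_def s_def partial_sum_eq fa_def fs_def)
  qed
  define J where "J N = (LINT z|?H. \<bar>a N z\<bar> powr p) + (LINT z|?H. \<bar>s N z\<bar> powr p)" for N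
  have J0: "J \<longlonglongrightarrow> 0"
    unfolding J_def a_def s_def
    using tendsto_add[OF A.psum_tendsto[OF p(1) fa] S.psum_tendsto[OF p(1) fs]] by simp
  have le: "(LINT z|?T. \<bar>partial_sum N f z - f z\<bar> powr p) \<le> 2 * 2 powr p * J N" for N
  proof -
    define G where "G z = \<bar>indicator equi_triangle z * (partial_sum N f z - f z)\<bar> powr p" for z
    have G: "integrable lebesgue G" 
      using dL[of N] unfolding G_def by (subst (asm) Lp_fun_lebesgue_on_iff) (auto simp: Lp_fun_def)
    have Gm: "G \<in> borel_measurable lebesgue" using G by simp
    have GH: "integrable lebesgue (\<lambda>z. indicator hemi_triangle z * G z)"
      using integrable_mult_indicator[OF _ G, of hemi_triangle] by simp
    have GF: "integrable lebesgue (\<lambda>z. indicator hemi_triangle z * G (flip_x z))"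
      using integrable_mult_indicator[of hemi_triangle lebesgue "\<lambda>z. G (flip_x z)"] integral_lebesgue_flip_x(2)[OF Gm] G by simp
    have GF': "(\<lambda>z. indicator hemi_triangle z * G (flip_x z)) \<in> borel_measurable lebesgue" using GF by simp
    have sub: "z \<in> equi_triangle" "flip_x z \<in> equi_triangle" if "z \<in> hemi_triangle" for z
      using that by (auto simp: hemi_triangle_eq equi_triangle_eq flip_x_def)
    have cover: "z \<in> hemi_triangle \<or> flip_x z \<in> hemi_triangle" if "z \<in> equi_triangle" for z
      using that by (cases z) (auto simp: hemi_triangle_eq equi_triangle_eq flip_x_def abs_if split: if_splits)
    have "(LINT z|?T. \<bar>partial_sum N f z - f z\<bar> powr p) = (LINT z|lebesgue. G z)"
      by (subst integral_restrict_space) (auto simp: G_def indicator_def intro!: Bochner_Integration.integral_cong)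
    \<comment> \<open>T is covered by the half triangle and its mirror image. Points with x = 0 are
      counted twice, which an upper bound permits as \<open>G\<close> is nonnegative.\<close>
    also have "\<dots> \<le> (LINT z|lebesgue. indicator hemi_triangle z * G z + indicator hemi_triangle (flip_x z) * G (flip_x (flip_x z)))"
    proof (rule integral_mono)
      show "integrable lebesgue (\<lambda>z. indicator hemi_triangle z * G z + indicator hemi_triangle (flip_x z) * G (flip_x (flip_x z)))"
        using GH integral_lebesgue_flip_x(2)[OF GF'] GF by simp
      show "G z \<le> indicator hemi_triangle z * G z + indicator hemi_triangle (flip_x z) * G (flip_x (flip_x z))" for z
        using cover[of z] by (auto simp: G_def indicator_def)
    qed (rule G)
    also have "\<dots> = (LINT z|lebesgue. indicator hemi_triangle z * G z) + (LINT z|lebesgue. indicator hemi_triangle z * G (flip_x z))"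
      using GH integral_lebesgue_flip_x[OF GF'] GF by simp
    also have "(LINT z|lebesgue. indicator hemi_triangle z * G z) = (LINT z|?H. \<bar>a N z + s N z\<bar> powr p)"
      by (subst integral_restrict_space) (auto simp: G_def indicator_def sub on_H intro!: Bochner_Integration.integral_cong)
    also have "(LINT z|lebesgue. indicator hemi_triangle z * G (flip_x z)) = (LINT z|?H. \<bar>- a N z + s N z\<bar> powr p)"
      by (subst integral_restrict_space) (auto simp: G_def indicator_def sub on_flip intro!: Bochner_Integration.integral_cong)
    also have "(LINT z|?H. \<bar>a N z + s N z\<bar> powr p) \<le> 2 powr p * J N"
      unfolding J_def by (intro integral_add_powr_le aL sL p)
    also have "(LINT z|?H. \<bar>- a N z + s N z\<bar> powr p) \<le> 2 powr p * J N"
      using integral_add_powr_le[OF p(2), of ?H "\<lambda>z. - a N z" "s N"] aL sL unfolding J_def by (simp add: Lp_fun_minus_iff)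
    finally show ?thesis by (simp add: ac_simps)
  qed
  have "(\<lambda>N. LINT z|?T. \<bar>partial_sum N f z - f z\<bar> powr p) \<longlonglongrightarrow> 0"
  proof (rule tendsto_sandwich[OF _ _ tendsto_const])
    show "(\<lambda>N. 2 * 2 powr p * J N) \<longlonglongrightarrow> 0" using tendsto_mult_right_zero[OF J0] by blast
  qed (use le in auto)
  then have "(\<lambda>N. Lp_norm p equi_triangle (\<lambda>z. partial_sum N f z - f z)) \<longlonglongrightarrow> 0"
    unfolding Lp_norm_def using p by (intro tendsto_zero_powrI[where b = "1 / p"]) auto
  then show ?thesis
    using assms(2) PL by (simp add: converges_in_Lp_def Lp_space_def Lp_fun_def)
qed

end
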